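(* Consider the Exponential-Inverse-Gamma prior model described in the context, with $0<d<1$ and a fixed matrix $\boldsymbol{\Sigma}$ with $0<\lambda_{\min}(\boldsymbol{\Sigma})\le\lambda_{\max}(\boldsymbol{\Sigma})<\infty$. Let $(q_n)$ be positive integers with $q_n=o(n)$, and let $c_n=(q_n/n)^{(1+\epsilon_n)/d}$ with $\epsilon_n=1/\log(\log(n/q_n))$ (for $n$ large). Then $$\lim_{n\to\infty}\ \sup_{\{\boldsymbol{\theta}_{0i}\}\in L_0[q_n]}E_{\{\boldsymbol{\theta}_{0i}\}}\,\Pi\Big(\sum_{i=1}^n\lVert\boldsymbol{\theta}_i-\widehat{\boldsymbol{\theta}}^{EIG}_i\rVert_\Sigma^2>q_n\log\big(\tfrac{n}{q_n}\big)\ \Big|\ \{\boldsymbol{X}_i\}\Big)=0,$$ and $$\limsup_{n\to\infty}\ \sup_{\{\boldsymbol{\theta}_{0i}\}\in L_0[q_n]}E_{\{\boldsymbol{\theta}_{0i}\}}\,\Pi\Big(\sum_{i=1}^n\lVert\boldsymbol{\theta}_i-\boldsymbol{\theta}_{0i}\rVert_\Sigma^2>M_nq_n\log\big(\tfrac{n}{q_n}\big)\ \Big|\ \{\boldsymbol{X}_i\}\Big)=0$$ for any sequence $\{M_n\}$ such that $\lim_{n\to\infty}M_n=\infty$.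
   Context: Exponential-Inverse-Gamma model (dimension $k\ge1$ fixed): $\boldsymbol{X}_i\mid\boldsymbol{\theta}_i\sim N_k(\boldsymbol{\theta}_i,\boldsymbol{\Sigma})$ independently, $i=1,\dots,n$, with $\boldsymbol{\Sigma}$ known positive definite; $\boldsymbol{\theta}_i\mid\lambda_i^2,\tau_i\sim N_k(\boldsymbol{0},\lambda_i^2\tau_i\boldsymbol{\Sigma})$ independently; all $\lambda_i^2$ and $\tau_i$, $i=1,\dots,n$, are mutually independent, with densities on $(0,\infty)$ $\pi(\lambda_i^2)\propto\exp(-\lambda_i^2/2)$ and $\pi(\tau_i)\propto\exp(-c_n/(2\tau_i))\,\tau_i^{-d-1}$, where $c_n>0$, $c_n\to0$ and $0<d<1$. The estimator is the posterior mean $\widehat{\boldsymbol{\theta}}^{EIG}_i=E(\boldsymbol{\theta}_i\mid\boldsymbol{X}_i)$. $\Pi(\cdot\mid\{\boldsymbol{X}_i\})$ is the posterior distribution of $\{\boldsymbol{\theta}_i\}_{i=1}^n$. Mahalanobis norm: $\lVert\boldsymbol{x}\rVert_\Sigma^2=\boldsymbol{x}^T\boldsymbol{\Sigma}^{-1}\boldsymbol{x}$. Nearly-black means: $L_0[q_n]=\{\{\boldsymbol{\theta}_{0i}\}_{i=1}^n:\boldsymbol{\theta}_{0i}\in\mathbb{R}^k,\ \sum_{i=1}^n\mathbf{1}(\boldsymbol{\theta}_{0i}\ne\boldsymbol{0})\le q_n\}$. $E_{\{\boldsymbol{\theta}_{0i}\}}$ denotes expectation when $\boldsymbol{X}_i\sim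 N_k(\boldsymbol{\theta}_{0i},\boldsymbol{\Sigma})$ independently. $\lambda_{\min},\lambda_{\max}$ are the smallest and largest eigenvalues. *)

theory Defs
  imports "HOL-Probability.Probability"
begin

definition pos_def_mat :: "real^'k^'k \<Rightarrow> bool" where
  "pos_def_mat S \<longleftrightarrow> transpose S = S \<and> (\<forall>x. x \<noteq> 0 \<longrightarrow> x \<bullet> (S *v x) > 0)"

definition eigenvals :: "real^'k^'k \<Rightarrow> real set" where
  "eigenvals S = {l. \<exists>v. v \<noteq> 0 \<and> S *v v = l *\<^sub>R v}"

text \<open>The spectrum of a real symmetric matrix is real, finite and nonempty, so that
  \<open>Min\<close> and \<open>Max\<close> below are meaningful for the matrices considered here.\<close>

definition lambda_min :: "real^'k^'k \<Rightarrow> real" where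
  "lambda_min S = Min (eigenvals S)"

definition lambda_max :: "real^'k^'k \<Rightarrow> real" where
  "lambda_max S = Max (eigenvals S)"

definition mahalanobis :: "real^'k^'k \<Rightarrow> real^'k \<Rightarrow> real" where
  "mahalanobis S x = sqrt (x \<bullet> (matrix_inv S *v x))"

definition mvn_density :: "real^'k \<Rightarrow> real^'k^'k \<Rightarrow> real^'k \<Rightarrow> real" where
  "mvn_density \<mu> S x =
     exp (- ((x - \<mu>) \<bullet> (matrix_inv S *v (x - \<mu>))) / 2) / sqrt ((2 * pi) ^ CARD('k) * det S)"

definition mvn :: "real^'k \<Rightarrow> real^'k^'k \<Rightarrow> (real^'k) measure" where
  "mvn \<mu> S = density lborel (\<lambda>x. ennreal (mvn_density \<mu> S x))"

text \<open>The factor \<open>(c/2)\<^sup>d / \<Gamma>(d)\<close> normalises \<open>t\<^sup>-\<^sup>d\<^sup>-\<^sup>1 exp (-c/(2t))\<close> on \<open>(0,\<infinity>)\<close>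
  (substitute \<open>s = c/(2t)\<close>).\<close>

definition inv_gamma_density :: "real \<Rightarrow> real \<Rightarrow> real \<Rightarrow> real" where
  "inv_gamma_density d c t =
     (if t \<le> 0 then 0
      else (c / 2) powr d / Gamma d * (exp (- c / (2 * t)) * t powr (- d - 1)))"

text \<open>Joint law of \<open>((\<lambda>\<^sup>2, \<tau>), \<theta>)\<close> for a single index: \<open>\<lambda>\<^sup>2\<close> and \<open>\<tau>\<close> are independent
  (\<open>\<lambda>\<^sup>2\<close> exponential with rate \<open>1/2\<close>) and, given them, \<open>\<theta>\<close> is normal with covariance
  \<open>\<lambda>\<^sup>2 \<tau> S\<close>.\<close>

definition eig_joint_prior ::
    "real \<Rightarrow> real \<Rightarrow> real^'k^'k \<Rightarrow> ((real \<times> real) \<times> (real^'k)) measure" where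
  "eig_joint_prior d c S =
     density
       ((density lborel (\<lambda>l. ennreal (exponential_density (1/2) l)) \<Otimes>\<^sub>M
         density lborel (\<lambda>t. ennreal (inv_gamma_density d c t))) \<Otimes>\<^sub>M lborel)
       (\<lambda>((l, t), \<theta>). ennreal (mvn_density 0 ((l * t) *\<^sub>R S) \<theta>))"

definition eig_prior :: "real \<Rightarrow> real \<Rightarrow> real^'k^'k \<Rightarrow> (real^'k) measure" where
  "eig_prior d c S = distr (eig_joint_prior d c S) borel snd"

text \<open>Bayes' formula: posterior for the prior \<open>P\<close> and the likelihood \<open>L\<close> of the observed data,
  as a function of the parameter. The likelihoods used here are positive and bounded, so this
  version of the posterior is defined for every value of the data.\<close>

definition bayes_posterior :: "'p measure \<Rightarrow> ('p \<Rightarrow> real) \<Rightarrow> 'p measure" where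
  "bayes_posterior P L = density P (\<lambda>\<theta>. ennreal (L \<theta> / (LINT \<theta>'|P. L \<theta>')))"

definition eig_posterior ::
    "real \<Rightarrow> real \<Rightarrow> real^'k^'k \<Rightarrow> nat \<Rightarrow> (nat \<Rightarrow> real^'k) \<Rightarrow> (nat \<Rightarrow> real^'k) measure" where
  "eig_posterior d c S n X =
     bayes_posterior (\<Pi>\<^sub>M i\<in>{1..n}. eig_prior d c S) (\<lambda>\<theta>. \<Prod>i=1..n. mvn_density (\<theta> i) S (X i))"

text \<open>\<open>E(\<theta>\<^sub>i | X\<^sub>i)\<close>, as a function of the value \<open>x\<close> of \<open>X\<^sub>i\<close>.\<close>

definition eig_estimator :: "real \<Rightarrow> real \<Rightarrow> real^'k^'k \<Rightarrow> real^'k \<Rightarrow> real^'k" where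
  "eig_estimator d c S x =
     (LINT \<theta>|bayes_posterior (eig_prior d c S) (\<lambda>\<theta>. mvn_density \<theta> S x). \<theta>)"

definition data_law :: "real^'k^'k \<Rightarrow> nat \<Rightarrow> (nat \<Rightarrow> real^'k) \<Rightarrow> (nat \<Rightarrow> real^'k) measure" where
  "data_law S n \<theta>\<^sub>0 = (\<Pi>\<^sub>M i\<in>{1..n}. mvn (\<theta>\<^sub>0 i) S)"

definition nearly_black :: "nat \<Rightarrow> nat \<Rightarrow> (nat \<Rightarrow> real^'k) set" where
  "nearly_black n q =
     {\<theta>\<^sub>0 \<in> {1..n} \<rightarrow>\<^sub>E UNIV. (\<Sum>i=1..n. of_bool (\<theta>\<^sub>0 i \<noteq> 0)) \<le> q}"

end

theory Submission
  imports Defs "HOL-Real_Asymp.Real_Asymp"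
begin

text \<open>Let \<open>L = ln (n / q)\<close> with \<open>q = q n\<close> and \<open>c = c n\<close>, and let \<open>\<parallel>x\<parallel>\<close> be the Mahalanobis norm. The posterior is a
  product over the indices, so that by Markov's inequality both claims follow from bounds for a single mean:
  the expected posterior second moment has to be \<open>o (q L / n)\<close> at a zero mean, and at a nonzero mean the
  expected posterior spread has to be \<open>o (L)\<close> around the posterior mean and \<open>O (L)\<close> around the truth, uniformly
  over all means.

  The variance factor \<open>\<lambda>\<^sup>2 \<tau>\<close> has the density \<open>d c\<^sup>d (u + c) powr (- d - 1)\<close> (\<open>eig_prior_mixture\<close>). Shifting \<open>u\<close> by \<open>1\<close>
  changes this density by a factor of at most \<open>(2 / c) powr (d + 1)\<close>, and in the marginal likelihood the same
  shift halves the precision of the observation. Hence the posterior mean of \<open>exp (\<parallel>x - \<theta>\<parallel>\<^sup>2 / 4)\<close> is at most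
  a constant times a power of \<open>1 / c\<close>, and by Jensen's inequality the posterior mean of \<open>\<parallel>x - \<theta>\<parallel>\<^sup>2\<close> is
  \<open>O (ln (1 / c))\<close>, uniformly in the observation \<open>x\<close> (\<open>post_residual\<close>). As \<open>ln (1 / c)\<close> is of order \<open>L\<close>, this
  settles the error at nonzero means (\<open>post_err_risk\<close>).

  At a zero mean, the density of the observation divided by its marginal likelihood is bounded. Tonelli's
  theorem therefore turns the expected posterior second moment, restricted to observations of norm
  \<open>O (sqrt L)\<close>, into a truncated second moment of the prior, which is \<open>O (c\<^sup>d L)\<close>; larger observations are too
  rare to matter (\<open>null_risk\<close>). Here \<open>n c\<^sup>d = q exp (- L / ln L)\<close>, and the factor \<open>exp (- L / ln L)\<close>, which comes
  from the \<open>\<epsilon> n\<close> in the exponent of \<open>c\<close>, turns \<open>O (q L)\<close> into \<open>o (q L)\<close>.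

  For the spread around the posterior mean at a nonzero mean the pointwise bound \<open>O (L)\<close> is not enough, and
  its order is attained near the detection threshold. However, the posterior variance is the derivative of
  the posterior mean with respect to the observation. Averaging over the observation, integration by parts
  moves this derivative to the Gaussian density, and there remains only the size of the score, the posterior
  mean of \<open>\<theta> - x\<close>, which is \<open>O (sqrt L)\<close> by the residual bound (\<open>post_var_risk\<close>). The integration by parts is
  carried out for difference quotients, whose limit is controlled by Fatou's lemma, so that nothing has to
  be differentiated under an integral sign.\<close>

section \<open>Whitening and the Gaussian integral\<close>

text \<open>Gram-Schmidt orthonormalisation with respect to the inner product \<open>(x, y) \<mapsto> x \<bullet> Q y\<close>: an
  orthonormal family of maximal size has \<open>CARD('k)\<close> members, for otherwise some vector lies outside its
  span, and subtracting the projection of that vector enlarges the family.\<close>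

lemma pos_def_orthonormal_extend:
  fixes Q :: "real^'k^'k"
  assumes Q: "pos_def_mat Q" and "m \<le> CARD('k)"
  shows "\<exists>B. finite B \<and> card B = m \<and> (\<forall>x\<in>B. \<forall>y\<in>B. x \<bullet> (Q *v y) = of_bool (x = y))"
  using assms(2)
proof (induction m)
  case 0
  show ?case by (intro exI[of _ "{}"]) auto
next
  case (Suc m)
  then obtain B where B: "finite B" "card B = m"
    and on: "\<And>x y. x \<in> B \<Longrightarrow> y \<in> B \<Longrightarrow> x \<bullet> (Q *v y) = of_bool (x = y)" by auto
  have sym: "x \<bullet> (Q *v y) = y \<bullet> (Q *v x)" for x y
    using Q unfolding pos_def_mat_def by (metis dot_lmul_matrix inner_commute transpose_matrix_vector)
  have pos: "x \<noteq> 0 \<Longrightarrow> x \<bullet> (Q *v x) > 0" for x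
    using Q unfolding pos_def_mat_def by auto
  have "dim B \<le> m" using B by (metis dim_le_card span_superset)
  moreover have "dim (UNIV :: (real^'k) set) = CARD('k)" by simp
  ultimately have "span B \<noteq> UNIV" using Suc.prems by (metis dim_span not_less_eq_eq)
  then obtain w where w: "w \<notin> span B" by auto
  define v where "v = w - (\<Sum>b\<in>B. (b \<bullet> (Q *v w)) *\<^sub>R b)"
  have "(\<Sum>b\<in>B. (b \<bullet> (Q *v w)) *\<^sub>R b) \<in> span B" by (intro span_sum span_scale span_base)
  then have "v \<noteq> 0" using w unfolding v_def by auto
  then have nv: "v \<bullet> (Q *v v) > 0" by (rule pos)
  have orth: "b \<bullet> (Q *v v) = 0" if "b \<in> B" for b
  proof -
    have "b \<bullet> (Q *v v) = b \<bullet> (Q *v w) - (\<Sum>a\<in>B. (a \<bullet> (Q *v w)) * (b \<bullet> (Q *v a)))"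
      unfolding v_def
      by (simp add: matrix_vector_mult_diff_distrib inner_diff_right inner_sum_right
          matrix_vector_mult_scaleR linear_sum[OF matrix_vector_mul_linear])
    also have "(\<Sum>a\<in>B. (a \<bullet> (Q *v w)) * (b \<bullet> (Q *v a))) = (\<Sum>a\<in>B. if a = b then b \<bullet> (Q *v w) else 0)"
      using on[OF that] by (intro sum.cong) auto
    finally show ?thesis using that B by simp
  qed
  define u where "u = (1 / sqrt (v \<bullet> (Q *v v))) *\<^sub>R v"
  have uu: "u \<bullet> (Q *v u) = 1" using nv by (simp add: u_def matrix_vector_mult_scaleR)
  have ub: "b \<bullet> (Q *v u) = 0" if "b \<in> B" for b using orth[OF that] by (simp add: u_def matrix_vector_mult_scaleR)
  have nu: "u \<notin> B" using ub uu by force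
  show ?case
  proof (intro exI[of _ "insert u B"] conjI ballI)
    show "card (insert u B) = Suc m" using B nu by simp
    fix x y assume "x \<in> insert u B" "y \<in> insert u B"
    then consider "x = u" "y = u" | "x = u" "y \<in> B" | "x \<in> B" "y = u" | "x \<in> B" "y \<in> B" by auto
    then show "x \<bullet> (Q *v y) = of_bool (x = y)"
    proof cases
      case 2 then show ?thesis using ub[of y] sym[of u y] nu by (metis of_bool_eq(1))
    next
      case 3 then show ?thesis using ub[of x] nu by (metis of_bool_eq(1))
    qed (use uu on in simp_all)
  qed (use B in auto)
qed

lemma pos_def_congruent_identity:
  fixes Q :: "real^'k^'k"
  assumes Q: "pos_def_mat Q"
  obtains A :: "real^'k^'k" where "transpose A ** Q ** A = mat 1"
proof -
  obtain B where B: "finite B" "card B = CARD('k)"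
    and on: "\<And>x y. x \<in> B \<Longrightarrow> y \<in> B \<Longrightarrow> x \<bullet> (Q *v y) = of_bool (x = y)"
    using pos_def_orthonormal_extend[OF Q order_refl] by auto
  obtain f :: "'k \<Rightarrow> real^'k" where f: "bij_betw f UNIV B"
    using finite_same_card_bij[of "UNIV :: 'k set" B] B by auto
  have inB: "f i \<in> B" for i using f by (auto simp: bij_betw_def)
  have inj: "f i = f j \<longleftrightarrow> i = j" for i j using f by (auto simp: bij_betw_def inj_on_def)
  define A where "A = transpose (\<chi> i. f i)"
  have col: "A *v axis j 1 = f j" for j
    by (simp add: A_def matrix_vector_mult_basis column_def transpose_def vec_eq_iff)
  have "(transpose A ** Q ** A) $ i $ j = (mat 1 :: real^'k^'k) $ i $ j" for i j
  proof -
    have "(transpose A ** Q ** A) $ i $ j = axis i 1 \<bullet> ((transpose A ** Q ** A) *v axis j 1)"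
      by (simp add: matrix_vector_mult_basis column_def inner_axis')
    also have "\<dots> = (A *v axis i 1) \<bullet> (Q *v (A *v axis j 1))"
      by (metis dot_lmul_matrix matrix_vector_mul_assoc transpose_matrix_vector transpose_transpose)
    also have "\<dots> = of_bool (i = j)" by (simp add: col on inB inj)
    finally show ?thesis by (simp add: mat_def)
  qed
  then have "transpose A ** Q ** A = mat 1" by (simp add: vec_eq_iff)
  then show thesis by (rule that)
qed


lemma nn_integral_translate:
  fixes f :: "'a::euclidean_space \<Rightarrow> ennreal"
  assumes [measurable]: "f \<in> borel_measurable borel"
  shows "(\<integral>\<^sup>+x. f (x + t) \<partial>lborel) = (\<integral>\<^sup>+x. f x \<partial>lborel)"
proof -
  have "(\<integral>\<^sup>+x. f x \<partial>distr lborel borel ((+) t)) = (\<integral>\<^sup>+x. f (t + x) \<partial>lborel)"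
    by (subst nn_integral_distr) auto
  then show ?thesis by (simp add: lborel_distr_plus add.commute)
qed

text \<open>A rank-one perturbation of the identity: translating along \<open>v\<close> and averaging over the
  translations with the weight \<open>g\<close> reduces the claim to Tonelli and a substitution on the line.\<close>

lemma nn_integral_rank_one:
  fixes f :: "'a::euclidean_space \<Rightarrow> ennreal" and a v :: 'a
  assumes [measurable]: "f \<in> borel_measurable borel" and b: "1 + a \<bullet> v \<noteq> 0"
  shows "ennreal \<bar>1 + a \<bullet> v\<bar> * (\<integral>\<^sup>+x. f (x + (a \<bullet> x) *\<^sub>R v) \<partial>lborel) = (\<integral>\<^sup>+x. f x \<partial>lborel)"
proof -
  define \<beta> where "\<beta> = 1 + a \<bullet> v"
  define g :: "real \<Rightarrow> ennreal" where "g = indicator {0..1}"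
  have [measurable]: "g \<in> borel_measurable borel" unfolding g_def by simp
  have g1: "(\<integral>\<^sup>+s. g s \<partial>lborel) = 1" unfolding g_def by simp
  have \<beta>: "\<beta> \<noteq> 0" using b \<beta>_def by simp
  have "ennreal \<bar>\<beta>\<bar> * (\<integral>\<^sup>+x. f (x + (a \<bullet> x) *\<^sub>R v) \<partial>lborel)
      = ennreal \<bar>\<beta>\<bar> * (\<integral>\<^sup>+s. g s * (\<integral>\<^sup>+x. f (x + (a \<bullet> x) *\<^sub>R v) \<partial>lborel) \<partial>lborel)"
    by (subst nn_integral_multc) (auto simp: g1)
  also have "\<dots> = ennreal \<bar>\<beta>\<bar> * (\<integral>\<^sup>+s. (\<integral>\<^sup>+x. g s * f ((x + s *\<^sub>R v) + (a \<bullet> (x + s *\<^sub>R v)) *\<^sub>R v) \<partial>lborel) \<partial>lborel)"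
  proof -
    have "(\<integral>\<^sup>+x. g s * f ((x + s *\<^sub>R v) + (a \<bullet> (x + s *\<^sub>R v)) *\<^sub>R v) \<partial>lborel)
        = g s * (\<integral>\<^sup>+x. f (x + (a \<bullet> x) *\<^sub>R v) \<partial>lborel)" for s
      by (subst nn_integral_cmult)
         (auto intro!: arg_cong2[where f="(*)"] nn_integral_translate[of "\<lambda>x. f (x + (a \<bullet> x) *\<^sub>R v)"])
    then show ?thesis by simp
  qed
  also have "\<dots> = ennreal \<bar>\<beta>\<bar> * (\<integral>\<^sup>+s. (\<integral>\<^sup>+x. g s * f (x + (a \<bullet> x + \<beta> * s) *\<^sub>R v) \<partial>lborel) \<partial>lborel)"
    by (simp add: \<beta>_def algebra_simps)
  also have "\<dots> = ennreal \<bar>\<beta>\<bar> * (\<integral>\<^sup>+x. (\<integral>\<^sup>+s. g s * f (x + (a \<bullet> x + \<beta> * s) *\<^sub>R v) \<partial>lborel) \<partial>lborel)"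
    by (subst lborel_pair.Fubini') auto
  also have "\<dots> = (\<integral>\<^sup>+x. (\<integral>\<^sup>+s. g ((s - a \<bullet> x) / \<beta>) * f (x + s *\<^sub>R v) \<partial>lborel) \<partial>lborel)"
  proof -
    have "(\<integral>\<^sup>+s. g ((s - a \<bullet> x) / \<beta>) * f (x + s *\<^sub>R v) \<partial>lborel)
       = ennreal \<bar>\<beta>\<bar> * (\<integral>\<^sup>+s. g s * f (x + (a \<bullet> x + \<beta> * s) *\<^sub>R v) \<partial>lborel)" for x
      by (subst nn_integral_real_affine[where t="a \<bullet> x" and c=\<beta>]) (use \<beta> in auto)
    then show ?thesis by (subst nn_integral_cmult[symmetric]) auto
  qed
  also have "\<dots> = (\<integral>\<^sup>+s. (\<integral>\<^sup>+x. g ((s - a \<bullet> x) / \<beta>) * f (x + s *\<^sub>R v) \<partial>lborel) \<partial>lborel)"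
    by (subst lborel_pair.Fubini') auto
  also have "\<dots> = (\<integral>\<^sup>+s. (\<integral>\<^sup>+x. g (s - (a \<bullet> x) / \<beta>) * f x \<partial>lborel) \<partial>lborel)"
  proof -
    have "(\<integral>\<^sup>+x. g ((s - a \<bullet> x) / \<beta>) * f (x + s *\<^sub>R v) \<partial>lborel)
        = (\<integral>\<^sup>+x. g (s - (a \<bullet> (x + s *\<^sub>R v)) / \<beta>) * f (x + s *\<^sub>R v) \<partial>lborel)" for s
    proof -
      have "(s - a \<bullet> x) / \<beta> = s - (a \<bullet> (x + s *\<^sub>R v)) / \<beta>" for x
      proof -
        have "s = s * \<beta> / \<beta>" using \<beta> by simp
        then have "s - (a \<bullet> (x + s *\<^sub>R v)) / \<beta> = (s * \<beta> - a \<bullet> (x + s *\<^sub>R v)) / \<beta>"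
          by (metis diff_divide_distrib)
        also have "s * \<beta> - a \<bullet> (x + s *\<^sub>R v) = s - a \<bullet> x" by (simp add: \<beta>_def algebra_simps)
        finally show ?thesis by simp
      qed
      then show ?thesis by simp
    qed
    also have "\<dots> s = (\<integral>\<^sup>+x. g (s - (a \<bullet> x) / \<beta>) * f x \<partial>lborel)" for s
      by (rule nn_integral_translate) auto
    finally show ?thesis by simp
  qed
  also have "\<dots> = (\<integral>\<^sup>+x. (\<integral>\<^sup>+s. g (s - (a \<bullet> x) / \<beta>) * f x \<partial>lborel) \<partial>lborel)"
    by (subst lborel_pair.Fubini') auto
  also have "\<dots> = (\<integral>\<^sup>+x. f x \<partial>lborel)"
  proof -
    have "(\<integral>\<^sup>+s. g (s - (a \<bullet> x) / \<beta>) * f x \<partial>lborel) = f x" for x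
    proof -
      have "(\<integral>\<^sup>+s. g (s + (- (a \<bullet> x) / \<beta>)) \<partial>lborel) = 1"
        by (subst nn_integral_translate) (auto simp: g1)
      then show ?thesis by (subst nn_integral_multc) auto
    qed
    then show ?thesis by simp
  qed
  finally show ?thesis unfolding \<beta>_def .
qed

text \<open>Every square matrix is a product of matrices with a zero row, diagonal matrices, transpositions and
  shears; the last two kinds are rank-one perturbations of the identity.\<close>

lemma nn_integral_lborel_matrix:
  fixes A :: "real^'k^'k" and f :: "real^'k \<Rightarrow> ennreal"
  assumes "invertible A" and "f \<in> borel_measurable borel"
  shows "ennreal \<bar>det A\<bar> * (\<integral>\<^sup>+x. f (A *v x) \<partial>lborel) = (\<integral>\<^sup>+x. f x \<partial>lborel)"
proof -
  define P where "P A \<longleftrightarrow> invertible A \<longrightarrow> (\<forall>f\<in>borel_measurable borel. 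
     ennreal \<bar>det A\<bar> * (\<integral>\<^sup>+x. f (A *v x) \<partial>lborel) = (\<integral>\<^sup>+x. f x \<partial>lborel))" for A :: "real^'k^'k"
  have mv[measurable]: "((*v) A) \<in> borel_measurable borel" for A :: "real^'k^'k"
    by (intro borel_measurable_continuous_onI matrix_vector_mult_linear_continuous_on)
  have "P A"
  proof (rule induct_matrix_elementary_alt)
    fix A B :: "real^'k^'k" assume P: "P A" "P B"
    show "P (A ** B)" unfolding P_def
    proof (intro impI ballI)
      fix f :: "real^'k \<Rightarrow> ennreal" assume f[measurable]: "f \<in> borel_measurable borel" and "invertible (A ** B)"
      then have inv: "invertible A" "invertible B" by (auto simp: invertible_det_nz det_mul)
      have "ennreal \<bar>det (A ** B)\<bar> * (\<integral>\<^sup>+x. f ((A ** B) *v x) \<partial>lborel)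
        = ennreal \<bar>det A\<bar> * (ennreal \<bar>det B\<bar> * (\<integral>\<^sup>+x. f (A *v (B *v x)) \<partial>lborel))"
        by (simp add: det_mul abs_mult ennreal_mult mult.assoc matrix_vector_mul_assoc)
      also have "ennreal \<bar>det B\<bar> * (\<integral>\<^sup>+x. f (A *v (B *v x)) \<partial>lborel) = (\<integral>\<^sup>+x. f (A *v x) \<partial>lborel)"
        using P(2) inv unfolding P_def by (auto dest!: bspec[where x="\<lambda>x. f (A *v x)"])
      also have "ennreal \<bar>det A\<bar> * \<dots> = (\<integral>\<^sup>+x. f x \<partial>lborel)"
        using P(1) inv f unfolding P_def by auto
      finally show "ennreal \<bar>det (A ** B)\<bar> * (\<integral>\<^sup>+x. f ((A ** B) *v x) \<partial>lborel) = (\<integral>\<^sup>+x. f x \<partial>lborel)" .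
    qed
  next
    fix A :: "real^'k^'k" and i assume "row i A = 0"
    then show "P A" unfolding P_def by (auto simp: invertible_det_nz dest: det_zero_row)
  next
    fix A :: "real^'k^'k" assume dg: "\<And>i j. i \<noteq> j \<Longrightarrow> A $ i $ j = 0"
    show "P A" unfolding P_def
    proof (intro impI ballI)
      fix f :: "real^'k \<Rightarrow> ennreal" assume f[measurable]: "f \<in> borel_measurable borel" and "invertible A"
      have dt: "det A = (\<Prod>i\<in>UNIV. A $ i $ i)" by (rule det_diagonal) (auto simp: dg)
      have nz: "A $ i $ i \<noteq> 0" for i using \<open>invertible A\<close> dt by (auto simp: invertible_det_nz)
      define c where "c = (\<lambda>b::real^'k. b \<bullet> (A *v b))"
      have cax: "c (axis i 1) = A $ i $ i" for i
        by (simp add: c_def matrix_vector_mult_basis column_def inner_axis')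
      have B: "Basis = (\<lambda>i. axis i 1 :: real^'k) ` UNIV" by (auto simp: Basis_vec_def)
      have inj: "inj (\<lambda>i. axis i 1 :: real^'k)" by (auto simp: inj_on_def axis_eq_axis)
      have T: "A *v x = (\<Sum>j\<in>Basis. (c j * (x \<bullet> j)) *\<^sub>R j)" for x
      proof -
        have "(\<Sum>j\<in>Basis. (c j * (x \<bullet> j)) *\<^sub>R j) = (\<Sum>i\<in>UNIV. (A $ i $ i * (x $ i)) *\<^sub>R axis i 1)"
          unfolding B by (subst sum.reindex[OF inj]) (simp add: cax inner_axis)
        moreover have "(A *v x) $ i = A $ i $ i * x $ i" for i
          unfolding matrix_vector_mult_def by (simp add: dg comm_monoid_add_class.sum.remove[where x=i])
        moreover have "(\<Sum>i\<in>UNIV. (A $ i $ i * (x $ i)) *\<^sub>R axis i 1) $ j = A $ j $ j * x $ j" for j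
        proof -
          have "(\<Sum>i\<in>UNIV. (A $ i $ i * (x $ i)) *\<^sub>R axis i (1::real)) $ j
             = (\<Sum>i\<in>UNIV. if i = j then A $ i $ i * x $ i else 0)"
            by (simp only: sum_component) (intro sum.cong, auto simp: axis_def)
          then show ?thesis by simp
        qed
        ultimately show ?thesis by (simp add: vec_eq_iff)
      qed
      have "(\<integral>\<^sup>+x. f x \<partial>lborel) = (\<integral>\<^sup>+x. f x \<partial>density (distr lborel borel (\<lambda>x. 0 + (\<Sum>j\<in>Basis. (c j * (x \<bullet> j)) *\<^sub>R j))) (\<lambda>_. (\<Prod>j\<in>Basis. \<bar>c j\<bar>)))"
        by (subst lborel_affine_euclidean[of c 0]) (auto simp: B cax nz)
      also have "\<dots> = ennreal (\<Prod>j\<in>Basis. \<bar>c j\<bar>) * (\<integral>\<^sup>+x. f (A *v x) \<partial>lborel)"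
        by (simp add: nn_integral_density nn_integral_distr T nn_integral_cmult)
      also have "(\<Prod>j\<in>Basis. \<bar>c j\<bar>) = \<bar>det A\<bar>"
        unfolding B by (subst prod.reindex[OF inj]) (simp add: cax dt abs_prod)
      finally show "ennreal \<bar>det A\<bar> * (\<integral>\<^sup>+x. f (A *v x) \<partial>lborel) = (\<integral>\<^sup>+x. f x \<partial>lborel)" by simp
    qed
  next
    fix m n :: 'k assume mn: "m \<noteq> n"
    let ?A = "(\<chi> i j. mat 1 $ i $ Transposition.transpose m n j) :: real^'k^'k"
    let ?v = "axis m 1 - axis n 1 :: real^'k"
    have 1: "?A *v x = x + ((- ?v) \<bullet> x) *\<^sub>R ?v" for x
    proof -
      have "(?A *v x) $ i = x $ Transposition.transpose m n i" for i
      proof -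
        have "(?A *v x) $ i = (\<Sum>j\<in>UNIV. if j = Transposition.transpose m n i then x $ j else 0)"
        proof -
          have "i = Transposition.transpose m n j \<longleftrightarrow> j = Transposition.transpose m n i" for j
            by (metis transpose_involutory)
          then show ?thesis by (simp add: matrix_vector_mult_def mat_def if_distrib[where f="\<lambda>t. t * y" for y] cong: if_cong)
        qed
        then show ?thesis by simp
      qed
      moreover have "(- ?v) \<bullet> x = x $ n - x $ m" by (simp add: inner_diff_left inner_axis')
      ultimately show ?thesis using mn
        by (simp only: vec_eq_iff) (auto simp: axis_def Transposition.transpose_def)
    qed
    have 2: "1 + (- ?v) \<bullet> ?v = - 1" using mn by (simp add: inner_diff_left inner_diff_right inner_axis_axis)
    have 3: "\<bar>det ?A\<bar> = 1" 
      by (simp add: det_permute_columns permutes_swap_id sign_swap_id abs_mult)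
    show "P ?A" unfolding P_def
    proof (intro impI ballI)
      fix f :: "real^'k \<Rightarrow> ennreal" assume f: "f \<in> borel_measurable borel"
      show "ennreal \<bar>det ?A\<bar> * (\<integral>\<^sup>+x. f (?A *v x) \<partial>lborel) = (\<integral>\<^sup>+x. f x \<partial>lborel)"
        using nn_integral_rank_one[OF f, of "- ?v" ?v] unfolding 1 2 3 by simp
    qed
  next
    fix m n :: 'k assume mn: "m \<noteq> n"
    let ?A = "(\<chi> i j. of_bool (i = m \<and> j = n \<or> i = j)) :: real^'k^'k"
    have 1: "?A *v x = x + (axis n 1 \<bullet> x) *\<^sub>R axis m 1" for x
    proof -
      have "(?A *v x) $ i = (\<Sum>j\<in>UNIV. (if j = i then x $ j else 0) + (if j = n then (if i = m then x $ j else 0) else 0))" for i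
        unfolding matrix_vector_mult_def using mn by (auto intro!: sum.cong)
      moreover have "axis n 1 \<bullet> x = x $ n" by (simp add: inner_axis')
      ultimately show ?thesis by (simp only: vec_eq_iff) (simp add: sum.distrib axis_def)
    qed
    have 2: "1 + axis n 1 \<bullet> (axis m 1 :: real^'k) = 1" using mn by (simp add: inner_axis_axis)
    have "?A = (\<chi> k. if k = m then row m (mat 1) + 1 *s row n (mat 1) else row k (mat 1))"
      using mn by (auto simp: vec_eq_iff row_def mat_def)
    then have 3: "det ?A = 1" by (simp only: det_row_operation[OF mn] det_I)
    show "P ?A" unfolding P_def
    proof (intro impI ballI)
      fix f :: "real^'k \<Rightarrow> ennreal" assume f: "f \<in> borel_measurable borel"
      show "ennreal \<bar>det ?A\<bar> * (\<integral>\<^sup>+x. f (?A *v x) \<partial>lborel) = (\<integral>\<^sup>+x. f x \<partial>lborel)"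
        using nn_integral_rank_one[OF f, of "axis n 1" "axis m 1"] unfolding 1 2 3 by simp
    qed
  qed
  then show ?thesis using assms unfolding P_def by auto
qed

lemma matrix_inv_props:
  fixes A :: "real^'k^'k"
  assumes "invertible A"
  shows "A ** matrix_inv A = mat 1" "matrix_inv A ** A = mat 1"
  using assms unfolding invertible_def matrix_inv_def by (metis (mono_tags, lifting) someI_ex)+

lemma matrix_inv_unique:
  fixes A :: "real^'k^'k"
  assumes "A ** B = mat 1"
  shows "matrix_inv A = B"
proof -
  have "B ** A = mat 1" using assms matrix_left_right_inverse by blast
  then have "invertible A" using assms unfolding invertible_def by blast
  then have "matrix_inv A = matrix_inv A ** (A ** B)" using assms by simp
  also have "\<dots> = B" using matrix_inv_props[OF \<open>invertible A\<close>] by (simp add: matrix_mul_assoc)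
  finally show ?thesis .
qed

lemma pos_def_whitening:
  fixes S :: "real^'k^'k"
  assumes S: "pos_def_mat S"
  obtains W :: "real^'k^'k" where "invertible W" "matrix_inv S = transpose W ** W" "(det W)\<^sup>2 * det S = 1"
proof -
  obtain A :: "real^'k^'k" where A: "transpose A ** S ** A = mat 1"
    using pos_def_congruent_identity[OF S] .
  then have A': "A ** (transpose A ** S) = mat 1" using matrix_left_right_inverse by blast
  have "S ** (A ** transpose A) = mat 1"
    using A A' by (metis matrix_left_right_inverse matrix_mul_assoc)
  then have inv: "matrix_inv S = A ** transpose A" by (rule matrix_inv_unique)
  have "det (transpose A ** S ** A) = 1" using A by simp
  then have d: "(det (transpose A))\<^sup>2 * det S = 1" by (simp add: det_mul power2_eq_square mult_ac)
  then have "invertible (transpose A)" by (auto simp: invertible_det_nz)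
  with inv d show thesis by (intro that[of "transpose A"]) simp_all
qed

text \<open>The matrix \<open>W\<close> carries the Mahalanobis norm to the Euclidean norm and the normal law with
  covariance \<open>S\<close> to the standard normal law.\<close>

locale whitened =
  fixes S W :: "real^'k^'k"
  assumes invertible_W: "invertible W"
    and matrix_inv_S: "matrix_inv S = transpose W ** W"
    and det_W_S: "(det W)\<^sup>2 * det S = 1"
begin

abbreviation msq :: "real^'k \<Rightarrow> real" where "msq x \<equiv> (norm (W *v x))\<^sup>2"

lemma quadratic_form: "x \<bullet> (matrix_inv S *v x) = msq x"
  unfolding matrix_inv_S power2_norm_eq_inner
  by (metis dot_lmul_matrix inner_commute matrix_vector_mul_assoc transpose_matrix_vector)

lemma mahalanobis_eq: "mahalanobis S x = norm (W *v x)"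
  unfolding mahalanobis_def quadratic_form by simp

lemma det_S_pos: "det S > 0"
proof (rule ccontr)
  assume "\<not> det S > 0"
  then have "(det W)\<^sup>2 * det S \<le> 0" by (intro mult_nonneg_nonpos) auto
  with det_W_S show False by simp
qed

lemma borel_measurable_W [measurable]: "(*v) W \<in> borel_measurable borel"
  by (intro borel_measurable_continuous_onI matrix_vector_mult_linear_continuous_on)

lemma borel_measurable_W_compose [measurable]:
  "f \<in> borel_measurable M \<Longrightarrow> (\<lambda>w. W *v f w) \<in> borel_measurable M"
  by (rule measurable_compose[OF _ borel_measurable_W])

lemma S_eq: "S ** (transpose W ** W) = mat 1"
proof -
  have "invertible S" using det_S_pos by (simp add: invertible_det_nz)
  then show ?thesis using matrix_inv_props[of S] matrix_inv_S by simp
qed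

lemma matrix_inv_scaled:
  assumes "u \<noteq> 0" shows "matrix_inv (u *\<^sub>R S) = (1 / u) *\<^sub>R matrix_inv S"
proof (rule matrix_inv_unique)
  show "u *\<^sub>R S ** (1 / u) *\<^sub>R matrix_inv S = mat 1"
    using assms S_eq matrix_inv_S by (simp add: matrix_scalar_ac scalar_matrix_assoc[symmetric])
qed

text \<open>After the substitution \<open>z = W x\<close> the integrand is a product over the coordinates.\<close>

lemma nn_integral_gaussian:
  assumes a: "a > 0"
  shows "(\<integral>\<^sup>+x. ennreal (exp (- a * msq x / 2)) \<partial>lborel)
    = ennreal (sqrt ((2 * pi / a) ^ CARD('k) * det S))"
proof -
  have g1: "(\<integral>\<^sup>+t. ennreal (exp (- a * t\<^sup>2 / 2)) \<partial>lborel) = ennreal (sqrt (2 * pi / a))"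
  proof -
    have "(\<integral>\<^sup>+t. ennreal (normal_density 0 (1 / sqrt a) t) \<partial>lborel) = 1"
      using prob_space.emeasure_space_1[OF prob_space_normal_density[of "1 / sqrt a" 0]] a
      by (simp add: emeasure_density)
    moreover have "normal_density 0 (1 / sqrt a) t = 1 / sqrt (2 * pi / a) * exp (- a * t\<^sup>2 / 2)" for t
      using a by (simp add: normal_density_def power_divide mult_ac)
    ultimately have e: "ennreal (1 / sqrt (2 * pi / a)) * (\<integral>\<^sup>+t. ennreal (exp (- a * t\<^sup>2 / 2)) \<partial>lborel) = 1"
      using a by (subst nn_integral_cmult[symmetric]) (auto simp: ennreal_mult'[symmetric])
    have "(\<integral>\<^sup>+t. ennreal (exp (- a * t\<^sup>2 / 2)) \<partial>lborel)
      = ennreal (sqrt (2 * pi / a)) * (ennreal (1 / sqrt (2 * pi / a)) * (\<integral>\<^sup>+t. ennreal (exp (- a * t\<^sup>2 / 2)) \<partial>lborel))"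
      using a by (simp add: mult.assoc[symmetric] ennreal_mult'[symmetric])
    then show ?thesis unfolding e by simp
  qed
  have "(\<integral>\<^sup>+z. ennreal (exp (- a * (norm z)\<^sup>2 / 2)) \<partial>(lborel :: (real^'k) measure))
      = (\<integral>\<^sup>+z. (\<Prod>b\<in>Basis. ennreal (exp (- a * (z \<bullet> b)\<^sup>2 / 2))) \<partial>(lborel :: (real^'k) measure))"
  proof (rule nn_integral_cong)
    fix z :: "real^'k"
    have "- a * (norm z)\<^sup>2 / 2 = (\<Sum>b\<in>Basis. - a * (z \<bullet> b)\<^sup>2 / 2)"
      unfolding power2_norm_eq_inner by (subst euclidean_inner) (simp add: power2_eq_square sum_distrib_left sum_divide_distrib sum_negf)
    then show "ennreal (exp (- a * (norm z)\<^sup>2 / 2)) = (\<Prod>b\<in>Basis. ennreal (exp (- a * (z \<bullet> b)\<^sup>2 / 2)))"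
      by (simp add: exp_sum prod_ennreal)
  qed
  also have "\<dots> = (\<Prod>b\<in>(Basis :: (real^'k) set). \<integral>\<^sup>+t. ennreal (exp (- a * t\<^sup>2 / 2)) \<partial>lborel)"
    by (rule nn_integral_lborel_prod) auto
  also have "\<dots> = ennreal (sqrt (2 * pi / a)) ^ CARD('k)" unfolding g1 by simp
  finally have g: "(\<integral>\<^sup>+z. ennreal (exp (- a * (norm z)\<^sup>2 / 2)) \<partial>(lborel :: (real^'k) measure))
     = ennreal (sqrt ((2 * pi / a) ^ CARD('k)))" using a by (simp add: ennreal_power real_sqrt_power)
  have "sqrt ((det W)\<^sup>2 * det S) = 1" unfolding det_W_S by simp
  then have dd: "sqrt (det S) * \<bar>det W\<bar> = 1" by (simp add: real_sqrt_mult mult.commute)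
  have "ennreal \<bar>det W\<bar> * (\<integral>\<^sup>+x. ennreal (exp (- a * msq x / 2)) \<partial>lborel)
     = ennreal (sqrt ((2 * pi / a) ^ CARD('k)))"
    using nn_integral_lborel_matrix[OF invertible_W, of "\<lambda>z. ennreal (exp (- a * (norm z)\<^sup>2 / 2))"] g by simp
  then have "ennreal (sqrt (det S)) * (ennreal \<bar>det W\<bar> * (\<integral>\<^sup>+x. ennreal (exp (- a * msq x / 2)) \<partial>lborel))
     = ennreal (sqrt (det S)) * ennreal (sqrt ((2 * pi / a) ^ CARD('k)))" by simp
  then show ?thesis
    using dd det_S_pos by (simp add: mult.assoc[symmetric] ennreal_mult'[symmetric] real_sqrt_mult mult.commute)
qed

end

section \<open>The law of the variance factor\<close>

text \<open>The substitution \<open>s = b / (2 t)\<close> leads to the Gamma integral.\<close>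

lemma inv_gamma_integral:
  fixes b p :: real
  assumes b: "b > 0" and p: "p > 0"
  shows "(\<integral>\<^sup>+t. ennreal (exp (- b / (2 * t)) * t powr (- p - 1)) * indicator {0<..} t \<partial>lborel)
    = ennreal (Gamma p * (2 / b) powr p)"
proof -
  let ?f = "\<lambda>s::real. s powr (p - 1) / exp s"
  let ?g = "\<lambda>t::real. b / (2 * t)"
  have "(?f has_integral Gamma p) {0..}" using Gamma_integral_real[OF p] .
  then have f: "(?f has_integral Gamma p) {0<..}"
    by (subst has_integral_spike_set_eq[of _ "{0..}"]) (auto intro: negligible_subset[of "{0}"])
  have img: "?g ` {0<..} = {0<..}"
  proof -
    have "y \<in> ?g ` {0<..}" if "y > 0" for y
      using that b by (intro image_eqI[of _ _ "b / (2 * y)"]) auto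
    then show ?thesis using b by auto
  qed
  have fi: "?f absolutely_integrable_on {0<..} \<and> integral {0<..} ?f = Gamma p"
    using f by (auto intro!: nonnegative_absolutely_integrable_1 simp: has_integral_iff)
  have "(\<lambda>t. \<bar>- b / (2 * t\<^sup>2)\<bar> * ?f (?g t)) absolutely_integrable_on {0<..} \<and>
    integral {0<..} (\<lambda>t. \<bar>- b / (2 * t\<^sup>2)\<bar> * ?f (?g t)) = Gamma p"
  proof (subst has_absolute_integral_change_of_variables_1'[where g="?g"])
    show "inj_on ?g {0<..}" using b by (auto simp: inj_on_def)
    show "(?g has_real_derivative - b / (2 * t\<^sup>2)) (at t within {0<..})" if "t \<in> {0<..}" for t
      using that by (auto intro!: derivative_eq_intros simp: power2_eq_square field_simps)
    show "?f absolutely_integrable_on ?g ` {0<..} \<and> integral (?g ` {0<..}) ?f = Gamma p"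
      using fi unfolding img .
  qed auto
  then have hi: "((\<lambda>t. \<bar>- b / (2 * t\<^sup>2)\<bar> * ?f (?g t)) has_integral Gamma p) {0<..}"
    by (auto simp: has_integral_iff absolutely_integrable_on_def)
  have eq: "\<bar>- b / (2 * t\<^sup>2)\<bar> * ?f (?g t) = (b / 2) powr p * (exp (- b / (2 * t)) * t powr (- p - 1))"
    if "t > 0" for t
  proof -
    have 1: "\<bar>- b / (2 * t\<^sup>2)\<bar> = (b / 2) * t powr (-2)"
      using b that by (simp add: powr_minus powr_numeral field_simps)
    have 2: "?f (?g t) = ((b / 2) powr (p - 1) * t powr (1 - p)) * exp (- b / (2 * t))"
      using b that by (simp add: powr_divide powr_mult exp_minus powr_diff field_simps)
    have 3: "(b / 2) * (b / 2) powr (p - 1) = (b / 2) powr p"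
      using b by (simp add: powr_diff)
    have 4: "t powr (-2) * t powr (1 - p) = t powr (- p - 1)"
    proof -
      have "(- 2) + (1 - p) = - p - 1" by simp
      then show ?thesis by (simp only: powr_add[symmetric])
    qed
    show ?thesis unfolding 1 2 3[symmetric] 4[symmetric] by (simp only: mult_ac)
  qed
  have hi2: "((\<lambda>t. exp (- b / (2 * t)) * t powr (- p - 1)) has_integral (Gamma p * (2 / b) powr p)) {0<..}"
  proof -
    have "((\<lambda>t. (b / 2) powr p * (exp (- b / (2 * t)) * t powr (- p - 1))) has_integral Gamma p) {0<..}"
      using hi by (rule has_integral_eq[rotated]) (use eq in auto)
    from has_integral_mult_right[OF this, of "(2 / b) powr p"]
    have *: "((\<lambda>t. (2 / b) powr p * ((b / 2) powr p * (exp (- b / (2 * t)) * t powr (- p - 1)))) has_integral (2 / b) powr p * Gamma p) {0<..}" .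
    have "(2 / b) powr p * (b / 2) powr p = 1" using b by (simp add: powr_mult[symmetric])
    then have "(2 / b) powr p * ((b / 2) powr p * y) = y" for y by (simp add: mult.assoc[symmetric])
    with * show ?thesis by (simp add: mult.commute)
  qed
  show ?thesis
    by (rule nn_integral_has_integral_lebesgue'[OF _ hi2]) auto
qed

text \<open>The density of \<open>\<lambda>\<^sup>2 \<tau>\<close>, a Lomax (shifted Pareto) density.\<close>

definition lomax_density :: "real \<Rightarrow> real \<Rightarrow> real \<Rightarrow> real" where
  "lomax_density d c u = (if u \<le> 0 then 0 else d * c powr d * (u + c) powr (- d - 1))"

lemma borel_measurable_lomax [measurable]: "lomax_density d c \<in> borel_measurable borel"
  unfolding lomax_density_def by measurable

lemma borel_measurable_inv_gamma [measurable]: "inv_gamma_density d c \<in> borel_measurable borel"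
  unfolding inv_gamma_density_def by measurable

lemma lomax_nonneg: "d > 0 \<Longrightarrow> lomax_density d c u \<ge> 0"
  unfolding lomax_density_def by simp

lemma inv_gamma_nonneg: "d > 0 \<Longrightarrow> inv_gamma_density d c t \<ge> 0"
  unfolding inv_gamma_density_def by simp

text \<open>With \<open>l = u / t\<close> the exponential factors combine to \<open>exp (- (u + c) / (2 t))\<close>, so that the integral over
  \<open>t\<close> is an inverse Gamma integral with \<open>c\<close> replaced by \<open>u + c\<close> and \<open>d\<close> by \<open>d + 1\<close>.\<close>

lemma lomax_as_mixture:
  assumes d: "d > 0" and c: "c > 0" and u: "u \<noteq> 0"
  shows "(\<integral>\<^sup>+t. ennreal (inv_gamma_density d c t * (exponential_density (1/2) (u / t) / t)) \<partial>lborel)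
    = ennreal (lomax_density d c u)"
proof (cases "u > 0")
  case False
  then have "inv_gamma_density d c t * (exponential_density (1/2) (u / t) / t) = 0" for t
    using u by (auto simp: inv_gamma_density_def exponential_density_def divide_less_0_iff)
  then show ?thesis using False by (simp only:) (simp add: lomax_density_def)
next
  case True
  have "ennreal (inv_gamma_density d c t * (exponential_density (1/2) (u / t) / t))
    = ennreal ((c / 2) powr d / Gamma d / 2) * (ennreal (exp (- (u + c) / (2 * t)) * t powr (- (d + 1) - 1)) * indicator {0<..} t)" for t
  proof (cases "t > 0")
    case t: True
    have "inv_gamma_density d c t * (exponential_density (1/2) (u / t) / t)
      = (c / 2) powr d / Gamma d / 2 * ((exp (- c / (2 * t)) * exp (- u / (2 * t))) * (t powr (- d - 1) / t))"
      using t True by (simp add: inv_gamma_density_def exponential_density_def divide_less_0_iff mult_ac)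
    also have "exp (- c / (2 * t)) * exp (- u / (2 * t)) = exp (- (u + c) / (2 * t))"
      by (simp only: exp_add[symmetric] add_divide_distrib[symmetric]) (simp add: algebra_simps)
    also have "t powr (- d - 1) / t = t powr (- (d + 1) - 1)"
      using t by (simp add: powr_diff powr_minus field_simps power2_eq_square)
    finally show ?thesis using t d by (simp add: ennreal_mult'[symmetric])
  qed (simp add: inv_gamma_density_def)
  then have "(\<integral>\<^sup>+t. ennreal (inv_gamma_density d c t * (exponential_density (1/2) (u / t) / t)) \<partial>lborel)
    = ennreal ((c / 2) powr d / Gamma d / 2) * ennreal (Gamma (d + 1) * (2 / (u + c)) powr (d + 1))"
    using True c d
    by (simp only:) (subst nn_integral_cmult, measurable, subst inv_gamma_integral, auto)
  also have "\<dots> = ennreal ((c / 2) powr d / Gamma d / 2 * (Gamma (d + 1) * (2 / (u + c)) powr (d + 1)))"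
    using d by (simp add: ennreal_mult'[symmetric])
  also have "(c / 2) powr d / Gamma d / 2 * (Gamma (d + 1) * (2 / (u + c)) powr (d + 1)) = lomax_density d c u"
  proof -
    have G: "Gamma (d + 1) = d * Gamma d" "Gamma d > 0" using d by (auto simp: Gamma_plus1 nonpos_Ints_def)
    have p: "(2 / (u + c)) powr (d + 1) = 2 powr d * 2 * (u + c) powr (- d - 1)"
      using True c by (simp add: powr_divide powr_add powr_diff powr_minus field_simps)
    have q: "(c / 2) powr d * 2 powr d = c powr d" using c by (simp add: powr_divide)
    have "(c / 2) powr d / Gamma d / 2 * (Gamma (d + 1) * (2 / (u + c)) powr (d + 1))
       = ((c / 2) powr d * 2 powr d) * d * (u + c) powr (- d - 1)"
      unfolding p G using G(2) by simp
    then show ?thesis unfolding q using True by (simp add: lomax_density_def)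
  qed
  finally show ?thesis .
qed

text \<open>The survival function is \<open>(c / (u + c)) powr d\<close>.\<close>

lemma lomax_mass:
  assumes d: "d > 0" and c: "c > 0"
  shows "(\<integral>\<^sup>+u. ennreal (lomax_density d c u) \<partial>lborel) = 1"
    and "a \<ge> 0 \<Longrightarrow> (\<integral>\<^sup>+u. ennreal (lomax_density d c u) * indicator {0..a} u \<partial>lborel) = ennreal (1 - (c / (a + c)) powr d)"
proof -
  let ?f = "\<lambda>u. d * c powr d * (u + c) powr (- d - 1)"
  let ?F = "\<lambda>u. - (c powr d * (u + c) powr (- d))"
  have der: "(?F has_real_derivative ?f u) (at u)" if "u \<ge> 0" for u
    using that c by (auto intro!: derivative_eq_intros)
  have lim: "(?F \<longlongrightarrow> 0) at_top"
  proof -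
    have "filterlim (\<lambda>u. u + c) at_top at_top"
      by (rule filterlim_at_top_mono[OF filterlim_ident]) (use c in auto)
    then have "((\<lambda>u. - (c powr d * (u + c) powr (- d))) \<longlongrightarrow> - (c powr d * 0)) at_top"
      using d by (intro tendsto_intros tendsto_neg_powr) auto
    then show ?thesis by simp
  qed
  have F0: "?F 0 = - 1" using c d by (simp add: powr_minus powr_gt_zero)
  have ae: "AE u in lborel. ennreal (lomax_density d c u) = ennreal (?f u) * indicator {0..} u"
    using AE_lborel_singleton[of "0::real"]
    by eventually_elim (auto simp: lomax_density_def indicator_def)
  have "(\<integral>\<^sup>+u. ennreal (lomax_density d c u) \<partial>lborel) = (\<integral>\<^sup>+u. ennreal (?f u) * indicator {0..} u \<partial>lborel)"
    by (rule nn_integral_cong_AE[OF ae])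
  also have "\<dots> = ennreal (0 - ?F 0)"
    by (rule nn_integral_FTC_atLeast[OF _ der _ lim]) (use d in auto)
  finally show "(\<integral>\<^sup>+u. ennreal (lomax_density d c u) \<partial>lborel) = 1" by (simp only: F0) simp
  assume a: "a \<ge> 0"
  have "(\<integral>\<^sup>+u. ennreal (lomax_density d c u) * indicator {0..a} u \<partial>lborel)
     = (\<integral>\<^sup>+u. ennreal (?f u) * indicator {0..a} u \<partial>lborel)"
    by (rule nn_integral_cong_AE) (use ae in eventually_elim, auto simp: indicator_def)
  also have "\<dots> = ennreal (?F a - ?F 0)"
    by (rule nn_integral_FTC_Icc) (use d der a in auto)
  also have "?F a - ?F 0 = 1 - (c / (a + c)) powr d"
    using F0 a c by (simp add: powr_divide powr_minus_divide)
  finally show "(\<integral>\<^sup>+u. ennreal (lomax_density d c u) * indicator {0..a} u \<partial>lborel) = ennreal (1 - (c / (a + c)) powr d)" .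
qed

text \<open>A truncated first moment, bounded by splitting the integral at \<open>u = 1\<close>.\<close>

lemma lomax_truncated_moment:
  assumes d: "0 < d" "d < 1" and c: "c > 0" and K: "K \<ge> 1" and T: "T \<ge> 1"
  shows "(\<integral>\<^sup>+u. ennreal (lomax_density d c u) * ennreal (min (K * u) T) \<partial>lborel)
    \<le> ennreal ((K / (1 - d) + 1) * T * c powr d)"
proof -
  have "(\<integral>\<^sup>+u. ennreal (lomax_density d c u) * ennreal (min (K * u) T) \<partial>lborel)
    \<le> (\<integral>\<^sup>+u. ennreal (d * c powr d * K) * (ennreal (u powr (- d)) * indicator {0..1} u) +
        ennreal (d * c powr d * T) * (ennreal (u powr (- d - 1)) * indicator {1..} u) \<partial>lborel)"
  proof (rule nn_integral_mono)
    fix u :: real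
    have le: "lomax_density d c u \<le> d * c powr d * u powr (- d - 1)" if "u > 0"
      unfolding lomax_density_def using that c d by (auto intro!: mult_left_mono powr_mono2')
    show "ennreal (lomax_density d c u) * ennreal (min (K * u) T) \<le>
      ennreal (d * c powr d * K) * (ennreal (u powr (- d)) * indicator {0..1} u) +
        ennreal (d * c powr d * T) * (ennreal (u powr (- d - 1)) * indicator {1..} u)"
    proof (cases "u \<le> 0")
      case True then show ?thesis by (simp add: lomax_density_def)
    next
      case False
      show ?thesis
      proof (cases "u \<le> 1")
        case True
        have "lomax_density d c u * min (K * u) T \<le> (d * c powr d * u powr (- d - 1)) * (K * u)"
          using le False K d T by (intro mult_mono) auto
        also have "\<dots> = d * c powr d * K * (u powr (- d - 1) * u)" by simp
        also have "u powr (- d - 1) * u = u powr (- d)"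
          using False by (simp add: powr_diff)
        finally have "ennreal (lomax_density d c u * min (K * u) T) \<le> ennreal (d * c powr d * K * u powr (- d))"
          by (rule ennreal_leI)
        then have "ennreal (lomax_density d c u) * ennreal (min (K * u) T) \<le>
            ennreal (d * c powr d * K) * (ennreal (u powr (- d)) * indicator {0..1} u)"
          using True False d K by (simp add: ennreal_mult'[symmetric] lomax_nonneg)
        then show ?thesis by (rule order_trans) simp
      next
        case u: False
        have "lomax_density d c u * min (K * u) T \<le> (d * c powr d * u powr (- d - 1)) * T"
          using le False K d T by (intro mult_mono) auto
        also have "\<dots> = d * c powr d * T * u powr (- d - 1)" by simp
        finally have "ennreal (lomax_density d c u * min (K * u) T) \<le> ennreal (d * c powr d * T * u powr (- d - 1))"
          by (rule ennreal_leI)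
        then have "ennreal (lomax_density d c u) * ennreal (min (K * u) T) \<le>
            ennreal (d * c powr d * T) * (ennreal (u powr (- d - 1)) * indicator {1..} u)"
          using u d T by (simp add: ennreal_mult'[symmetric] lomax_nonneg)
        then show ?thesis by (rule order_trans) simp
      qed
    qed
  qed
  also have "\<dots> = ennreal (d * c powr d * K) * (\<integral>\<^sup>+u. ennreal (u powr (- d)) * indicator {0..1} u \<partial>lborel)
     + ennreal (d * c powr d * T) * (\<integral>\<^sup>+u. ennreal (u powr (- d - 1)) * indicator {1..} u \<partial>lborel)"
    by (simp add: nn_integral_add nn_integral_cmult)
  also have "(\<integral>\<^sup>+u. ennreal (u powr (- d)) * indicator {0..1} u \<partial>lborel) = ennreal (1 / (1 - d))"
  proof -
    have "((\<lambda>u::real. u powr (- d)) has_integral 1 powr (- d + 1) / (- d + 1)) {0..1}"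
      using d by (intro has_integral_powr_from_0) auto
    then have "((\<lambda>u::real. u powr (- d)) has_integral 1 / (1 - d)) {0..1}" by simp
    then show ?thesis by (intro nn_integral_has_integral_lebesgue') auto
  qed
  also have "(\<integral>\<^sup>+u. ennreal (u powr (- d - 1)) * indicator {1..} u \<partial>lborel) = ennreal (1 / d)"
  proof -
    have "(\<integral>\<^sup>+u. ennreal (u powr (- d - 1)) * indicator {1..} u \<partial>lborel) = ennreal (0 - (- (1 / d) * 1 powr (- d)))"
    proof (rule nn_integral_FTC_atLeast[where F="\<lambda>u. - (1 / d) * u powr (- d)"])
      show "((\<lambda>u. - (1 / d) * u powr (- d)) has_real_derivative u powr (- d - 1)) (at u)" if "1 \<le> u" for u
        using that d by (auto intro!: derivative_eq_intros)
      have "((\<lambda>u. - (1 / d) * u powr (- d)) \<longlongrightarrow> - (1 / d) * 0) at_top"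
        using d by (intro tendsto_intros tendsto_neg_powr filterlim_ident) auto
      then show "((\<lambda>u. - (1 / d) * u powr (- d)) \<longlongrightarrow> 0) at_top" by simp
    qed auto
    then show ?thesis by simp
  qed
  also have "ennreal (d * c powr d * K) * ennreal (1 / (1 - d)) + ennreal (d * c powr d * T) * ennreal (1 / d)
    = ennreal (d * c powr d * K / (1 - d) + c powr d * T)"
    using d K T by (simp add: ennreal_mult'[symmetric] ennreal_plus[symmetric] del: ennreal_plus)
  also have "\<dots> \<le> ennreal ((K / (1 - d) + 1) * T * c powr d)"
  proof (rule ennreal_leI)
    have "d * (c powr d * K / (1 - d)) \<le> T * (c powr d * K / (1 - d))"
      using d T K by (intro mult_right_mono) auto
    then show "d * c powr d * K / (1 - d) + c powr d * T \<le> (K / (1 - d) + 1) * T * c powr d"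
      by (simp add: algebra_simps)
  qed
  finally show ?thesis .
qed

text \<open>The ratio decreases in \<open>u\<close>, from \<open>((1 + c) / c) powr (d + 1)\<close> at \<open>u = 0\<close>.\<close>

lemma lomax_shift:
  assumes d: "d > 0" and c: "0 < c" "c \<le> 1" and u: "u > 0"
  shows "lomax_density d c u \<le> (2 / c) powr (d + 1) * lomax_density d c (u + 1)"
proof -
  have "(u + 1 + c) / (u + c) \<le> 2 / c"
  proof -
    have "c * u + c * 1 + c * c \<le> 2 * u + 1 * c + 1 * c" using c u by (intro add_mono mult_right_mono) auto
    then show ?thesis using c u by (simp add: field_simps)
  qed
  then have "((u + 1 + c) / (u + c)) powr (d + 1) \<le> (2 / c) powr (d + 1)"
    using c u d by (intro powr_mono2) auto
  then have "((u + 1 + c) / (u + c)) powr (d + 1) * (u + 1 + c) powr (- d - 1) \<le> (2 / c) powr (d + 1) * (u + 1 + c) powr (- d - 1)"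
    by (rule mult_right_mono) simp
  moreover have "((u + 1 + c) / (u + c)) powr (d + 1) * (u + 1 + c) powr (- d - 1) = (u + c) powr (- d - 1)"
  proof -
    have "- d - 1 = - (d + 1)" by simp
    then show ?thesis using c u by (simp only: powr_minus) (simp add: powr_divide field_simps)
  qed
  ultimately have "(u + c) powr (- d - 1) \<le> (2 / c) powr (d + 1) * (u + 1 + c) powr (- d - 1)" by simp
  from mult_left_mono[OF this, of "d * c powr d"] show ?thesis
    using u d unfolding lomax_density_def by (simp add: mult_ac)
qed

section \<open>The prior as a scale mixture\<close>

context whitened
begin

definition gauss_const :: real where "gauss_const = sqrt ((2 * pi) ^ CARD('k) * det S)"

text \<open>The likelihood without its normalising constant, which cancels in every posterior.\<close>

definition lik :: "real^'k \<Rightarrow> real^'k \<Rightarrow> real" where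
  "lik x \<theta> = exp (- msq (x - \<theta>) / 2)"

abbreviation dens :: "real^'k \<Rightarrow> real^'k \<Rightarrow> real" where "dens x \<mu> \<equiv> lik x \<mu> / gauss_const"

lemma gauss_const_pos: "gauss_const > 0"
  unfolding gauss_const_def using det_S_pos by simp

lemma mvn_density_eq: "mvn_density \<mu> S x = dens x \<mu>"
  unfolding mvn_density_def lik_def gauss_const_def quadratic_form ..

lemma mvn_density_scaled:
  "mvn_density 0 (u *\<^sub>R S) \<theta> = (if u = 0 then 0
     else exp (- msq \<theta> / (2 * u)) / sqrt ((2 * pi * u) ^ CARD('k) * det S))"
proof (cases "u = 0")
  case False
  have "\<theta> \<bullet> (matrix_inv (u *\<^sub>R S) *v \<theta>) = msq \<theta> / u"
    unfolding matrix_inv_scaled[OF False] scaleR_matrix_vector_assoc[symmetric]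
    by (simp add: quadratic_form)
  moreover have "det (u *\<^sub>R S) = u ^ CARD('k) * det S"
    using det_rows_mul[of "\<lambda>_. u" "\<lambda>i. S $ i"] by (simp add: vec_eq_iff scaleR_vec_def vector_scalar_mult_def)
  ultimately show ?thesis using False
    unfolding mvn_density_def by (simp add: power_mult_distrib mult.assoc)
next
  case True
  have "det (0 :: real^'k^'k) = 0" by (rule det_zero_row(1)) (simp add: row_def vec_eq_iff)
  with True show ?thesis unfolding mvn_density_def by simp
qed

lemma borel_measurable_lik [measurable]:
  "f \<in> borel_measurable M \<Longrightarrow> g \<in> borel_measurable M \<Longrightarrow> (\<lambda>w. lik (f w) (g w)) \<in> borel_measurable M"
proof -
  assume [measurable]: "f \<in> borel_measurable M" "g \<in> borel_measurable M"
  show ?thesis unfolding lik_def by measurable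
qed

lemma lik_bounds: "0 < lik x \<theta>" "lik x \<theta> \<le> 1"
  unfolding lik_def by auto

lemma dens_nonneg: "dens x \<mu> \<ge> 0"
  unfolding lik_def using gauss_const_pos by simp

lemma borel_measurable_scaled_density [measurable]:
  assumes [measurable]: "f \<in> borel_measurable M" "g \<in> borel_measurable M"
  shows "(\<lambda>w. mvn_density 0 (f w *\<^sub>R S) (g w)) \<in> borel_measurable M"
proof -
  show ?thesis unfolding mvn_density_scaled by measurable
qed

text \<open>Given both scales, the prior of \<open>\<theta>\<close> depends on them through their product only, and the product has
  the Lomax density.\<close>

lemma eig_prior_mixture:
  assumes d: "d > 0" and c: "c > 0" and f[measurable]: "f \<in> borel_measurable borel"
  shows "(\<integral>\<^sup>+\<theta>. f \<theta> \<partial>eig_prior d c S) =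
    (\<integral>\<^sup>+u. ennreal (lomax_density d c u) * (\<integral>\<^sup>+\<theta>. ennreal (mvn_density 0 (u *\<^sub>R S) \<theta>) * f \<theta> \<partial>lborel) \<partial>lborel)"
proof -
  let ?E = "density lborel (\<lambda>l. ennreal (exponential_density (1/2) l))"
  let ?I = "density lborel (\<lambda>t. ennreal (inv_gamma_density d c t))"
  define G where "G u = (\<integral>\<^sup>+\<theta>. ennreal (mvn_density 0 (u *\<^sub>R S) \<theta>) * f \<theta> \<partial>lborel)" for u
  have G[measurable]: "G \<in> borel_measurable borel" unfolding G_def by measurable
  have sI: "sigma_finite_measure ?I"
    by (subst sigma_finite_measure.sigma_finite_iff_density_finite[OF sigma_finite_lborel]) auto
  interpret I: sigma_finite_measure ?I by (rule sI)
  have "(\<integral>\<^sup>+\<theta>. f \<theta> \<partial>eig_prior d c S)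
    = (\<integral>\<^sup>+w. ennreal (mvn_density 0 ((fst (fst w) * snd (fst w)) *\<^sub>R S) (snd w)) * f (snd w) \<partial>((?E \<Otimes>\<^sub>M ?I) \<Otimes>\<^sub>M lborel))"
    unfolding eig_prior_def eig_joint_prior_def
    by (subst nn_integral_distr) (auto simp: nn_integral_density case_prod_beta' comp_def)
  also have "\<dots> = (\<integral>\<^sup>+p. G (fst p * snd p) \<partial>(?E \<Otimes>\<^sub>M ?I))"
    by (subst lborel.nn_integral_fst[symmetric]) (auto simp: G_def)
  also have "\<dots> = (\<integral>\<^sup>+l. \<integral>\<^sup>+t. G (l * t) \<partial>?I \<partial>?E)"
    by (subst I.nn_integral_fst[symmetric]) auto
  also have "\<dots> = (\<integral>\<^sup>+l. \<integral>\<^sup>+t. ennreal (exponential_density (1/2) l) * (ennreal (inv_gamma_density d c t) * G (l * t)) \<partial>lborel \<partial>lborel)"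
    by (simp add: nn_integral_density nn_integral_cmult)
  also have "\<dots> = (\<integral>\<^sup>+t. \<integral>\<^sup>+l. ennreal (exponential_density (1/2) l) * (ennreal (inv_gamma_density d c t) * G (l * t)) \<partial>lborel \<partial>lborel)"
    by (subst lborel_pair.Fubini') auto
  also have "\<dots> = (\<integral>\<^sup>+t. \<integral>\<^sup>+u. ennreal (inv_gamma_density d c t * (exponential_density (1/2) (u / t) / t)) * G u \<partial>lborel \<partial>lborel)"
  proof (rule nn_integral_cong)
    fix t :: real
    show "(\<integral>\<^sup>+l. ennreal (exponential_density (1/2) l) * (ennreal (inv_gamma_density d c t) * G (l * t)) \<partial>lborel)
      = (\<integral>\<^sup>+u. ennreal (inv_gamma_density d c t * (exponential_density (1/2) (u / t) / t)) * G u \<partial>lborel)"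
    proof (cases "t > 0")
      case True
      have e0: "exponential_density (1/2) l \<ge> 0" for l :: real by (simp add: exponential_density_def)
      have "(\<integral>\<^sup>+l. ennreal (exponential_density (1/2) l) * (ennreal (inv_gamma_density d c t) * G (l * t)) \<partial>lborel)
        = ennreal \<bar>1 / t\<bar> * (\<integral>\<^sup>+u. ennreal (exponential_density (1/2) (0 + (1 / t) * u)) * (ennreal (inv_gamma_density d c t) * G ((0 + (1 / t) * u) * t)) \<partial>lborel)"
        by (rule nn_integral_real_affine) (use True in auto)
      also have "\<dots> = (\<integral>\<^sup>+u. ennreal (1 / t) * (ennreal (exponential_density (1/2) (u / t)) * (ennreal (inv_gamma_density d c t) * G u)) \<partial>lborel)"
        using True by (subst nn_integral_cmult) (auto simp: mult_ac)
      also have "\<dots> = (\<integral>\<^sup>+u. ennreal (inv_gamma_density d c t * (exponential_density (1/2) (u / t) / t)) * G u \<partial>lborel)"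
        using True d e0 by (intro nn_integral_cong)
          (simp add: ennreal_mult'[symmetric] mult.assoc[symmetric] inv_gamma_nonneg mult_ac)
      finally show ?thesis .
    qed (simp add: inv_gamma_density_def)
  qed
  also have "\<dots> = (\<integral>\<^sup>+u. \<integral>\<^sup>+t. ennreal (inv_gamma_density d c t * (exponential_density (1/2) (u / t) / t)) * G u \<partial>lborel \<partial>lborel)"
    by (subst lborel_pair.Fubini') auto
  also have "\<dots> = (\<integral>\<^sup>+u. (\<integral>\<^sup>+t. ennreal (inv_gamma_density d c t * (exponential_density (1/2) (u / t) / t)) \<partial>lborel) * G u \<partial>lborel)"
    by (intro nn_integral_cong nn_integral_multc) auto
  also have "\<dots> = (\<integral>\<^sup>+u. ennreal (lomax_density d c u) * G u \<partial>lborel)"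
    by (intro nn_integral_cong_AE eventually_mono[OF AE_lborel_singleton[of "0::real"]]
          arg_cong2[where f="(*)"] lomax_as_mixture[OF d c]) auto
  finally show ?thesis unfolding G_def .
qed

lemma nn_integral_lik:
  "(\<integral>\<^sup>+x. ennreal (lik x \<mu>) \<partial>lborel) = ennreal gauss_const"
proof -
  have "(\<integral>\<^sup>+x. ennreal (lik x \<mu>) \<partial>lborel) = (\<integral>\<^sup>+x. ennreal (exp (- 1 * msq (x + - \<mu>) / 2)) \<partial>lborel)"
    by (simp add: lik_def)
  also have "\<dots> = (\<integral>\<^sup>+x. ennreal (exp (- 1 * msq x / 2)) \<partial>lborel)"
    by (rule nn_integral_translate) measurable
  also have "\<dots> = ennreal gauss_const" by (subst nn_integral_gaussian) (simp_all add: gauss_const_def)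
  finally show ?thesis .
qed

lemma sets_mvn [measurable_cong]: "sets (mvn \<mu> S) = sets borel"
  unfolding mvn_def by simp

lemma prob_space_mvn: "prob_space (mvn \<mu> S)"
proof
  have "(\<integral>\<^sup>+x. ennreal (mvn_density \<mu> S x) \<partial>lborel) = (\<integral>\<^sup>+x. ennreal (1 / gauss_const) * ennreal (lik x \<mu>) \<partial>lborel)"
    using gauss_const_pos by (simp add: mvn_density_eq ennreal_mult'[symmetric])
  also have "\<dots> = 1"
    using gauss_const_pos by (subst nn_integral_cmult) (auto simp: nn_integral_lik ennreal_mult'[symmetric])
  finally show "emeasure (mvn \<mu> S) (space (mvn \<mu> S)) = 1"
    unfolding mvn_def by (subst emeasure_density) (auto simp: mvn_density_eq)
qed

lemma nn_integral_mvn: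
  assumes [measurable]: "f \<in> borel_measurable borel"
  shows "(\<integral>\<^sup>+x. f x \<partial>mvn \<mu> S) = (\<integral>\<^sup>+x. ennreal (dens x \<mu>) * f x \<partial>lborel)"
  unfolding mvn_def mvn_density_eq by (subst nn_integral_density) auto

text \<open>Completing the square.\<close>

lemma nn_integral_lik_scaled:
  assumes a: "a \<ge> 0" and u: "u > 0"
  shows "(\<integral>\<^sup>+\<theta>. ennreal (mvn_density 0 (u *\<^sub>R S) \<theta>) * ennreal (exp (- a * msq (x - \<theta>) / 2)) \<partial>lborel)
    = ennreal (exp (- a * msq x / (2 * (1 + a * u))) / sqrt ((1 + a * u) ^ CARD('k)))"
proof -
  define b where "b = a + 1 / u"
  have b: "b > 0" using a u by (simp add: b_def add_nonneg_pos)
  have bu: "b = (1 + a * u) / u" using u by (simp add: b_def field_simps)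
  have pos: "1 + a * u > 0" using a u by (simp add: add_pos_nonneg)
  define K where "K = exp (- a * msq x / (2 * (1 + a * u))) / sqrt ((2 * pi * u) ^ CARD('k) * det S)"
  have K: "K \<ge> 0" unfolding K_def using det_S_pos u by simp
  have eq: "mvn_density 0 (u *\<^sub>R S) \<theta> * exp (- a * msq (x - \<theta>) / 2)
    = K * exp (- b * msq (\<theta> + - ((a / b) *\<^sub>R x)) / 2)" for \<theta>
  proof -
    define y z where "y = W *v x" and "z = W *v \<theta>"
    have n1: "msq (x - \<theta>) = y \<bullet> y - 2 * (y \<bullet> z) + z \<bullet> z"
      unfolding power2_norm_eq_inner y_def z_def matrix_vector_mult_diff_distrib
      by (simp add: inner_diff_left inner_diff_right inner_commute)
    have n2: "msq (\<theta> + - ((a / b) *\<^sub>R x)) = z \<bullet> z - 2 * (a / b) * (y \<bullet> z) + (a / b)\<^sup>2 * (y \<bullet> y)"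
      unfolding power2_norm_eq_inner y_def z_def 
      by (simp add: matrix_vector_mult_diff_distrib matrix_vector_mult_scaleR inner_diff_left inner_diff_right inner_commute power2_eq_square)
    have "- (z \<bullet> z) / (2 * u) + - a * (y \<bullet> y - 2 * (y \<bullet> z) + z \<bullet> z) / 2
       = - a * (y \<bullet> y) / (2 * (1 + a * u)) + - b * (z \<bullet> z - 2 * (a / b) * (y \<bullet> z) + (a / b)\<^sup>2 * (y \<bullet> y)) / 2"
    proof -
      have 1: "b * (z \<bullet> z - 2 * (a / b) * (y \<bullet> z) + (a / b)\<^sup>2 * (y \<bullet> y))
         = b * (z \<bullet> z) - 2 * a * (y \<bullet> z) + a * (a / b) * (y \<bullet> y)"
        using b by (simp add: power2_eq_square field_simps)
      have 2: "a / (1 + a * u) = a - a * (a / b)"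
        unfolding bu using pos u by (simp add: field_simps)
      have "a * (y \<bullet> y) / (2 * (1 + a * u)) = (a / (1 + a * u)) * (y \<bullet> y) / 2" by simp
      also have "\<dots> = (a - a * (a / b)) * (y \<bullet> y) / 2" unfolding 2 ..
      finally have 3: "- a * (y \<bullet> y) / (2 * (1 + a * u)) = - (a - a * (a / b)) * (y \<bullet> y) / 2"
        by (simp only: minus_mult_left[symmetric] minus_divide_left[symmetric])
      have 4: "- (z \<bullet> z) / (2 * u) = - (1 / u) * (z \<bullet> z) / 2" by simp
      have 5: "- b * (z \<bullet> z - 2 * (a / b) * (y \<bullet> z) + (a / b)\<^sup>2 * (y \<bullet> y)) / 2
          = - ((a * (z \<bullet> z) + (1 / u) * (z \<bullet> z)) - 2 * a * (y \<bullet> z) + a * (a / b) * (y \<bullet> y)) / 2"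
        unfolding minus_mult_left[symmetric] 1 by (simp add: b_def algebra_simps)
      obtain r v where r: "a / b = r" and v: "1 / u = v" by blast
      show ?thesis unfolding 3 4 5 unfolding r v
        by (simp add: algebra_simps add_divide_distrib diff_divide_distrib)
    qed
    then have "exp (- (z \<bullet> z) / (2 * u)) * exp (- a * (y \<bullet> y - 2 * (y \<bullet> z) + z \<bullet> z) / 2)
       = exp (- a * (y \<bullet> y) / (2 * (1 + a * u))) * exp (- b * (z \<bullet> z - 2 * (a / b) * (y \<bullet> z) + (a / b)\<^sup>2 * (y \<bullet> y)) / 2)"
      by (simp only: exp_add[symmetric])
    then show ?thesis
      using u unfolding n1 n2 mvn_density_scaled K_def
      by (simp add: power2_norm_eq_inner y_def[symmetric] z_def[symmetric])
  qed
  have "(\<integral>\<^sup>+\<theta>. ennreal (mvn_density 0 (u *\<^sub>R S) \<theta>) * ennreal (exp (- a * msq (x - \<theta>) / 2)) \<partial>lborel)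
     = (\<integral>\<^sup>+\<theta>. ennreal K * ennreal (exp (- b * msq (\<theta> + - ((a / b) *\<^sub>R x)) / 2)) \<partial>lborel)"
    by (intro nn_integral_cong) (simp only: ennreal_mult''[symmetric] exp_ge_zero eq)
  also have "\<dots> = ennreal K * (\<integral>\<^sup>+\<theta>. ennreal (exp (- b * msq (\<theta> + - ((a / b) *\<^sub>R x)) / 2)) \<partial>lborel)"
    by (rule nn_integral_cmult) measurable
  also have "(\<integral>\<^sup>+\<theta>. ennreal (exp (- b * msq (\<theta> + - ((a / b) *\<^sub>R x)) / 2)) \<partial>lborel)
     = (\<integral>\<^sup>+\<theta>. ennreal (exp (- b * msq \<theta> / 2)) \<partial>lborel)"
    by (rule nn_integral_translate) measurable
  also have "\<dots> = ennreal (sqrt ((2 * pi / b) ^ CARD('k) * det S))" by (rule nn_integral_gaussian[OF b])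
  also have "ennreal K * ennreal (sqrt ((2 * pi / b) ^ CARD('k) * det S)) = ennreal (K * sqrt ((2 * pi / b) ^ CARD('k) * det S))"
    using K by (simp add: ennreal_mult')
  also have "K * sqrt ((2 * pi / b) ^ CARD('k) * det S) = exp (- a * msq x / (2 * (1 + a * u))) / sqrt ((1 + a * u) ^ CARD('k))"
  proof -
    have "2 * pi / b = (2 * pi * u) / (1 + a * u)" unfolding bu by simp
    then have "sqrt ((2 * pi / b) ^ CARD('k) * det S) = sqrt ((2 * pi * u) ^ CARD('k) * det S) / sqrt ((1 + a * u) ^ CARD('k))"
      by (simp add: power_divide real_sqrt_divide real_sqrt_mult)
    moreover have "sqrt ((2 * pi * u) ^ CARD('k) * det S) > 0" using u det_S_pos by simp
    ultimately show ?thesis unfolding K_def using u det_S_pos by simp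
  qed
  finally show ?thesis .
qed

lemma nn_integral_lik_exp:
  assumes a: "a < 1"
  shows "(\<integral>\<^sup>+x. ennreal (dens x \<mu> * exp (a * msq (x - \<mu>) / 2)) \<partial>lborel)
    = ennreal (1 / sqrt ((1 - a) ^ CARD('k)))"
proof -
  have "dens x \<mu> * exp (a * msq (x - \<mu>) / 2)
     = (1 / gauss_const) * exp (- (1 - a) * msq (x + - \<mu>) / 2)" for x
  proof -
    have "lik x \<mu> * exp (a * msq (x - \<mu>) / 2) = exp (- (1 - a) * msq (x + - \<mu>) / 2)"
      unfolding lik_def exp_add[symmetric] by (simp add: algebra_simps diff_divide_distrib)
    then show ?thesis by simp
  qed
  then have "(\<integral>\<^sup>+x. ennreal (dens x \<mu> * exp (a * msq (x - \<mu>) / 2)) \<partial>lborel)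
    = (\<integral>\<^sup>+x. ennreal (1 / gauss_const) * ennreal (exp (- (1 - a) * msq (x + - \<mu>) / 2)) \<partial>lborel)"
    using gauss_const_pos by (simp only: ennreal_mult'' exp_ge_zero)
  also have "\<dots> = ennreal (1 / gauss_const) * (\<integral>\<^sup>+x. ennreal (exp (- (1 - a) * msq (x + - \<mu>) / 2)) \<partial>lborel)"
    by (rule nn_integral_cmult) measurable
  also have "(\<integral>\<^sup>+x. ennreal (exp (- (1 - a) * msq (x + - \<mu>) / 2)) \<partial>lborel)
     = (\<integral>\<^sup>+x. ennreal (exp (- (1 - a) * msq x / 2)) \<partial>lborel)"
    by (rule nn_integral_translate) measurable
  also have "\<dots> = ennreal (sqrt ((2 * pi / (1 - a)) ^ CARD('k) * det S))"
    by (rule nn_integral_gaussian) (use a in simp)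
  also have "ennreal (1 / gauss_const) * \<dots> = ennreal (1 / gauss_const * sqrt ((2 * pi / (1 - a)) ^ CARD('k) * det S))"
    using gauss_const_pos by (intro ennreal_mult''[symmetric]) (use a det_S_pos in simp)
  also have "1 / gauss_const * sqrt ((2 * pi / (1 - a)) ^ CARD('k) * det S) = 1 / sqrt ((1 - a) ^ CARD('k))"
    using det_S_pos by (simp add: gauss_const_def power_divide real_sqrt_divide real_sqrt_mult)
  finally show ?thesis .
qed

text \<open>The inequality \<open>y \<le> 4 exp (y / 4)\<close> turns second moments into the Gaussian integral with
  half the precision.\<close>

lemma nn_integral_lik_sq:
  "(\<integral>\<^sup>+x. ennreal (dens x \<mu> * msq (x - \<mu>)) \<partial>lborel) \<le> ennreal (4 * sqrt (2 ^ CARD('k)))"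
proof -
  have "(\<integral>\<^sup>+x. ennreal (dens x \<mu> * msq (x - \<mu>)) \<partial>lborel)
    \<le> (\<integral>\<^sup>+x. 4 * ennreal (dens x \<mu> * exp ((1/2) * msq (x - \<mu>) / 2)) \<partial>lborel)"
  proof (rule nn_integral_mono)
    fix x
    have "msq (x - \<mu>) \<le> 4 * exp ((1/2) * msq (x - \<mu>) / 2)"
      using exp_ge_add_one_self[of "(1/2) * msq (x - \<mu>) / 2"] by linarith
    then have "dens x \<mu> * msq (x - \<mu>)
       \<le> dens x \<mu> * (4 * exp ((1/2) * msq (x - \<mu>) / 2))"
      using gauss_const_pos lik_bounds(1)[of x \<mu>] by (intro mult_left_mono) auto
    then have "ennreal (dens x \<mu> * msq (x - \<mu>))
       \<le> ennreal (4 * (dens x \<mu> * exp ((1/2) * msq (x - \<mu>) / 2)))"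
      by (intro ennreal_leI) (simp add: mult_ac)
    then show "ennreal (dens x \<mu> * msq (x - \<mu>))
       \<le> 4 * ennreal (dens x \<mu> * exp ((1/2) * msq (x - \<mu>) / 2))"
      by (subst (asm) ennreal_mult') simp_all
  qed
  also have "\<dots> = 4 * ennreal (1 / sqrt ((1 - 1/2) ^ CARD('k)))"
  proof (subst nn_integral_cmult)
    show "(\<lambda>x. ennreal (dens x \<mu> * exp ((1/2) * msq (x - \<mu>) / 2))) \<in> borel_measurable lborel"
      by measurable
  qed (subst nn_integral_lik_exp, auto)
  also have "\<dots> = ennreal (4 * sqrt (2 ^ CARD('k)))"
    by (simp add: power_one_over real_sqrt_divide ennreal_mult')
  finally show ?thesis .
qed

lemma nn_integral_scaled_sq:
  assumes u: "u > 0"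
  shows "(\<integral>\<^sup>+\<theta>. ennreal (mvn_density 0 (u *\<^sub>R S) \<theta> * msq \<theta>) \<partial>lborel) \<le> ennreal (4 * sqrt (2 ^ CARD('k)) * u)"
proof -
  define K where "K = 4 * u / sqrt ((2 * pi * u) ^ CARD('k) * det S)"
  have K: "K \<ge> 0" unfolding K_def using u det_S_pos by simp
  have "(\<integral>\<^sup>+\<theta>. ennreal (mvn_density 0 (u *\<^sub>R S) \<theta> * msq \<theta>) \<partial>lborel)
    \<le> (\<integral>\<^sup>+\<theta>. ennreal K * ennreal (exp (- (1 / (2 * u)) * msq \<theta> / 2)) \<partial>lborel)"
  proof (rule nn_integral_mono)
    fix \<theta>
    let ?n = "msq \<theta>"
    have "?n / (4 * u) \<le> exp (?n / (4 * u))" using exp_ge_add_one_self[of "?n / (4 * u)"] by linarith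
    then have "?n \<le> 4 * u * exp (?n / (4 * u))" using u by (simp add: pos_divide_le_eq mult.commute)
    then have "mvn_density 0 (u *\<^sub>R S) \<theta> * ?n \<le> mvn_density 0 (u *\<^sub>R S) \<theta> * (4 * u * exp (?n / (4 * u)))"
      using u det_S_pos by (intro mult_left_mono) (auto simp: mvn_density_scaled)
    also have "\<dots> = K * (exp (- ?n / (2 * u)) * exp (?n / (4 * u)))"
      using u by (simp add: mvn_density_scaled K_def)
    also have "exp (- ?n / (2 * u)) * exp (?n / (4 * u)) = exp (- (1 / (2 * u)) * ?n / 2)"
      unfolding exp_add[symmetric] using u by (simp add: field_simps)
    finally have "ennreal (mvn_density 0 (u *\<^sub>R S) \<theta> * ?n) \<le> ennreal (K * exp (- (1 / (2 * u)) * ?n / 2))"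
      by (rule ennreal_leI)
    then show "ennreal (mvn_density 0 (u *\<^sub>R S) \<theta> * ?n) \<le> ennreal K * ennreal (exp (- (1 / (2 * u)) * ?n / 2))"
      using K by (simp add: ennreal_mult')
  qed
  also have "\<dots> = ennreal K * ennreal (sqrt ((2 * pi / (1 / (2 * u))) ^ CARD('k) * det S))"
    using u by (subst nn_integral_cmult, measurable, subst nn_integral_gaussian, auto)
  also have "\<dots> = ennreal (K * sqrt ((2 * pi / (1 / (2 * u))) ^ CARD('k) * det S))"
    using K by (simp add: ennreal_mult')
  also have "2 * pi / (1 / (2 * u)) = 2 * (2 * pi * u)" using u by simp
  also have "K * sqrt ((2 * (2 * pi * u)) ^ CARD('k) * det S) = 4 * sqrt (2 ^ CARD('k)) * u"
  proof -
    have "sqrt ((2 * (2 * pi * u)) ^ CARD('k) * det S) = sqrt (2 ^ CARD('k)) * sqrt ((2 * pi * u) ^ CARD('k) * det S)"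
      by (subst power_mult_distrib) (simp only: real_sqrt_mult mult.assoc)
    moreover have "sqrt ((2 * pi * u) ^ CARD('k) * det S) > 0" using u det_S_pos by simp
    ultimately have "K * sqrt ((2 * (2 * pi * u)) ^ CARD('k) * det S) = K * (sqrt (2 ^ CARD('k)) * sqrt ((2 * pi * u) ^ CARD('k) * det S))"
      "K * sqrt ((2 * pi * u) ^ CARD('k) * det S) = 4 * u" unfolding K_def using u det_S_pos by (simp_all only:) simp
    then show ?thesis by (metis mult.assoc mult.commute)
  qed
  finally show ?thesis .
qed

end

section \<open>Posterior of a single mean\<close>

lemma ennreal_lincomb:
  assumes "a \<ge> 0" "p \<ge> 0" "k \<ge> 0" "e \<ge> 0"
  shows "ennreal (a * p + k * e) = ennreal a * ennreal p + ennreal k * ennreal e"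
  using assms by (simp add: ennreal_mult)

text \<open>The model for one index, with the hyperparameter \<open>c\<close> of the inverse Gamma law bounded by \<open>1\<close>.\<close>

locale eig_model = whitened S W for S W :: "real^'k^'k" +
  fixes d c :: real
  assumes d: "0 < d" "d < 1" and c: "0 < c" "c \<le> 1"
begin

abbreviation prior :: "(real^'k) measure" where "prior \<equiv> eig_prior d c S"

text \<open>The marginal density of the observation, up to \<open>gauss_const\<close>.\<close>

definition evid :: "real^'k \<Rightarrow> real" where "evid x = (\<integral>\<theta>. lik x \<theta> \<partial>prior)"

definition post :: "real^'k \<Rightarrow> (real^'k) measure" where
  "post x = bayes_posterior prior (\<lambda>\<theta>. mvn_density \<theta> S x)"

lemma sets_prior [measurable_cong]: "sets prior = sets borel"
  unfolding eig_prior_def by simp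

lemma space_prior [simp]: "space prior = UNIV"
  unfolding eig_prior_def by simp

lemma nn_integral_prior_lik_scaled:
  assumes a: "a \<ge> 0"
  shows "(\<integral>\<^sup>+\<theta>. ennreal (exp (- a * msq (x - \<theta>) / 2)) \<partial>prior)
    = (\<integral>\<^sup>+u. ennreal (lomax_density d c u) *
        ennreal (exp (- a * msq x / (2 * (1 + a * u))) / sqrt ((1 + a * u) ^ CARD('k))) \<partial>lborel)"
proof -
  show ?thesis
  proof (subst eig_prior_mixture[OF d(1) c(1)], measurable, intro nn_integral_cong)
    fix u :: real
    show "ennreal (lomax_density d c u) * (\<integral>\<^sup>+ \<theta>. ennreal (mvn_density 0 (u *\<^sub>R S) \<theta>) * ennreal (exp (- a * msq (x - \<theta>) / 2)) \<partial>lborel) =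
       ennreal (lomax_density d c u) * ennreal (exp (- a * msq x / (2 * (1 + a * u))) / sqrt ((1 + a * u) ^ CARD('k)))"
    proof (cases "u > 0")
      case True
      show ?thesis by (subst nn_integral_lik_scaled[OF a True]) simp
    qed (simp add: lomax_density_def)
  qed
qed

lemma prob_space_prior: "prob_space prior"
proof
  have "emeasure prior (space prior) = (\<integral>\<^sup>+\<theta>. ennreal (exp (- 0 * msq (0 - \<theta>) / 2)) \<partial>prior)"
    by simp
  also have "\<dots> = 1" by (subst nn_integral_prior_lik_scaled) (simp_all add: lomax_mass(1)[OF d(1) c(1)])
  finally show "emeasure prior (space prior) = 1" .
qed

sublocale prior: prob_space prior by (rule prob_space_prior)

lemma integrable_lik: "integrable prior (lik x)"
  by (rule prior.integrable_const_bound[where B=1]) (use lik_bounds in \<open>auto simp: less_imp_le\<close>)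

lemma ennreal_evid: "ennreal (evid x) = (\<integral>\<^sup>+\<theta>. ennreal (lik x \<theta>) \<partial>prior)"
  unfolding evid_def by (subst nn_integral_eq_integral[OF integrable_lik]) (use lik_bounds in \<open>auto simp: less_imp_le\<close>)

lemma evid_nonneg: "evid x \<ge> 0"
  unfolding evid_def by (intro integral_nonneg_AE) (use lik_bounds in \<open>auto simp: less_imp_le\<close>)

lemma borel_measurable_evid [measurable]: "evid \<in> borel_measurable borel"
  unfolding evid_def by (rule prior.borel_measurable_lebesgue_integral) measurable

definition evid_const :: real where "evid_const = (1 - (1/2) powr d) / sqrt (2 ^ CARD('k))"

lemma evid_const_pos: "evid_const > 0"
proof -
  have "(1/2::real) powr d < 1" using powr_less_mono2[of d "1/2" 1] d by simp
  then show ?thesis unfolding evid_const_def by simp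
qed

text \<open>With probability \<open>1 - 2 powr (- d)\<close>, for every \<open>c\<close>, the variance factor is at most \<open>c\<close>, and then the
  observation is at least as likely as under \<open>\<theta> = 0\<close>, up to a constant factor.\<close>

lemma evid_ge: "evid_const * lik x 0 \<le> evid x"
proof -
  let ?e = "exp (- msq x / 2) / sqrt (2 ^ CARD('k))"
  have e: "?e \<ge> 0" by simp
  have p1: "1 - (1/2) powr d \<ge> 0" using d by (simp add: powr_le1)
  have "ennreal (evid_const * lik x 0) = ennreal (1 - (c / (c + c)) powr d) * ennreal ?e"
    using c p1 e by (subst ennreal_mult''[symmetric]) (simp_all add: evid_const_def lik_def)
  also have "\<dots> = (\<integral>\<^sup>+u. ennreal (lomax_density d c u) * indicator {0..c} u * ennreal ?e \<partial>lborel)"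
    using lomax_mass(2)[OF d(1) c(1), of c] c by (subst nn_integral_multc) auto
  also have "\<dots> \<le> (\<integral>\<^sup>+u. ennreal (lomax_density d c u) *
        ennreal (exp (- 1 * msq x / (2 * (1 + 1 * u))) / sqrt ((1 + 1 * u) ^ CARD('k))) \<partial>lborel)"
  proof (rule nn_integral_mono)
    fix u :: real
    show "ennreal (lomax_density d c u) * indicator {0..c} u * ennreal ?e \<le> ennreal (lomax_density d c u) *
        ennreal (exp (- 1 * msq x / (2 * (1 + 1 * u))) / sqrt ((1 + 1 * u) ^ CARD('k)))"
    proof (cases "u \<in> {0..c}")
      case True
      then have u: "0 \<le> u" "u \<le> 1" using c by auto
      have "msq x / (2 * (1 + u)) \<le> msq x / 2"
        using u by (intro divide_left_mono) auto
      moreover have "sqrt ((1 + u) ^ CARD('k)) \<le> sqrt (2 ^ CARD('k))"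
        using u by (intro real_sqrt_le_mono power_mono) auto
      moreover have "sqrt ((1 + u) ^ CARD('k)) > 0" using u by simp
      ultimately have "?e \<le> exp (- 1 * msq x / (2 * (1 + 1 * u))) / sqrt ((1 + 1 * u) ^ CARD('k))"
        by (intro frac_le) auto
      then show ?thesis using True by (auto intro!: mult_left_mono ennreal_leI)
    qed simp
  qed
  also have "\<dots> = (\<integral>\<^sup>+\<theta>. ennreal (exp (- 1 * msq (x - \<theta>) / 2)) \<partial>prior)"
    by (rule nn_integral_prior_lik_scaled[symmetric]) simp
  also have "\<dots> = ennreal (evid x)" unfolding ennreal_evid lik_def by simp
  finally show ?thesis using evid_nonneg by (simp add: ennreal_le_iff)
qed

lemma evid_pos: "evid x > 0"
  using evid_ge[of x] evid_const_pos lik_bounds(1)[of x 0] by (smt (verit) mult_pos_pos)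

lemma post_dens_nonneg: "lik x \<theta> / evid x \<ge> 0"
  using lik_bounds(1)[of x \<theta>] evid_pos[of x] by (simp add: less_imp_le)

lemma post_eq: "post x = density prior (\<lambda>\<theta>. ennreal (lik x \<theta> / evid x))"
proof -
  have "(\<integral>\<theta>. mvn_density \<theta> S x \<partial>prior) = evid x / gauss_const"
    unfolding mvn_density_eq evid_def by simp
  then show ?thesis unfolding post_def bayes_posterior_def mvn_density_eq using gauss_const_pos by simp
qed

lemma sets_post [measurable_cong]: "sets (post x) = sets borel"
  unfolding post_eq by (simp add: sets_prior)

lemma nn_integral_post:
  assumes [measurable]: "f \<in> borel_measurable borel"
  shows "(\<integral>\<^sup>+\<theta>. f \<theta> \<partial>post x) = (\<integral>\<^sup>+\<theta>. ennreal (lik x \<theta> / evid x) * f \<theta> \<partial>prior)"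
  unfolding post_eq by (subst nn_integral_density) auto

lemma nn_integral_lik_evid: "(\<integral>\<^sup>+\<theta>. ennreal (lik x \<theta> / evid x) \<partial>prior) = 1"
proof -
  have "(\<integral>\<^sup>+\<theta>. ennreal (lik x \<theta> / evid x) \<partial>prior) = (\<integral>\<^sup>+\<theta>. ennreal (1 / evid x) * ennreal (lik x \<theta>) \<partial>prior)"
    using evid_nonneg by (simp add: ennreal_mult'[symmetric])
  also have "\<dots> = ennreal (1 / evid x) * ennreal (evid x)"
    by (subst nn_integral_cmult) (simp_all add: ennreal_evid)
  also have "\<dots> = 1" using evid_pos[of x] by (simp add: ennreal_mult'[symmetric])
  finally show ?thesis .
qed

lemma prob_space_post: "prob_space (post x)"
proof
  show "emeasure (post x) (space (post x)) = 1"
    unfolding post_eq by (subst emeasure_density) (simp_all add: nn_integral_lik_evid)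
qed

definition flat_const :: real where "flat_const = sqrt (2 ^ CARD('k)) * (2 / c) powr (d + 1)"

lemma flat_const_pos: "flat_const > 0"
  unfolding flat_const_def using c by simp

text \<open>Halving the precision of the likelihood amounts to shifting the mixing variable by \<open>1\<close>, and the
  Lomax density changes under this shift by a factor which is polynomial in \<open>1 / c\<close>.\<close>

lemma half_precision:
  "(\<integral>\<^sup>+\<theta>. ennreal (exp (- (1/2) * msq (x - \<theta>) / 2)) \<partial>prior) \<le> ennreal (flat_const * evid x)"
proof -
  let ?g = "\<lambda>v. exp (- 1 * msq x / (2 * (1 + 1 * v))) / sqrt ((1 + 1 * v) ^ CARD('k))"
  have "(\<integral>\<^sup>+\<theta>. ennreal (exp (- (1/2) * msq (x - \<theta>) / 2)) \<partial>prior)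
    = (\<integral>\<^sup>+u. ennreal (lomax_density d c u) *
        ennreal (exp (- (1/2) * msq x / (2 * (1 + (1/2) * u))) / sqrt ((1 + (1/2) * u) ^ CARD('k))) \<partial>lborel)"
    by (rule nn_integral_prior_lik_scaled) simp
  also have "\<dots> \<le> (\<integral>\<^sup>+u. ennreal flat_const * (ennreal (lomax_density d c (u + 1)) * ennreal (?g (u + 1))) \<partial>lborel)"
  proof (rule nn_integral_mono)
    fix u :: real
    show "ennreal (lomax_density d c u) *
        ennreal (exp (- (1/2) * msq x / (2 * (1 + (1/2) * u))) / sqrt ((1 + (1/2) * u) ^ CARD('k)))
      \<le> ennreal flat_const * (ennreal (lomax_density d c (u + 1)) * ennreal (?g (u + 1)))"
    proof (cases "u > 0")
      case True
      have "(1 + (1/2) * u) = (2 + u) / 2" by simp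
      then have sq: "sqrt ((1 + (1/2) * u) ^ CARD('k)) = sqrt ((2 + u) ^ CARD('k)) / sqrt (2 ^ CARD('k))"
        by (simp only: power_divide real_sqrt_divide)
      have ex: "- (1/2) * msq x / (2 * (1 + (1/2) * u)) = - 1 * msq x / (2 * (1 + 1 * (u + 1)))"
        using True by (simp add: field_simps)
      have eq: "exp (- (1/2) * msq x / (2 * (1 + (1/2) * u))) / sqrt ((1 + (1/2) * u) ^ CARD('k))
         = sqrt (2 ^ CARD('k)) * ?g (u + 1)"
        unfolding ex sq by (simp add: add.commute[of _ u] add.assoc)
      have g: "?g (u + 1) \<ge> 0" using True by simp
      have "lomax_density d c u * (sqrt (2 ^ CARD('k)) * ?g (u + 1))
        \<le> ((2 / c) powr (d + 1) * lomax_density d c (u + 1)) * (sqrt (2 ^ CARD('k)) * ?g (u + 1))"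
        by (intro mult_right_mono lomax_shift d c True mult_nonneg_nonneg g) simp
      also have "\<dots> = flat_const * (lomax_density d c (u + 1) * ?g (u + 1))"
        by (simp add: flat_const_def)
      finally have "ennreal (lomax_density d c u * (sqrt (2 ^ CARD('k)) * ?g (u + 1)))
         \<le> ennreal (flat_const * (lomax_density d c (u + 1) * ?g (u + 1)))" by (rule ennreal_leI)
      then show ?thesis unfolding eq using lomax_nonneg[OF d(1)] flat_const_pos g
        by (simp only: ennreal_mult' less_imp_le)
    qed (simp add: lomax_density_def)
  qed
  also have "\<dots> = ennreal flat_const * (\<integral>\<^sup>+u. ennreal (lomax_density d c (u + 1)) * ennreal (?g (u + 1)) \<partial>lborel)"
    by (rule nn_integral_cmult) measurable
  also have "(\<integral>\<^sup>+u. ennreal (lomax_density d c (u + 1)) * ennreal (?g (u + 1)) \<partial>lborel)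
     = (\<integral>\<^sup>+u. ennreal (lomax_density d c u) * ennreal (?g u) \<partial>lborel)"
    by (rule nn_integral_translate) measurable
  also have "\<dots> = (\<integral>\<^sup>+\<theta>. ennreal (exp (- 1 * msq (x - \<theta>) / 2)) \<partial>prior)"
    by (rule nn_integral_prior_lik_scaled[symmetric]) simp
  also have "\<dots> = ennreal (evid x)" unfolding ennreal_evid lik_def by simp
  also have "ennreal flat_const * ennreal (evid x) = ennreal (flat_const * evid x)"
    using flat_const_pos by (simp add: ennreal_mult')
  finally show ?thesis .
qed

definition resid_bound :: real where "resid_bound = 4 * (ln flat_const + 1)"

lemma resid_bound_ge: "resid_bound \<ge> 4"
proof -
  have "1 \<le> sqrt (2 ^ CARD('k))" by simp
  moreover have "1 \<le> (2 / c) powr (d + 1)" using c d by (intro ge_one_powr_ge_zero) (auto simp: field_simps)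
  ultimately have "1 \<le> flat_const" unfolding flat_const_def using mult_mono[of 1 "sqrt (2 ^ CARD('k))" 1 "(2 / c) powr (d + 1)"] by simp
  then show ?thesis unfolding resid_bound_def by simp
qed

text \<open>Jensen's inequality for the exponential, in the form of its tangent at \<open>ln flat_const\<close>. The bound is
  uniform in \<open>x\<close>, hence later also in the unknown means, and grows only like \<open>ln (1 / c)\<close>.\<close>

lemma post_residual:
  "(\<integral>\<^sup>+\<theta>. ennreal (msq (x - \<theta>)) \<partial>post x) \<le> ennreal resid_bound"
proof -
  let ?s = "\<lambda>\<theta>. msq (x - \<theta>) / 4"
  let ?K = "4 / (flat_const * evid x)"
  have L: "ln flat_const \<ge> 0" using resid_bound_ge unfolding resid_bound_def by simp
  have K: "?K \<ge> 0" using flat_const_pos evid_pos[of x] by simp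
  have "(\<integral>\<^sup>+\<theta>. ennreal (msq (x - \<theta>)) \<partial>post x)
     = (\<integral>\<^sup>+\<theta>. ennreal (lik x \<theta> / evid x) * ennreal (msq (x - \<theta>)) \<partial>prior)"
    by (rule nn_integral_post) measurable
  also have "\<dots> \<le> (\<integral>\<^sup>+\<theta>. ennreal (4 * ln flat_const) * ennreal (lik x \<theta> / evid x)
       + ennreal ?K * ennreal (exp (- (1/2) * msq (x - \<theta>) / 2)) \<partial>prior)"
  proof (rule nn_integral_mono)
    fix \<theta>
    have "?s \<theta> - ln flat_const \<le> exp (?s \<theta> - ln flat_const)"
      using exp_ge_add_one_self[of "?s \<theta> - ln flat_const"] by linarith
    also have "\<dots> = exp (?s \<theta>) / flat_const" using flat_const_pos by (simp add: exp_diff)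
    finally have "msq (x - \<theta>) \<le> 4 * ln flat_const + 4 * (exp (?s \<theta>) / flat_const)" by simp
    then have "lik x \<theta> / evid x * msq (x - \<theta>) \<le> lik x \<theta> / evid x * (4 * ln flat_const + 4 * (exp (?s \<theta>) / flat_const))"
      using lik_bounds(1)[of x \<theta>] evid_pos[of x] by (intro mult_left_mono) auto
    also have "\<dots> = 4 * ln flat_const * (lik x \<theta> / evid x) + ?K * (lik x \<theta> * exp (?s \<theta>))"
      by (simp add: algebra_simps)
    also have "lik x \<theta> * exp (?s \<theta>) = exp (- (1/2) * msq (x - \<theta>) / 2)"
      unfolding lik_def exp_add[symmetric] by simp
    finally have "ennreal (lik x \<theta> / evid x * msq (x - \<theta>)) \<le>
        ennreal (4 * ln flat_const * (lik x \<theta> / evid x) + ?K * exp (- (1/2) * msq (x - \<theta>) / 2))"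
      by (rule ennreal_leI)
    also have "\<dots> = ennreal (4 * ln flat_const) * ennreal (lik x \<theta> / evid x) + ennreal ?K * ennreal (exp (- (1/2) * msq (x - \<theta>) / 2))"
      using L K lik_bounds(1)[of x \<theta>] evid_pos[of x] by (intro ennreal_lincomb) auto
    finally show "ennreal (lik x \<theta> / evid x) * ennreal (msq (x - \<theta>)) \<le>
       ennreal (4 * ln flat_const) * ennreal (lik x \<theta> / evid x) + ennreal ?K * ennreal (exp (- (1/2) * msq (x - \<theta>) / 2))"
      by (subst ennreal_mult''[symmetric]) auto
  qed
  also have "\<dots> = ennreal (4 * ln flat_const) * (\<integral>\<^sup>+\<theta>. ennreal (lik x \<theta> / evid x) \<partial>prior)
      + ennreal ?K * (\<integral>\<^sup>+\<theta>. ennreal (exp (- (1/2) * msq (x - \<theta>) / 2)) \<partial>prior)"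
    by (subst nn_integral_add, measurable, subst (1 2) nn_integral_cmult, measurable)
  also have "\<dots> \<le> ennreal (4 * ln flat_const) * 1 + ennreal ?K * ennreal (flat_const * evid x)"
    by (intro add_mono mult_left_mono half_precision) (simp_all add: nn_integral_lik_evid)
  also have "\<dots> = ennreal (4 * ln flat_const) + ennreal 4"
    using flat_const_pos evid_pos[of x] K by (subst ennreal_mult'[symmetric]) auto
  also have "\<dots> = ennreal resid_bound"
  proof -
    have "resid_bound = 4 * ln flat_const + 4" by (simp add: resid_bound_def)
    then show ?thesis using L by (simp only:) (subst ennreal_plus, auto)
  qed
  finally show ?thesis .
qed

end

section \<open>Risk at a zero mean\<close>

lemma norm_sq_sum_le: "(norm (a + b :: 'a::real_inner))\<^sup>2 \<le> 2 * (norm a)\<^sup>2 + 2 * (norm b)\<^sup>2"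
proof -
  have "(norm (a + b))\<^sup>2 + (norm (a - b))\<^sup>2 = 2 * (norm a)\<^sup>2 + 2 * (norm b)\<^sup>2"
    by (simp add: power2_norm_eq_inner inner_add_left inner_add_right inner_diff_left inner_diff_right)
  then show ?thesis by (metis le_add_same_cancel1 zero_le_power2)
qed

context eig_model
begin

definition trunc_const :: real where "trunc_const = 4 * sqrt (2 ^ CARD('k)) / (1 - d) + 1"

text \<open>The prior has no second moment, because \<open>d < 1\<close> makes the mean of the variance factor infinite.\<close>

lemma prior_truncated_sq:
  assumes B: "B \<ge> 1"
  shows "(\<integral>\<^sup>+\<theta>. ennreal (min (msq \<theta>) B) \<partial>prior) \<le> ennreal (trunc_const * B * c powr d)"
proof -
  let ?K = "4 * sqrt (2 ^ CARD('k))"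
  have K: "?K \<ge> 1"
  proof -
    have "sqrt (2 ^ CARD('k)) \<ge> (1::real)" by simp
    then show ?thesis by linarith
  qed
  have "(\<integral>\<^sup>+\<theta>. ennreal (min (msq \<theta>) B) \<partial>prior)
    = (\<integral>\<^sup>+u. ennreal (lomax_density d c u) * (\<integral>\<^sup>+\<theta>. ennreal (mvn_density 0 (u *\<^sub>R S) \<theta>) * ennreal (min (msq \<theta>) B) \<partial>lborel) \<partial>lborel)"
    by (rule eig_prior_mixture[OF d(1) c(1)]) measurable
  also have "\<dots> \<le> (\<integral>\<^sup>+u. ennreal (lomax_density d c u) * ennreal (min (?K * u) B) \<partial>lborel)"
  proof (rule nn_integral_mono)
    fix u :: real
    show "ennreal (lomax_density d c u) * (\<integral>\<^sup>+\<theta>. ennreal (mvn_density 0 (u *\<^sub>R S) \<theta>) * ennreal (min (msq \<theta>) B) \<partial>lborel)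
       \<le> ennreal (lomax_density d c u) * ennreal (min (?K * u) B)"
    proof (cases "u > 0")
      case True
      have nn: "mvn_density 0 (u *\<^sub>R S) \<theta> \<ge> 0" for \<theta>
        using True det_S_pos by (simp add: mvn_density_scaled)
      have "(\<integral>\<^sup>+\<theta>. ennreal (mvn_density 0 (u *\<^sub>R S) \<theta>) * ennreal (min (msq \<theta>) B) \<partial>lborel)
        \<le> (\<integral>\<^sup>+\<theta>. ennreal (mvn_density 0 (u *\<^sub>R S) \<theta> * msq \<theta>) \<partial>lborel)"
        using nn by (intro nn_integral_mono) (simp add: ennreal_mult' mult_left_mono ennreal_leI)
      also have "\<dots> \<le> ennreal (?K * u)" by (rule nn_integral_scaled_sq[OF True])
      finally have 1: "(\<integral>\<^sup>+\<theta>. ennreal (mvn_density 0 (u *\<^sub>R S) \<theta>) * ennreal (min (msq \<theta>) B) \<partial>lborel) \<le> ennreal (?K * u)" .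
      have "(\<integral>\<^sup>+\<theta>. ennreal (mvn_density 0 (u *\<^sub>R S) \<theta>) * ennreal (min (msq \<theta>) B) \<partial>lborel)
        \<le> (\<integral>\<^sup>+\<theta>. (ennreal (mvn_density 0 (u *\<^sub>R S) \<theta>) * ennreal (exp (- 0 * msq (0 - \<theta>) / 2))) * ennreal B \<partial>lborel)"
        by (intro nn_integral_mono) (simp add: mult_left_mono ennreal_leI)
      also have "\<dots> = (\<integral>\<^sup>+\<theta>. (ennreal (mvn_density 0 (u *\<^sub>R S) \<theta>) * ennreal (exp (- 0 * msq (0 - \<theta>) / 2))) \<partial>lborel) * ennreal B"
        by (rule nn_integral_multc) measurable
      also have "\<dots> = ennreal B" by (subst nn_integral_lik_scaled) (use True in auto)
      finally have 2: "(\<integral>\<^sup>+\<theta>. ennreal (mvn_density 0 (u *\<^sub>R S) \<theta>) * ennreal (min (msq \<theta>) B) \<partial>lborel) \<le> ennreal B" .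
      show ?thesis using 1 2 by (intro mult_left_mono) (auto simp: min_def)
    qed (simp add: lomax_density_def)
  qed
  also have "\<dots> \<le> ennreal ((?K / (1 - d) + 1) * B * c powr d)"
    by (rule lomax_truncated_moment[OF d c(1) K B])
  finally show ?thesis unfolding trunc_const_def .
qed

definition post_sq :: "real^'k \<Rightarrow> ennreal" where
  "post_sq x = (\<integral>\<^sup>+\<theta>. ennreal (msq \<theta>) \<partial>post x)"

lemma post_sq_eq: "post_sq x = (\<integral>\<^sup>+\<theta>. ennreal (lik x \<theta> / evid x) * ennreal (msq \<theta>) \<partial>prior)"
  unfolding post_sq_def by (rule nn_integral_post) measurable

lemma borel_measurable_post_sq [measurable]: "post_sq \<in> borel_measurable borel"
  unfolding post_sq_eq[abs_def] by (rule prior.borel_measurable_nn_integral) measurable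

lemma post_sq_le: "post_sq x \<le> ennreal (2 * msq x + 2 * resid_bound)"
proof -
  interpret p: prob_space "post x" by (rule prob_space_post)
  have le: "msq \<theta> \<le> 2 * msq x + 2 * msq (x - \<theta>)" for \<theta>
    using norm_sq_sum_le[of "W *v x" "- (W *v (x - \<theta>))"]
    by (simp add: matrix_vector_mult_diff_distrib norm_minus_commute)
  have "post_sq x \<le> (\<integral>\<^sup>+\<theta>. ennreal (2 * msq x) + 2 * ennreal (msq (x - \<theta>)) \<partial>post x)"
    unfolding post_sq_def
  proof (rule nn_integral_mono)
    fix \<theta>
    have "ennreal (msq \<theta>) \<le> ennreal (2 * msq x + 2 * msq (x - \<theta>))"
      by (rule ennreal_leI[OF le])
    then show "ennreal (msq \<theta>) \<le> ennreal (2 * msq x) + 2 * ennreal (msq (x - \<theta>))"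
      by (simp add: ennreal_plus ennreal_mult')
  qed
  also have "\<dots> = ennreal (2 * msq x) + 2 * (\<integral>\<^sup>+\<theta>. ennreal (msq (x - \<theta>)) \<partial>post x)"
    by (subst nn_integral_add, measurable, subst nn_integral_cmult, measurable) (simp add: p.emeasure_space_1)
  also have "\<dots> \<le> ennreal (2 * msq x) + 2 * ennreal resid_bound"
    by (intro add_left_mono mult_left_mono post_residual) auto
  also have "\<dots> = ennreal (2 * msq x + 2 * resid_bound)"
    using resid_bound_ge by (simp add: ennreal_plus ennreal_mult')
  finally show ?thesis .
qed

text \<open>For \<open>\<parallel>x\<parallel>\<^sup>2 \<le> T\<close> the density of the observation cancels against the evidence, and integrating
  over \<open>x\<close> first leaves a truncated second moment of the prior.\<close>

lemma null_risk_inner: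
  assumes T: "T \<ge> 0"
  shows "(\<integral>\<^sup>+x. ennreal (dens x 0) * (post_sq x * indicator {x. msq x \<le> T} x) \<partial>lborel)
    \<le> ennreal (trunc_const * (2 * T + 8 * sqrt (2 ^ CARD('k))) * c powr d / evid_const)"
proof -
  define I :: "real^'k \<Rightarrow> real" where "I = indicator {x. msq x \<le> T}"
  have [measurable]: "I \<in> borel_measurable borel" unfolding I_def by measurable
  have I: "0 \<le> I x" "I x \<le> 1" for x unfolding I_def by (auto simp: indicator_def)
  define B where "B = 2 * T + 8 * sqrt (2 ^ CARD('k))"
  have B: "B \<ge> 1"
  proof -
    have "sqrt (2 ^ CARD('k)) \<ge> (1::real)" by simp
    then show ?thesis using T unfolding B_def by linarith
  qed
  have "(\<integral>\<^sup>+x. ennreal (dens x 0) * (post_sq x * indicator {x. msq x \<le> T} x) \<partial>lborel)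
     = (\<integral>\<^sup>+x. \<integral>\<^sup>+\<theta>. ennreal (dens x 0 * I x * (lik x \<theta> / evid x * msq \<theta>)) \<partial>prior \<partial>lborel)"
  proof (rule nn_integral_cong)
    fix x
    have nn: "lik x \<theta> / evid x \<ge> 0" "dens x 0 * I x \<ge> 0" for \<theta>
      using lik_bounds(1)[of x] evid_pos[of x] gauss_const_pos I by (auto simp: less_imp_le)
    have "(\<integral>\<^sup>+\<theta>. ennreal (dens x 0 * I x * (lik x \<theta> / evid x * msq \<theta>)) \<partial>prior)
      = (\<integral>\<^sup>+\<theta>. ennreal (dens x 0 * I x) * (ennreal (lik x \<theta> / evid x) * ennreal (msq \<theta>)) \<partial>prior)"
      using nn by (intro nn_integral_cong) (simp only: ennreal_mult'' zero_le_power2 mult_nonneg_nonneg)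
    also have "\<dots> = ennreal (dens x 0 * I x) * post_sq x"
      unfolding post_sq_eq by (rule nn_integral_cmult) measurable
    also have "\<dots> = ennreal (dens x 0) * (post_sq x * indicator {x. msq x \<le> T} x)"
      by (auto simp: I_def indicator_def)
    finally show "ennreal (dens x 0) * (post_sq x * indicator {x. msq x \<le> T} x)
      = (\<integral>\<^sup>+\<theta>. ennreal (dens x 0 * I x * (lik x \<theta> / evid x * msq \<theta>)) \<partial>prior)" by simp
  qed
  also have "\<dots> \<le> (\<integral>\<^sup>+x. \<integral>\<^sup>+\<theta>. ennreal (1 / evid_const) * ennreal (dens x \<theta> * (I x * msq \<theta>)) \<partial>prior \<partial>lborel)"
  proof (intro nn_integral_mono)
    fix x \<theta>
    have r: "lik x 0 / evid x \<le> 1 / evid_const"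
      using evid_ge[of x] evid_pos[of x] evid_const_pos by (simp add: field_simps)
    have "dens x 0 * I x * (lik x \<theta> / evid x * msq \<theta>)
      = (lik x 0 / evid x) * (dens x \<theta> * (I x * msq \<theta>))"
      by (simp add: mult_ac)
    also have "\<dots> \<le> (1 / evid_const) * (dens x \<theta> * (I x * msq \<theta>))"
      using r I lik_bounds(1)[of x \<theta>] gauss_const_pos by (intro mult_right_mono) auto
    finally have "ennreal (dens x 0 * I x * (lik x \<theta> / evid x * msq \<theta>))
      \<le> ennreal ((1 / evid_const) * (dens x \<theta> * (I x * msq \<theta>)))" by (rule ennreal_leI)
    then show "ennreal (dens x 0 * I x * (lik x \<theta> / evid x * msq \<theta>))
      \<le> ennreal (1 / evid_const) * ennreal (dens x \<theta> * (I x * msq \<theta>))"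
      using evid_const_pos by (subst ennreal_mult'[symmetric]) auto
  qed
  also have "\<dots> = (\<integral>\<^sup>+\<theta>. \<integral>\<^sup>+x. ennreal (1 / evid_const) * ennreal (dens x \<theta> * (I x * msq \<theta>)) \<partial>lborel \<partial>prior)"
  proof -
    interpret pair_sigma_finite lborel prior ..
    show ?thesis by (rule Fubini'[symmetric]) measurable
  qed
  also have "\<dots> = (\<integral>\<^sup>+\<theta>. ennreal (1 / evid_const) * (\<integral>\<^sup>+x. ennreal (dens x \<theta> * (I x * msq \<theta>)) \<partial>lborel) \<partial>prior)"
    by (intro nn_integral_cong nn_integral_cmult) measurable
  also have "\<dots> = ennreal (1 / evid_const) * (\<integral>\<^sup>+\<theta>. (\<integral>\<^sup>+x. ennreal (dens x \<theta> * (I x * msq \<theta>)) \<partial>lborel) \<partial>prior)"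
    by (rule nn_integral_cmult) measurable
  also have "\<dots> \<le> ennreal (1 / evid_const) * (\<integral>\<^sup>+\<theta>. ennreal (min (msq \<theta>) B) \<partial>prior)"
  proof (intro mult_left_mono nn_integral_mono)
    fix \<theta>
    let ?n = "msq \<theta>"
    have one: "(\<integral>\<^sup>+x. ennreal (dens x \<theta>) \<partial>lborel) = 1"
      using nn_integral_lik_exp[of 0 \<theta>] by simp
    note nn = dens_nonneg[of _ \<theta>]
    have "(\<integral>\<^sup>+x. ennreal (dens x \<theta> * (I x * ?n)) \<partial>lborel) \<le> (\<integral>\<^sup>+x. ennreal (dens x \<theta>) * ennreal ?n \<partial>lborel)"
    proof (rule nn_integral_mono)
      fix x
      have "dens x \<theta> * (I x * ?n) \<le> dens x \<theta> * ?n"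
        using I[of x] nn[of x] by (intro mult_left_mono mult_left_le_one_le) auto
      then show "ennreal (dens x \<theta> * (I x * ?n)) \<le> ennreal (dens x \<theta>) * ennreal ?n"
        by (subst ennreal_mult''[symmetric]) (auto intro: ennreal_leI)
    qed
    also have "\<dots> = ennreal ?n" by (subst nn_integral_multc) (simp_all add: one)
    finally have 1: "(\<integral>\<^sup>+x. ennreal (dens x \<theta> * (I x * ?n)) \<partial>lborel) \<le> ennreal ?n" .
    have "(\<integral>\<^sup>+x. ennreal (dens x \<theta> * (I x * ?n)) \<partial>lborel)
      \<le> (\<integral>\<^sup>+x. ennreal (2 * T) * ennreal (dens x \<theta>) + ennreal 2 * ennreal (dens x \<theta> * msq (x - \<theta>)) \<partial>lborel)"
    proof (rule nn_integral_mono)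
      fix x
      have "I x * ?n \<le> 2 * T + 2 * msq (x - \<theta>)"
      proof (cases "msq x \<le> T")
        case True
        have "?n \<le> 2 * msq x + 2 * msq (x - \<theta>)"
          using norm_sq_sum_le[of "W *v x" "- (W *v (x - \<theta>))"]
    by (simp add: matrix_vector_mult_diff_distrib norm_minus_commute)
        then show ?thesis using True by (simp add: I_def)
      qed (use T in \<open>simp add: I_def\<close>)
      then have "dens x \<theta> * (I x * ?n) \<le> dens x \<theta> * (2 * T + 2 * msq (x - \<theta>))"
        using nn by (intro mult_left_mono) auto
      also have "\<dots> = 2 * T * (dens x \<theta>) + 2 * (dens x \<theta> * msq (x - \<theta>))"
        by (simp add: algebra_simps)
      finally have "ennreal (dens x \<theta> * (I x * ?n)) \<le> ennreal (2 * T * (dens x \<theta>) + 2 * (dens x \<theta> * msq (x - \<theta>)))"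
        by (rule ennreal_leI)
      also have "\<dots> = ennreal (2 * T) * ennreal (dens x \<theta>) + ennreal 2 * ennreal (dens x \<theta> * msq (x - \<theta>))"
        using T nn by (intro ennreal_lincomb mult_nonneg_nonneg) auto
      finally show "ennreal (dens x \<theta> * (I x * ?n)) \<le> \<dots>" .
    qed
    also have "\<dots> = ennreal (2 * T) * 1 + ennreal 2 * (\<integral>\<^sup>+x. ennreal (dens x \<theta> * msq (x - \<theta>)) \<partial>lborel)"
      by (subst nn_integral_add, measurable, subst (1 2) nn_integral_cmult, measurable, simp only: one)
    also have "\<dots> \<le> ennreal (2 * T) * 1 + ennreal 2 * ennreal (4 * sqrt (2 ^ CARD('k)))"
      by (intro add_left_mono mult_left_mono nn_integral_lik_sq) auto
    also have "\<dots> = ennreal B" using T unfolding B_def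
      by (subst ennreal_mult'[symmetric]) (auto simp: ennreal_plus[symmetric] simp del: ennreal_plus)
    finally have 2: "(\<integral>\<^sup>+x. ennreal (dens x \<theta> * (I x * ?n)) \<partial>lborel) \<le> ennreal B" .
    show "(\<integral>\<^sup>+x. ennreal (dens x \<theta> * (I x * ?n)) \<partial>lborel) \<le> ennreal (min ?n B)"
      using 1 2 by (auto simp: min_def)
  qed simp
  also have "\<dots> \<le> ennreal (1 / evid_const) * ennreal (trunc_const * B * c powr d)"
    by (intro mult_left_mono prior_truncated_sq[OF B]) simp
  also have "\<dots> = ennreal (trunc_const * B * c powr d / evid_const)"
    using evid_const_pos by (subst ennreal_mult'[symmetric]) auto
  finally show ?thesis unfolding B_def .
qed

text \<open>For \<open>\<parallel>x\<parallel>\<^sup>2 > T\<close> the crude bound by \<open>\<parallel>x\<parallel>\<^sup>2\<close> and the residual suffices, by an exponential Markov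
  inequality.\<close>

lemma null_risk_outer:
  "(\<integral>\<^sup>+x. ennreal (dens x 0) * (post_sq x * indicator {x. \<not> msq x \<le> T} x) \<partial>lborel)
    \<le> ennreal (exp (- T / 4) * ((16 + 2 * resid_bound) * 2 ^ CARD('k)))"
proof -
  let ?C = "exp (- T / 4) * (16 + 2 * resid_bound)"
  have C: "?C \<ge> 0" using resid_bound_ge by simp
  have "(\<integral>\<^sup>+x. ennreal (dens x 0) * (post_sq x * indicator {x. \<not> msq x \<le> T} x) \<partial>lborel)
    \<le> (\<integral>\<^sup>+x. ennreal ?C * ennreal (dens x 0 * exp ((3/4) * msq (x - 0) / 2)) \<partial>lborel)"
  proof (rule nn_integral_mono)
    fix x
    let ?n = "msq x"
    note nn = dens_nonneg[of x 0]
    have "post_sq x * indicator {x. \<not> msq x \<le> T} x \<le> ennreal (?C * exp ((3/4) * ?n / 2))"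
    proof (cases "?n \<le> T")
      case False
      have "2 * ?n \<le> 16 * exp (?n / 8)" using exp_ge_add_one_self[of "?n / 8"] by linarith
      moreover have "2 * resid_bound * 1 \<le> 2 * resid_bound * exp (?n / 8)"
        using resid_bound_ge by (intro mult_left_mono) auto
      ultimately have "2 * ?n + 2 * resid_bound \<le> (16 + 2 * resid_bound) * exp (?n / 8)" by (simp add: algebra_simps)
      also have "\<dots> \<le> (16 + 2 * resid_bound) * (exp (- T / 4 + ?n / 4) * exp (?n / 8))"
        using False resid_bound_ge by (intro mult_left_mono mult_le_cancel_right1[THEN iffD2]) auto
      also have "\<dots> = ?C * exp ((3/4) * ?n / 2)"
      proof -
        have "exp (- T / 4 + ?n / 4) * exp (?n / 8) = exp (- T / 4) * exp ((3/4) * ?n / 2)"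
          unfolding exp_add[symmetric] by (rule arg_cong[where f=exp]) linarith
        then show ?thesis by simp
      qed
      finally have "ennreal (2 * ?n + 2 * resid_bound) \<le> ennreal (?C * exp ((3/4) * ?n / 2))" by (rule ennreal_leI)
      with post_sq_le[of x] have "post_sq x \<le> ennreal (?C * exp ((3/4) * ?n / 2))" by (rule order_trans)
      then show ?thesis using False by simp
    qed simp
    then have "ennreal (dens x 0) * (post_sq x * indicator {x. \<not> msq x \<le> T} x)
      \<le> ennreal (dens x 0) * ennreal (?C * exp ((3/4) * ?n / 2))" by (rule mult_left_mono) simp
    also have "\<dots> = ennreal ((dens x 0) * (?C * exp ((3/4) * ?n / 2)))"
      using nn by (rule ennreal_mult'[symmetric])
    also have "(dens x 0) * (?C * exp ((3/4) * ?n / 2)) = ?C * (dens x 0 * exp ((3/4) * msq (x - 0) / 2))" by simp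
    also have "ennreal \<dots> = ennreal ?C * ennreal (dens x 0 * exp ((3/4) * msq (x - 0) / 2))"
      using C by (rule ennreal_mult')
    finally show "ennreal (dens x 0) * (post_sq x * indicator {x. \<not> msq x \<le> T} x) \<le> \<dots>" .
  qed
  also have "\<dots> = ennreal ?C * (\<integral>\<^sup>+x. ennreal (dens x 0 * exp ((3/4) * msq (x - 0) / 2)) \<partial>lborel)"
    by (rule nn_integral_cmult) measurable
  also have "\<dots> = ennreal ?C * ennreal (1 / sqrt ((1 - 3/4) ^ CARD('k)))"
    by (subst nn_integral_lik_exp) auto
  also have "1 / sqrt ((1 - 3/4) ^ CARD('k)) = (2::real) ^ CARD('k)"
  proof -
    have "(1 - 3/4 :: real) ^ CARD('k) = ((1/2) ^ CARD('k))\<^sup>2"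
      by (simp add: power_mult[symmetric] mult.commute power_mult power2_eq_square power_mult_distrib[symmetric])
    then show ?thesis by (simp only: real_sqrt_abs) (simp add: power_one_over)
  qed
  also have "ennreal ?C * ennreal (2 ^ CARD('k)) = ennreal (?C * 2 ^ CARD('k))"
    using C by (rule ennreal_mult'[symmetric])
  finally show ?thesis by (simp only: mult.assoc)
qed

text \<open>The radius \<open>T = 4 d ln (1 / c)\<close> is chosen to give \<open>exp (- T / 4) = c powr d\<close>; then both parts are of
  order \<open>c powr d\<close> up to a factor \<open>1 + ln (1 / c)\<close>.\<close>

lemma null_risk:
  "(\<integral>\<^sup>+x. post_sq x \<partial>mvn 0 S) \<le> ennreal (c powr d *
     (trunc_const * (8 * d * ln (1 / c) + 8 * sqrt (2 ^ CARD('k))) / evid_const + (16 + 2 * resid_bound) * 2 ^ CARD('k)))"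
proof -
  define T where "T = 4 * d * ln (1 / c)"
  have T: "T \<ge> 0" unfolding T_def using c d by simp
  have eT: "exp (- T / 4) = c powr d" unfolding T_def using c by (simp add: powr_def ln_div)
  have "(\<integral>\<^sup>+x. post_sq x \<partial>mvn 0 S) = (\<integral>\<^sup>+x. ennreal (dens x 0) * post_sq x \<partial>lborel)"
    by (rule nn_integral_mvn) measurable
  also have "\<dots> = (\<integral>\<^sup>+x. ennreal (dens x 0) * (post_sq x * indicator {x. msq x \<le> T} x)
      + ennreal (dens x 0) * (post_sq x * indicator {x. \<not> msq x \<le> T} x) \<partial>lborel)"
    by (rule nn_integral_cong) (auto simp: indicator_def)
  also have "\<dots> = (\<integral>\<^sup>+x. ennreal (dens x 0) * (post_sq x * indicator {x. msq x \<le> T} x) \<partial>lborel)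
      + (\<integral>\<^sup>+x. ennreal (dens x 0) * (post_sq x * indicator {x. \<not> msq x \<le> T} x) \<partial>lborel)"
    by (rule nn_integral_add) measurable
  also have "\<dots> \<le> ennreal (trunc_const * (2 * T + 8 * sqrt (2 ^ CARD('k))) * c powr d / evid_const)
      + ennreal (exp (- T / 4) * ((16 + 2 * resid_bound) * 2 ^ CARD('k)))"
    by (intro add_mono null_risk_inner null_risk_outer T)
  also have "\<dots> = ennreal (trunc_const * (2 * T + 8 * sqrt (2 ^ CARD('k))) * c powr d / evid_const
      + exp (- T / 4) * ((16 + 2 * resid_bound) * 2 ^ CARD('k)))"
    using T evid_const_pos resid_bound_ge d by (intro ennreal_plus[symmetric]) (auto simp: trunc_const_def)
  also have "trunc_const * (2 * T + 8 * sqrt (2 ^ CARD('k))) * c powr d / evid_const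
      + exp (- T / 4) * ((16 + 2 * resid_bound) * 2 ^ CARD('k)) = c powr d *
     (trunc_const * (8 * d * ln (1 / c) + 8 * sqrt (2 ^ CARD('k))) / evid_const + (16 + 2 * resid_bound) * 2 ^ CARD('k))"
    unfolding eT by (simp add: T_def algebra_simps)
  finally show ?thesis .
qed

end

section \<open>Posterior variance at an arbitrary mean\<close>

lemma integral_translate:
  fixes f :: "'a::euclidean_space \<Rightarrow> real"
  assumes [measurable]: "f \<in> borel_measurable borel"
  shows "(\<integral>x. f (x + t) \<partial>lborel) = (\<integral>x. f x \<partial>lborel)"
proof -
  have "(\<integral>x. f x \<partial>distr lborel borel ((+) t)) = (\<integral>x. f (t + x) \<partial>lborel)"
    by (subst integral_distr) auto
  then show ?thesis by (simp add: lborel_distr_plus add.commute)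
qed

lemma integrable_translate:
  fixes f :: "'a::euclidean_space \<Rightarrow> real"
  assumes f: "integrable lborel f"
  shows "integrable lborel (\<lambda>x. f (x + t))"
proof -
  have "integrable (distr lborel borel ((+) t)) f" using f by (simp add: lborel_distr_plus)
  then have "integrable lborel (\<lambda>x. f (t + x))"
    by (subst (asm) integrable_distr_eq) (use f in auto)
  then show ?thesis by (simp add: add.commute)
qed

lemma abs_exp_diff_le:
  fixes a b :: real
  shows "\<bar>exp a - exp b\<bar> \<le> \<bar>a - b\<bar> * (exp a + exp b)"
proof -
  have *: "exp a - exp b \<le> (a - b) * (exp a + exp b)" "exp b \<le> exp a" if "b \<le> a" for a b :: real
  proof -
    have "exp a * (1 + (b - a)) \<le> exp a * exp (b - a)"
      by (intro mult_left_mono exp_ge_add_one_self) auto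
    then have "exp a - exp b \<le> (a - b) * exp a" by (simp add: exp_diff algebra_simps)
    moreover have "b * exp b \<le> a * exp b" using that by (intro mult_right_mono) auto
    ultimately show "exp a - exp b \<le> (a - b) * (exp a + exp b)" unfolding ring_distribs by linarith
  qed (use that in simp)
  show ?thesis
  proof (cases "b \<le> a")
    case True then show ?thesis using *[of b a] by simp
  next
    case False then show ?thesis using *[of a b] by (simp add: add.commute)
  qed
qed

context eig_model
begin

definition resid :: "'k \<Rightarrow> real^'k \<Rightarrow> real^'k \<Rightarrow> real" where
  "resid j x \<theta> = (W *v (\<theta> - x)) $ j"

text \<open>By Tweedie's formula, this posterior mean of \<open>resid j x\<close> is the derivative of \<open>ln evid\<close> in the direction
  \<open>dir j\<close> defined below.\<close>

definition score :: "'k \<Rightarrow> real^'k \<Rightarrow> real" where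
  "score j x = (\<integral>\<theta>. lik x \<theta> * resid j x \<theta> \<partial>prior) / evid x"

definition dir :: "'k \<Rightarrow> real^'k" where
  "dir j = matrix_inv W *v axis j 1"

lemma W_dir: "W *v dir j = axis j 1"
  unfolding dir_def using invertible_W by (simp add: matrix_vector_mul_assoc matrix_inv_props)

lemma borel_measurable_resid [measurable]:
  "f \<in> borel_measurable M \<Longrightarrow> g \<in> borel_measurable M \<Longrightarrow> (\<lambda>w. resid j (f w) (g w)) \<in> borel_measurable M"
proof -
  assume [measurable]: "f \<in> borel_measurable M" "g \<in> borel_measurable M"
  have "resid j (f w) (g w) = (W *v (g w - f w)) \<bullet> axis j 1" for w
    by (simp add: resid_def inner_axis)
  then show ?thesis by simp
qed

lemma borel_measurable_score [measurable]: "score j \<in> borel_measurable borel"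
proof -
  have "(\<lambda>x. \<integral>\<theta>. lik x \<theta> * resid j x \<theta> \<partial>prior) \<in> borel_measurable borel"
    by (rule prior.borel_measurable_lebesgue_integral) measurable
  then show ?thesis unfolding score_def[abs_def] by measurable
qed

lemma resid_sq_le: "(resid j x \<theta>)\<^sup>2 \<le> msq (x - \<theta>)"
proof -
  have "\<bar>resid j x \<theta>\<bar> \<le> norm (W *v (\<theta> - x))" unfolding resid_def by (rule component_le_norm_cart)
  also have "\<dots> = norm (W *v (x - \<theta>))" by (simp add: matrix_vector_mult_diff_distrib norm_minus_commute)
  finally show ?thesis by (simp add: abs_le_square_iff[symmetric])
qed

lemma lik_resid_sq: "lik x \<theta> * (resid j x \<theta>)\<^sup>2 \<le> 2"
proof -
  let ?n = "msq (x - \<theta>)"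
  have "(resid j x \<theta>)\<^sup>2 \<le> 2 * exp (?n / 2)" using resid_sq_le[of j x \<theta>] exp_ge_add_one_self[of "?n / 2"] by linarith
  then have "lik x \<theta> * (resid j x \<theta>)\<^sup>2 \<le> lik x \<theta> * (2 * exp (?n / 2))"
    using lik_bounds(1)[of x \<theta>] by (intro mult_left_mono) auto
  also have "\<dots> = 2" by (simp add: lik_def exp_minus)
  finally show ?thesis .
qed

lemma integrable_lik_resid: "integrable prior (\<lambda>\<theta>. lik x \<theta> * resid j x \<theta>)"
proof (rule prior.integrable_const_bound[where B=3])
  show "AE \<theta> in prior. norm (lik x \<theta> * resid j x \<theta>) \<le> 3"
  proof (rule AE_I2)
    fix \<theta>
    have "\<bar>resid j x \<theta>\<bar> \<le> 1 + (resid j x \<theta>)\<^sup>2"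
      using sum_power2_ge_zero[of "\<bar>resid j x \<theta>\<bar> - 1" 0] by (simp add: power2_diff)
    then have "lik x \<theta> * \<bar>resid j x \<theta>\<bar> \<le> lik x \<theta> * (1 + (resid j x \<theta>)\<^sup>2)"
      using lik_bounds(1)[of x \<theta>] by (intro mult_left_mono) auto
    also have "\<dots> \<le> 1 + 2" using lik_resid_sq[of x \<theta> j] lik_bounds(2)[of x \<theta>] by (simp add: algebra_simps)
    finally show "norm (lik x \<theta> * resid j x \<theta>) \<le> 3" using lik_bounds(1)[of x \<theta>] by (simp add: abs_mult)
  qed
qed measurable

lemma integral_lik_resid: "(\<integral>\<theta>. lik x \<theta> * resid j x \<theta> \<partial>prior) = evid x * score j x"
  unfolding score_def using evid_pos[of x] by simp

text \<open>Cauchy--Schwarz, through \<open>2 r \<bar>w\<bar> \<le> r\<^sup>2 + w\<^sup>2\<close>, and the uniform residual bound.\<close>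

lemma abs_score_le: "\<bar>score j x\<bar> \<le> sqrt resid_bound"
proof -
  define r where "r = sqrt resid_bound"
  have r: "r > 0" "r\<^sup>2 = resid_bound" using resid_bound_ge by (auto simp: r_def)
  have i2: "integrable prior (\<lambda>\<theta>. lik x \<theta> * (resid j x \<theta>)\<^sup>2)"
    by (rule prior.integrable_const_bound[where B=2])
       (use lik_resid_sq lik_bounds(1) in \<open>auto simp: less_imp_le\<close>)
  have "ennreal (\<integral>\<theta>. lik x \<theta> * (resid j x \<theta>)\<^sup>2 \<partial>prior) = (\<integral>\<^sup>+\<theta>. ennreal (lik x \<theta> * (resid j x \<theta>)\<^sup>2) \<partial>prior)"
    by (rule nn_integral_eq_integral[symmetric, OF i2]) (use lik_bounds in \<open>auto simp: less_imp_le\<close>)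
  also have "\<dots> \<le> (\<integral>\<^sup>+\<theta>. ennreal (evid x) * (ennreal (lik x \<theta> / evid x) * ennreal (msq (x - \<theta>))) \<partial>prior)"
  proof (rule nn_integral_mono)
    fix \<theta>
    have "lik x \<theta> * (resid j x \<theta>)\<^sup>2 \<le> lik x \<theta> * msq (x - \<theta>)"
      using lik_bounds(1)[of x \<theta>] resid_sq_le by (intro mult_left_mono) auto
    also have "\<dots> = evid x * (lik x \<theta> / evid x * msq (x - \<theta>))" using evid_pos[of x] by simp
    finally have "ennreal (lik x \<theta> * (resid j x \<theta>)\<^sup>2) \<le> ennreal (evid x * (lik x \<theta> / evid x * msq (x - \<theta>)))"
      by (rule ennreal_leI)
    then show "ennreal (lik x \<theta> * (resid j x \<theta>)\<^sup>2) \<le> ennreal (evid x) * (ennreal (lik x \<theta> / evid x) * ennreal (msq (x - \<theta>)))"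
      using evid_pos[of x] lik_bounds(1)[of x \<theta>] by (simp only: ennreal_mult' ennreal_mult'' zero_le_power2 less_imp_le)
  qed
  also have "\<dots> = ennreal (evid x) * (\<integral>\<^sup>+\<theta>. ennreal (msq (x - \<theta>)) \<partial>post x)"
    by (subst nn_integral_post, measurable, subst nn_integral_cmult, measurable)
  also have "\<dots> \<le> ennreal (evid x) * ennreal resid_bound" by (intro mult_left_mono post_residual) auto
  also have "\<dots> = ennreal (evid x * resid_bound)" using evid_nonneg by (simp add: ennreal_mult')
  finally have sq: "(\<integral>\<theta>. lik x \<theta> * (resid j x \<theta>)\<^sup>2 \<partial>prior) \<le> evid x * r\<^sup>2"
    using evid_nonneg[of x] resid_bound_ge by (simp add: r ennreal_le_iff)
  have "\<bar>evid x * score j x\<bar> \<le> (\<integral>\<theta>. \<bar>lik x \<theta> * resid j x \<theta>\<bar> \<partial>prior)"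
    unfolding integral_lik_resid[symmetric] using integral_norm_bound[of prior "\<lambda>\<theta>. lik x \<theta> * resid j x \<theta>"] by simp
  also have "\<dots> \<le> (\<integral>\<theta>. r / 2 * lik x \<theta> + 1 / (2 * r) * (lik x \<theta> * (resid j x \<theta>)\<^sup>2) \<partial>prior)"
  proof (rule integral_mono)
    fix \<theta>
    have "0 \<le> (\<bar>resid j x \<theta>\<bar> - r)\<^sup>2" by simp
    then have "2 * r * \<bar>resid j x \<theta>\<bar> \<le> r\<^sup>2 + (resid j x \<theta>)\<^sup>2" by (simp add: power2_diff mult_ac)
    then have "\<bar>resid j x \<theta>\<bar> \<le> (r\<^sup>2 + (resid j x \<theta>)\<^sup>2) / (2 * r)" using r by (simp add: pos_le_divide_eq mult_ac)
    also have "\<dots> = r / 2 + 1 / (2 * r) * (resid j x \<theta>)\<^sup>2" using r(1) by (simp add: add_divide_distrib power2_eq_square)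
    finally have "lik x \<theta> * \<bar>resid j x \<theta>\<bar> \<le> lik x \<theta> * (r / 2 + 1 / (2 * r) * (resid j x \<theta>)\<^sup>2)"
      using lik_bounds(1)[of x \<theta>] by (intro mult_left_mono) auto
    then show "\<bar>lik x \<theta> * resid j x \<theta>\<bar> \<le> r / 2 * lik x \<theta> + 1 / (2 * r) * (lik x \<theta> * (resid j x \<theta>)\<^sup>2)"
      using lik_bounds(1)[of x \<theta>] by (simp add: abs_mult algebra_simps)
  qed (use integrable_lik_resid i2 integrable_lik in auto)
  also have "\<dots> = r / 2 * evid x + 1 / (2 * r) * (\<integral>\<theta>. lik x \<theta> * (resid j x \<theta>)\<^sup>2 \<partial>prior)"
    using i2 integrable_lik by (simp add: evid_def)
  also have "\<dots> \<le> r / 2 * evid x + 1 / (2 * r) * (evid x * r\<^sup>2)"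
    using r sq by (intro add_left_mono mult_left_mono) auto
  also have "\<dots> = evid x * r" using r(1) by (simp add: power2_eq_square)
  finally show ?thesis using evid_pos[of x] unfolding r_def by (simp add: abs_mult)
qed

text \<open>Moving the observation tilts the posterior exponentially.\<close>

lemma lik_shift: "lik (x + t *\<^sub>R dir j) \<theta> = lik x \<theta> * exp (t * resid j x \<theta> - t\<^sup>2 / 2)"
proof -
  have W: "W *v (x + t *\<^sub>R dir j - \<theta>) = W *v (x - \<theta>) + t *\<^sub>R axis j 1"
    by (simp add: matrix_vector_mult_diff_distrib matrix_vector_right_distrib matrix_vector_mult_scaleR W_dir)
  have r: "(W *v (x - \<theta>)) \<bullet> axis j 1 = - resid j x \<theta>"
    by (simp add: resid_def inner_axis matrix_vector_mult_diff_distrib)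
  have "msq (x + t *\<^sub>R dir j - \<theta>) = msq (x - \<theta>) - 2 * t * resid j x \<theta> + t\<^sup>2"
  proof -
    obtain y where y: "W *v (x - \<theta>) = y" by blast
    have "(y + t *\<^sub>R axis j 1) \<bullet> (y + t *\<^sub>R axis j 1) = y \<bullet> y + 2 * t * (y \<bullet> axis j 1) + t * t"
      by (simp add: inner_add_left inner_add_right inner_commute[of "axis j 1"] inner_axis_axis distrib_left)
    then show ?thesis unfolding W power2_norm_eq_inner using r unfolding y by (simp add: power2_eq_square)
  qed
  then show ?thesis unfolding lik_def exp_add[symmetric] by (simp add: diff_divide_distrib add_divide_distrib)
qed

lemma resid_shift: "resid j (x + t *\<^sub>R dir j) \<theta> = resid j x \<theta> - t"
proof -
  have "W *v (\<theta> - (x + t *\<^sub>R dir j)) = W *v (\<theta> - x) - t *\<^sub>R axis j 1"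
    by (simp add: matrix_vector_mult_diff_distrib matrix_vector_right_distrib matrix_vector_mult_scaleR W_dir)
  then show ?thesis unfolding resid_def by (simp add: axis_def)
qed

text \<open>The difference quotient of the tilted posterior mean; its limit for \<open>t\<close> to \<open>0\<close> is the posterior
  variance of the coordinate.\<close>

definition mean_slope :: "'k \<Rightarrow> real \<Rightarrow> real^'k \<Rightarrow> real" where
  "mean_slope j t x = (score j (x + t *\<^sub>R dir j) + t - score j x) / t"

text \<open>The integrand that represents \<open>mean_slope\<close>. It is nonnegative because \<open>exp\<close> is increasing, which is
  what Fatou's lemma needs.\<close>

definition tilt :: "'k \<Rightarrow> real \<Rightarrow> real^'k \<Rightarrow> real^'k \<Rightarrow> real" where
  "tilt j t x \<theta> = lik x \<theta> * exp (- t\<^sup>2 / 2) *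
     ((exp (t * resid j x \<theta>) - exp (t * score j x)) / t * (resid j x \<theta> - score j x)) / evid (x + t *\<^sub>R dir j)"

lemma borel_measurable_tilt [measurable]: "tilt j t x \<in> borel_measurable borel"
  unfolding tilt_def[abs_def] by measurable

lemma tilt_nonneg:
  assumes "t > 0" shows "tilt j t x \<theta> \<ge> 0"
proof -
  have "(exp (t * resid j x \<theta>) - exp (t * score j x)) / t * (resid j x \<theta> - score j x) \<ge> 0"
  proof (cases "resid j x \<theta> \<ge> score j x")
    case True
    then show ?thesis using assms by (intro mult_nonneg_nonneg divide_nonneg_nonneg) auto
  next
    case False
    then show ?thesis using assms by (intro mult_nonpos_nonpos divide_nonpos_nonneg) auto
  qed
  moreover have "lik x \<theta> * exp (- t\<^sup>2 / 2) \<ge> 0" using lik_bounds(1)[of x \<theta>] by simp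
  ultimately show ?thesis unfolding tilt_def
    by (intro divide_nonneg_nonneg evid_nonneg mult_nonneg_nonneg[of "lik x \<theta> * exp (- t\<^sup>2 / 2)"])
qed

text \<open>The term with \<open>exp (t * score j x)\<close> integrates to \<open>0\<close>, since \<open>score j x\<close> is the posterior mean.\<close>

lemma mean_slope_eq:
  assumes t: "t > 0"
  shows "integrable prior (tilt j t x)" and "(\<integral>\<theta>. tilt j t x \<theta> \<partial>prior) = mean_slope j t x"
proof -
  let ?y = "x + t *\<^sub>R dir j"
  let ?s = "score j x"
  let ?g = "\<lambda>\<theta>. 1 / (t * evid ?y) * ((lik ?y \<theta> * resid j ?y \<theta> + (t - ?s) * lik ?y \<theta>)
      - exp (t * ?s - t\<^sup>2 / 2) * (lik x \<theta> * resid j x \<theta> - ?s * lik x \<theta>))"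
  have eq: "tilt j t x \<theta> = ?g \<theta>" for \<theta>
  proof -
    have "lik ?y \<theta> * resid j ?y \<theta> + (t - ?s) * lik ?y \<theta> = lik x \<theta> * (exp (t * resid j x \<theta>) * exp (- t\<^sup>2 / 2)) * (resid j x \<theta> - ?s)"
      unfolding lik_shift resid_shift by (simp add: exp_add[symmetric] algebra_simps)
    moreover have "exp (t * ?s - t\<^sup>2 / 2) = exp (t * ?s) * exp (- t\<^sup>2 / 2)" by (simp add: exp_add[symmetric])
    ultimately have "?g \<theta> = 1 / (t * evid ?y) * (lik x \<theta> * (exp (t * resid j x \<theta>) * exp (- t\<^sup>2 / 2)) * (resid j x \<theta> - ?s)
       - exp (t * ?s) * exp (- t\<^sup>2 / 2) * (lik x \<theta> * resid j x \<theta> - ?s * lik x \<theta>))" by (simp only:)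
    also have "\<dots> = tilt j t x \<theta>" unfolding tilt_def using t evid_pos[of ?y] by (simp add: field_simps)
    finally show ?thesis ..
  qed
  have int: "integrable prior ?g"
    by (intro integrable_mult_right Bochner_Integration.integrable_diff Bochner_Integration.integrable_add
        integrable_lik_resid integrable_lik)
  then show "integrable prior (tilt j t x)" unfolding eq[abs_def] .
  have "(\<integral>\<theta>. ?g \<theta> \<partial>prior) = 1 / (t * evid ?y) * ((evid ?y * score j ?y + (t - ?s) * evid ?y)
      - exp (t * ?s - t\<^sup>2 / 2) * (evid x * ?s - ?s * evid x))"
    by (simp add: integrable_lik_resid integrable_lik integral_lik_resid evid_def[symmetric])
  also have "\<dots> = mean_slope j t x"
    unfolding mean_slope_def using t evid_pos[of ?y] by (simp add: field_simps)
  finally show "(\<integral>\<theta>. tilt j t x \<theta> \<partial>prior) = mean_slope j t x" unfolding eq[abs_def] .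
qed

lemma mean_slope_nonneg: "t > 0 \<Longrightarrow> mean_slope j t x \<ge> 0"
  using mean_slope_eq(2)[of t j x] tilt_nonneg by (metis integral_nonneg_AE AE_I2)

lemma nn_integral_tilt:
  assumes t: "t > 0"
  shows "(\<integral>\<^sup>+\<theta>. ennreal (tilt j t x \<theta>) \<partial>prior) = ennreal (mean_slope j t x)"
  using nn_integral_eq_integral[OF mean_slope_eq(1)[OF t]] tilt_nonneg[OF t] mean_slope_eq(2)[OF t] by simp

definition coord_var :: "'k \<Rightarrow> real^'k \<Rightarrow> ennreal" where
  "coord_var j x = (\<integral>\<^sup>+\<theta>. ennreal (lik x \<theta> / evid x * (resid j x \<theta> - score j x)\<^sup>2) \<partial>prior)"

lemma borel_measurable_coord_var [measurable]: "coord_var j \<in> borel_measurable borel"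
  unfolding coord_var_def[abs_def] by (rule prior.borel_measurable_nn_integral) measurable

definition step :: "nat \<Rightarrow> real" where "step i = 1 / (real i + 1)"

lemma step: "step i > 0" "step i \<le> 1" "step \<longlonglongrightarrow> 0"
  unfolding step_def using LIMSEQ_inverse_real_of_nat by (auto simp: inverse_eq_divide add.commute)

lemma evid_shift_tendsto: "(\<lambda>i. evid (x + step i *\<^sub>R dir j)) \<longlonglongrightarrow> evid x"
  unfolding evid_def
proof (rule integral_dominated_convergence[where w="\<lambda>_. 1"])
  show "AE \<theta> in prior. (\<lambda>i. lik (x + step i *\<^sub>R dir j) \<theta>) \<longlonglongrightarrow> lik x \<theta>"
  proof (rule AE_I2)
    fix \<theta>
    have "(\<lambda>i. lik x \<theta> * exp (step i * resid j x \<theta> - (step i)\<^sup>2 / 2)) \<longlonglongrightarrow> lik x \<theta> * exp (0 * resid j x \<theta> - 0\<^sup>2 / 2)"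
      by (intro tendsto_intros step) auto
    then show "(\<lambda>i. lik (x + step i *\<^sub>R dir j) \<theta>) \<longlonglongrightarrow> lik x \<theta>" by (simp add: lik_shift)
  qed
  show "AE \<theta> in prior. norm (lik (x + step i *\<^sub>R dir j) \<theta>) \<le> 1" for i
    using lik_bounds by (auto simp: less_imp_le)
qed auto

lemma tilt_tendsto: "(\<lambda>i. tilt j (step i) x \<theta>) \<longlonglongrightarrow> lik x \<theta> / evid x * (resid j x \<theta> - score j x)\<^sup>2"
proof -
  let ?w = "resid j x \<theta>" and ?s = "score j x"
  have der: "((\<lambda>t. exp (t * ?w) - exp (t * ?s)) has_real_derivative (?w - ?s)) (at 0)"
    by (auto intro!: derivative_eq_intros)
  have "(\<lambda>t. (exp (t * ?w) - exp (t * ?s)) / t) \<midarrow>0\<rightarrow> ?w - ?s"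
    using der unfolding has_field_derivative_iff by simp
  moreover have "filterlim step (at 0) sequentially"
    by (rule filterlim_atI[OF step(3)]) (simp add: step_def)
  ultimately have q: "(\<lambda>i. (exp (step i * ?w) - exp (step i * ?s)) / step i) \<longlonglongrightarrow> ?w - ?s"
    by (rule filterlim_compose)
  have "(\<lambda>i. lik x \<theta> * exp (- (step i)\<^sup>2 / 2) *
     ((exp (step i * ?w) - exp (step i * ?s)) / step i * (?w - ?s)) / evid (x + step i *\<^sub>R dir j))
    \<longlonglongrightarrow> lik x \<theta> * exp (- 0\<^sup>2 / 2) * ((?w - ?s) * (?w - ?s)) / evid x"
    by (intro tendsto_intros q step evid_shift_tendsto) (use evid_pos[of x] in auto)
  then show ?thesis unfolding tilt_def by (simp add: power2_eq_square)
qed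

text \<open>Fatou's lemma, so that no differentiation under the integral sign is needed. The constant \<open>p\<close> will be
  the density of the observation at \<open>x\<close>.\<close>

lemma coord_var_le_liminf:
  assumes p: "p \<ge> 0"
  shows "ennreal p * coord_var j x \<le> liminf (\<lambda>i. ennreal (p * mean_slope j (step i) x))"
proof -
  have "ennreal p * coord_var j x = (\<integral>\<^sup>+\<theta>. ennreal p * ennreal (lik x \<theta> / evid x * (resid j x \<theta> - score j x)\<^sup>2) \<partial>prior)"
    unfolding coord_var_def by (rule nn_integral_cmult[symmetric]) measurable
  also have "\<dots> = (\<integral>\<^sup>+\<theta>. liminf (\<lambda>i. ennreal (p * tilt j (step i) x \<theta>)) \<partial>prior)"
  proof (rule nn_integral_cong)
    fix \<theta>
    have "(\<lambda>i. ennreal (p * tilt j (step i) x \<theta>)) \<longlonglongrightarrow> ennreal (p * (lik x \<theta> / evid x * (resid j x \<theta> - score j x)\<^sup>2))"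
      by (intro tendsto_ennrealI tendsto_intros tilt_tendsto)
    then have "liminf (\<lambda>i. ennreal (p * tilt j (step i) x \<theta>)) = ennreal (p * (lik x \<theta> / evid x * (resid j x \<theta> - score j x)\<^sup>2))"
      by (rule lim_imp_Liminf[rotated]) simp
    then show "ennreal p * ennreal (lik x \<theta> / evid x * (resid j x \<theta> - score j x)\<^sup>2) = liminf (\<lambda>i. ennreal (p * tilt j (step i) x \<theta>))"
      by (simp only: ennreal_mult'[OF p])
  qed
  also have "\<dots> \<le> liminf (\<lambda>i. \<integral>\<^sup>+\<theta>. ennreal (p * tilt j (step i) x \<theta>) \<partial>prior)"
    by (rule nn_integral_liminf) measurable
  also have "(\<lambda>i. \<integral>\<^sup>+\<theta>. ennreal (p * tilt j (step i) x \<theta>) \<partial>prior) = (\<lambda>i. ennreal (p * mean_slope j (step i) x))"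
  proof
    fix i
    have "(\<integral>\<^sup>+\<theta>. ennreal (p * tilt j (step i) x \<theta>) \<partial>prior) = ennreal p * (\<integral>\<^sup>+\<theta>. ennreal (tilt j (step i) x \<theta>) \<partial>prior)"
      using p by (subst nn_integral_cmult[symmetric]) (auto simp: ennreal_mult')
    then show "(\<integral>\<^sup>+\<theta>. ennreal (p * tilt j (step i) x \<theta>) \<partial>prior) = ennreal (p * mean_slope j (step i) x)"
      using p by (simp add: nn_integral_tilt[OF step(1)] ennreal_mult')
  qed
  finally show ?thesis .
qed

end

lemma ennreal_mult_sum:
  assumes P: "P \<ge> 0" and a: "\<And>j. j \<in> A \<Longrightarrow> a j \<ge> 0"
  shows "ennreal P * ennreal (\<Sum>j\<in>A. a j) = (\<Sum>j\<in>A. ennreal (P * a j))"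
proof -
  have "ennreal P * ennreal (\<Sum>j\<in>A. a j) = ennreal (\<Sum>j\<in>A. P * a j)"
    by (simp only: ennreal_mult'[OF P, symmetric] sum_distrib_left)
  also have "\<dots> = (\<Sum>j\<in>A. ennreal (P * a j))" using P a by (subst sum_ennreal) auto
  finally show ?thesis .
qed

lemma norm_sq_eq_sum: "(norm (y :: real^'n))\<^sup>2 = (\<Sum>j\<in>UNIV. (y $ j)\<^sup>2)"
  unfolding power2_norm_eq_inner inner_vec_def by (simp add: power2_eq_square)

context eig_model
begin

definition shift_const :: real where "shift_const = 4 + 8 * sqrt (2 ^ CARD('k))"

text \<open>The exponents differ by at most \<open>t (2 + m)\<close>, where \<open>m\<close> is the squared distance at either of the two
  points; pairing each exponential with the bound at its own point keeps the right-hand side integrable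
  uniformly in \<open>t\<close>.\<close>

lemma lik_shift_diff:
  assumes t: "0 < t" "t \<le> 1"
  shows "\<bar>lik (x - t *\<^sub>R dir j) \<mu> - lik x \<mu>\<bar> \<le> t *
    (lik (x - t *\<^sub>R dir j) \<mu> * (2 + msq (x - t *\<^sub>R dir j - \<mu>)) + lik x \<mu> * (2 + msq (x - \<mu>)))"
proof -
  let ?y = "x - t *\<^sub>R dir j"
  define m n where "m = msq (?y - \<mu>)" and "n = msq (x - \<mu>)"
  let ?a = "- m / 2" and ?b = "- n / 2"
  define w where "w = resid j x \<mu>"
  have w': "resid j ?y \<mu> = w + t" using resid_shift[of j x "- t" \<mu>] by (simp add: w_def)
  have "exp ?a = exp (?b + (- t * w - t\<^sup>2 / 2))"
    using lik_shift[of x "- t" j \<mu>] unfolding lik_def exp_add by (simp add: m_def n_def w_def exp_add)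
  then have ab: "?a - ?b = - t * w - t\<^sup>2 / 2" by simp
  have sq: "\<bar>y\<bar> \<le> (1 + y\<^sup>2) / 2" for y :: real
    using zero_le_power2[of "\<bar>y\<bar> - 1"] by (simp add: power2_diff)
  have tt: "t\<^sup>2 \<le> t" using t by (simp add: power2_eq_square mult_left_le)
  have abs: "\<bar>?a - ?b\<bar> \<le> t * \<bar>w\<bar> + t\<^sup>2 / 2" unfolding ab using t by (auto simp: abs_if mult_less_0_iff)
  have 1: "\<bar>?a - ?b\<bar> \<le> t * (2 + n)"
  proof -
    have "\<bar>w\<bar> \<le> (1 + n) / 2" using sq[of w] resid_sq_le[of j x \<mu>] by (simp add: w_def n_def)
    then have "t * \<bar>w\<bar> \<le> t * ((1 + n) / 2)" using t by (intro mult_left_mono) auto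
    then have "\<bar>?a - ?b\<bar> \<le> t * ((1 + n) / 2) + t / 2" using abs tt by linarith
    also have "\<dots> = t * ((2 + n) / 2)" by (simp add: algebra_simps)
    also have "\<dots> \<le> t * (2 + n)" using t by (intro mult_left_mono) (auto simp: n_def)
    finally show ?thesis .
  qed
  have 2: "\<bar>?a - ?b\<bar> \<le> t * (2 + m)"
  proof -
    have "\<bar>w + t\<bar> \<le> (1 + m) / 2" using sq[of "w + t"] resid_sq_le[of j ?y \<mu>] by (simp add: w' m_def)
    then have "\<bar>w\<bar> \<le> (1 + m) / 2 + 1" using t by linarith
    then have "t * \<bar>w\<bar> \<le> t * ((1 + m) / 2 + 1)" using t by (intro mult_left_mono) auto
    then have "\<bar>?a - ?b\<bar> \<le> t * ((1 + m) / 2 + 1) + t / 2" using abs tt by linarith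
    also have "\<dots> = t * ((4 + m) / 2)" by (simp add: algebra_simps)
    also have "\<dots> \<le> t * (2 + m)" using t by (intro mult_left_mono) (auto simp: m_def)
    finally show ?thesis .
  qed
  have "\<bar>exp ?a - exp ?b\<bar> \<le> \<bar>?a - ?b\<bar> * exp ?a + \<bar>?a - ?b\<bar> * exp ?b"
    using abs_exp_diff_le[of ?a ?b] by (simp add: distrib_left)
  also have "\<dots> \<le> (t * (2 + m)) * exp ?a + (t * (2 + n)) * exp ?b"
    using 1 2 by (intro add_mono mult_right_mono) auto
  finally show ?thesis unfolding lik_def m_def[symmetric] n_def[symmetric] by (simp add: algebra_simps)
qed

lemma integrable_lik_lborel:
  "integrable lborel (\<lambda>x. dens x \<mu>)" "(\<integral>x. dens x \<mu> \<partial>lborel) = 1"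
proof -
  note nn = dens_nonneg[of _ \<mu>]
  have i: "(\<integral>\<^sup>+x. ennreal (dens x \<mu>) \<partial>lborel) = 1"
    using nn_integral_lik_exp[of 0 \<mu>] by simp
  have "has_bochner_integral lborel (\<lambda>x. dens x \<mu>) 1"
    by (rule has_bochner_integral_nn_integral) (use nn i in auto)
  then show "integrable lborel (\<lambda>x. dens x \<mu>)" "(\<integral>x. dens x \<mu> \<partial>lborel) = 1"
    by (auto simp: has_bochner_integral_iff)
qed

lemma integrable_lik_sq_lborel:
  "integrable lborel (\<lambda>x. dens x \<mu> * msq (x - \<mu>))"
  "(\<integral>x. dens x \<mu> * msq (x - \<mu>) \<partial>lborel) \<le> 4 * sqrt (2 ^ CARD('k))"
proof -
  have nn: "dens x \<mu> * msq (x - \<mu>) \<ge> 0" for x using lik_bounds(1)[of x \<mu>] gauss_const_pos by (simp add: less_imp_le)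
  show i: "integrable lborel (\<lambda>x. dens x \<mu> * msq (x - \<mu>))"
  proof (rule integrableI_nonneg)
    show "(\<integral>\<^sup>+x. ennreal (dens x \<mu> * msq (x - \<mu>)) \<partial>lborel) < \<infinity>"
      using nn_integral_lik_sq[of \<mu>] by (rule order_le_less_trans) simp
  qed (use nn in auto)
  show "(\<integral>x. dens x \<mu> * msq (x - \<mu>) \<partial>lborel) \<le> 4 * sqrt (2 ^ CARD('k))"
    using nn_integral_lik_sq[of \<mu>] nn by (subst (asm) nn_integral_eq_integral[OF i]) auto
qed

text \<open>Gaussian integration by parts in discrete form: the shift is moved from the score, which is bounded, to
  the density of the observation, which is Lipschitz in mean under shifts.\<close>

lemma mean_slope_risk:
  assumes t: "0 < t" "t \<le> 1"
  shows "(\<integral>\<^sup>+x. ennreal (dens x \<mu> * mean_slope j t x) \<partial>lborel) \<le> ennreal (1 + sqrt resid_bound * shift_const)"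
proof -
  define p where "p = (\<lambda>x. dens x \<mu>)"
  define q where "q = (\<lambda>x. p x * (2 + msq (x - \<mu>)))"
  define r where "r = sqrt resid_bound"
  let ?v = "t *\<^sub>R dir j"
  have [measurable]: "p \<in> borel_measurable borel" "q \<in> borel_measurable borel" unfolding p_def q_def by measurable
  have r: "r \<ge> 0" using resid_bound_ge by (simp add: r_def)
  have p: "p x \<ge> 0" for x using lik_bounds(1)[of x \<mu>] gauss_const_pos by (simp add: p_def less_imp_le)
  have ip: "integrable lborel p" "(\<integral>x. p x \<partial>lborel) = 1" using integrable_lik_lborel by (auto simp: p_def)
  have q_eq: "q = (\<lambda>x. 2 * p x + p x * msq (x - \<mu>))" by (auto simp: q_def algebra_simps)
  have sq: "integrable lborel (\<lambda>x. p x * msq (x - \<mu>))"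
    "(\<integral>x. p x * msq (x - \<mu>) \<partial>lborel) \<le> 4 * sqrt (2 ^ CARD('k))"
    unfolding p_def by (rule integrable_lik_sq_lborel)+
  have iq: "integrable lborel q" unfolding q_eq using ip sq(1) by auto
  have iq2: "(\<integral>x. q x \<partial>lborel) \<le> 2 + 4 * sqrt (2 ^ CARD('k))"
    unfolding q_eq using ip sq by simp
  have bdd: "integrable lborel (\<lambda>x. f x * score j (g x))" if "integrable lborel f" "g \<in> borel_measurable borel" for f and g :: "real^'k \<Rightarrow> real^'k"
  proof (rule Bochner_Integration.integrable_bound[of _ "\<lambda>x. r * f x"])
    show "integrable lborel (\<lambda>x. r * f x)" using that by simp
    show "(\<lambda>x. f x * score j (g x)) \<in> borel_measurable lborel" using that by measurable
    show "AE x in lborel. norm (f x * score j (g x)) \<le> norm (r * f x)"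
    proof (rule AE_I2)
      fix x
      have "\<bar>f x\<bar> * \<bar>score j (g x)\<bar> \<le> \<bar>f x\<bar> * r" using abs_score_le[of j "g x"] by (intro mult_left_mono) (auto simp: r_def)
      then show "norm (f x * score j (g x)) \<le> norm (r * f x)" using r by (simp add: abs_mult mult.commute)
    qed
  qed
  have ipm: "integrable lborel (\<lambda>x. p (x - ?v))" using integrable_translate[OF ip(1), of "- ?v"] by simp
  have iqm: "integrable lborel (\<lambda>x. q (x - ?v))" using integrable_translate[OF iq(1), of "- ?v"] by simp
  have i1: "integrable lborel (\<lambda>x. p x * score j (x + ?v))" by (rule bdd[OF ip(1)]) measurable
  have i2: "integrable lborel (\<lambda>x. p x * score j x)" by (rule bdd[OF ip(1)]) measurable
  have i3: "integrable lborel (\<lambda>x. p (x - ?v) * score j x)" by (rule bdd[OF ipm]) measurable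
  have eq: "p x * mean_slope j t x = (1 / t) * (p x * score j (x + ?v) - p x * score j x) + p x" for x
    unfolding mean_slope_def using t by (simp add: field_simps)
  have islope: "integrable lborel (\<lambda>x. p x * mean_slope j t x)" unfolding eq using i1 i2 ip(1) by auto
  have "(\<integral>x. p x * mean_slope j t x \<partial>lborel) = (1 / t) * ((\<integral>x. p x * score j (x + ?v) \<partial>lborel) - (\<integral>x. p x * score j x \<partial>lborel)) + 1"
    unfolding eq using i1 i2 ip by simp
  also have "(\<integral>x. p x * score j (x + ?v) \<partial>lborel) = (\<integral>x. p (x - ?v) * score j x \<partial>lborel)"
    using integral_translate[of "\<lambda>x. p (x - ?v) * score j x" ?v] by simp
  also have "\<dots> - (\<integral>x. p x * score j x \<partial>lborel) = (\<integral>x. p (x - ?v) * score j x - p x * score j x \<partial>lborel)"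
    using i2 i3 by simp
  also have "\<dots> \<le> (\<integral>x. r * t * (q (x - ?v) + q x) \<partial>lborel)"
  proof (rule integral_mono)
    fix x
    have "\<bar>p (x - ?v) - p x\<bar> = \<bar>lik (x - ?v) \<mu> - lik x \<mu>\<bar> / gauss_const"
      using gauss_const_pos by (simp add: p_def diff_divide_distrib[symmetric])
    also have "\<dots> \<le> (t * (lik (x - ?v) \<mu> * (2 + msq (x - ?v - \<mu>)) + lik x \<mu> * (2 + msq (x - \<mu>)))) / gauss_const"
      using lik_shift_diff[OF t, of x j \<mu>] gauss_const_pos by (intro divide_right_mono) auto
    also have "\<dots> = t * (q (x - ?v) + q x)" by (simp add: q_def p_def add_divide_distrib distrib_left)
    finally have d: "\<bar>p (x - ?v) - p x\<bar> \<le> t * (q (x - ?v) + q x)" .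
    have "p (x - ?v) * score j x - p x * score j x \<le> \<bar>p (x - ?v) - p x\<bar> * \<bar>score j x\<bar>"
      unfolding abs_mult[symmetric] by (simp add: algebra_simps)
    also have "\<dots> \<le> (t * (q (x - ?v) + q x)) * r"
      using d abs_score_le[of j x] by (intro mult_mono) (auto simp: r_def)
    finally show "p (x - ?v) * score j x - p x * score j x \<le> r * t * (q (x - ?v) + q x)" by (simp add: mult_ac)
  qed (use i2 i3 iq iqm in auto)
  also have "\<dots> = r * t * ((\<integral>x. q (x - ?v) \<partial>lborel) + (\<integral>x. q x \<partial>lborel))"
    using iq iqm by simp
  also have "(\<integral>x. q (x - ?v) \<partial>lborel) = (\<integral>x. q x \<partial>lborel)"
    using integral_translate[of q "- ?v"] by simp
  finally have "(\<integral>x. p x * mean_slope j t x \<partial>lborel) \<le> (1 / t) * (r * t * ((\<integral>x. q x \<partial>lborel) + (\<integral>x. q x \<partial>lborel))) + 1"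
    using t by (simp add: divide_right_mono mult_left_mono)
  also have "\<dots> = 1 + r * (2 * (\<integral>x. q x \<partial>lborel))" using t by simp
  also have "\<dots> \<le> 1 + r * shift_const" using iq2 r by (intro add_left_mono mult_left_mono) (auto simp: shift_const_def)
  finally have le: "(\<integral>x. p x * mean_slope j t x \<partial>lborel) \<le> 1 + r * shift_const" .
  have "(\<integral>\<^sup>+x. ennreal (p x * mean_slope j t x) \<partial>lborel) = ennreal (\<integral>x. p x * mean_slope j t x \<partial>lborel)"
    using p mean_slope_nonneg[OF t(1)] by (intro nn_integral_eq_integral[OF islope]) auto
  also have "\<dots> \<le> ennreal (1 + r * shift_const)" using le by (rule ennreal_leI)
  finally show ?thesis unfolding p_def r_def .
qed

lemma borel_measurable_mean_slope [measurable]: "mean_slope j t \<in> borel_measurable borel"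
  unfolding mean_slope_def[abs_def] by measurable

lemma coord_var_risk:
  "(\<integral>\<^sup>+x. coord_var j x \<partial>mvn \<mu> S) \<le> ennreal (1 + sqrt resid_bound * shift_const)"
proof -
  note p = dens_nonneg[of _ \<mu>]
  have "(\<integral>\<^sup>+x. coord_var j x \<partial>mvn \<mu> S) = (\<integral>\<^sup>+x. ennreal (dens x \<mu>) * coord_var j x \<partial>lborel)"
    by (rule nn_integral_mvn) measurable
  also have "\<dots> \<le> (\<integral>\<^sup>+x. liminf (\<lambda>i. ennreal (dens x \<mu> * mean_slope j (step i) x)) \<partial>lborel)"
    by (intro nn_integral_mono coord_var_le_liminf p)
  also have "\<dots> \<le> liminf (\<lambda>i. \<integral>\<^sup>+x. ennreal (dens x \<mu> * mean_slope j (step i) x) \<partial>lborel)"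
    by (rule nn_integral_liminf) measurable
  also have "\<dots> \<le> liminf (\<lambda>i. ennreal (1 + sqrt resid_bound * shift_const))"
    by (intro Liminf_mono always_eventually allI mean_slope_risk step)
  also have "\<dots> = ennreal (1 + sqrt resid_bound * shift_const)" by (simp add: Liminf_const)
  finally show ?thesis .
qed

text \<open>The posterior mean minimises the posterior quadratic error.\<close>

lemma coord_var_le:
  "coord_var j x \<le> (\<integral>\<^sup>+\<theta>. ennreal (lik x \<theta> / evid x * (resid j x \<theta> - a)\<^sup>2) \<partial>prior)"
proof -
  let ?s = "score j x"
  note pos = post_dens_nonneg[of x]
  have i2: "integrable prior (\<lambda>\<theta>. lik x \<theta> * (resid j x \<theta>)\<^sup>2)"
    by (rule prior.integrable_const_bound[where B=2])
       (use lik_resid_sq lik_bounds(1) in \<open>auto simp: less_imp_le\<close>)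
  have eq: "lik x \<theta> / evid x * (resid j x \<theta> - b)\<^sup>2
     = 1 / evid x * (lik x \<theta> * (resid j x \<theta>)\<^sup>2 - 2 * b * (lik x \<theta> * resid j x \<theta>) + b\<^sup>2 * lik x \<theta>)" for \<theta> b
    by (simp add: power2_diff algebra_simps add_divide_distrib diff_divide_distrib)
  have int: "integrable prior (\<lambda>\<theta>. lik x \<theta> / evid x * (resid j x \<theta> - b)\<^sup>2)" for b
    unfolding eq using i2 integrable_lik integrable_lik_resid by (intro integrable_mult_right Bochner_Integration.integrable_add Bochner_Integration.integrable_diff)
  have val: "(\<integral>\<theta>. lik x \<theta> / evid x * (resid j x \<theta> - b)\<^sup>2 \<partial>prior)
     = (\<integral>\<theta>. lik x \<theta> * (resid j x \<theta>)\<^sup>2 \<partial>prior) / evid x - 2 * b * ?s + b\<^sup>2" for b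
    unfolding eq using i2 integrable_lik integrable_lik_resid evid_pos[of x]
    by (simp add: integral_lik_resid evid_def[symmetric] field_simps)
  have "0 \<le> (a - ?s)\<^sup>2" by simp
  then have "- 2 * ?s * ?s + ?s\<^sup>2 \<le> - 2 * a * ?s + a\<^sup>2" by (simp add: power2_diff power2_eq_square algebra_simps)
  then have "(\<integral>\<theta>. lik x \<theta> / evid x * (resid j x \<theta> - ?s)\<^sup>2 \<partial>prior) \<le> (\<integral>\<theta>. lik x \<theta> / evid x * (resid j x \<theta> - a)\<^sup>2 \<partial>prior)"
    unfolding val by linarith
  moreover have nn: "0 \<le> lik x \<theta> / evid x * (resid j x \<theta> - b)\<^sup>2" for \<theta> b by (intro mult_nonneg_nonneg pos) simp
  have "(\<integral>\<^sup>+\<theta>. ennreal (lik x \<theta> / evid x * (resid j x \<theta> - b)\<^sup>2) \<partial>prior)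
     = ennreal (\<integral>\<theta>. lik x \<theta> / evid x * (resid j x \<theta> - b)\<^sup>2 \<partial>prior)" for b
    by (rule nn_integral_eq_integral[OF int AE_I2]) (rule nn)
  ultimately show ?thesis unfolding coord_var_def by (simp only: ennreal_leI)
qed

lemma integrable_post: "integrable (post x) (\<lambda>\<theta>. \<theta>)"
proof -
  interpret p: prob_space "post x" by (rule prob_space_post)
  have "linear ((*v) (matrix_inv W))" by simp
  then obtain K where K: "K > 0" "\<And>y. norm (matrix_inv W *v y) \<le> K * norm y"
    using linear_bounded_pos by (metis mult.commute)
  have le: "norm \<theta> \<le> K * (norm (W *v x) + 1 + msq (x - \<theta>))" for \<theta>
  proof -
    have "norm \<theta> = norm (matrix_inv W *v (W *v \<theta>))"
      using invertible_W by (simp add: matrix_vector_mul_assoc matrix_inv_props)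
    also have "\<dots> \<le> K * norm (W *v \<theta>)" by (rule K)
    also have "norm (W *v \<theta>) \<le> norm (W *v x) + norm (W *v (x - \<theta>))"
      using norm_triangle_ineq4[of "W *v x" "W *v (x - \<theta>)"] by (simp add: matrix_vector_mult_diff_distrib)
    also have "norm (W *v (x - \<theta>)) \<le> 1 + msq (x - \<theta>)"
      using zero_le_power2[of "norm (W *v (x - \<theta>)) - 1"] zero_le_power2[of "norm (W *v (x - \<theta>))"]
      unfolding power2_diff by (smt (verit, best) norm_ge_zero one_power2)
    finally show ?thesis using K(1) by (simp add: add.assoc mult_left_mono)
  qed
  have i: "integrable (post x) (\<lambda>\<theta>. msq (x - \<theta>))"
    by (rule integrableI_bounded) (use post_residual[of x] in \<open>auto simp: less_top[symmetric] top_unique\<close>)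
  show ?thesis
  proof (rule Bochner_Integration.integrable_bound)
    show "integrable (post x) (\<lambda>\<theta>. K * (norm (W *v x) + 1 + msq (x - \<theta>)))" using i by simp
    show "AE \<theta> in post x. norm \<theta> \<le> norm (K * (norm (W *v x) + 1 + msq (x - \<theta>)))"
      using le by (intro AE_I2) (metis abs_ge_self order_trans real_norm_def)
  qed measurable
qed

lemma W_estimator: "(W *v eig_estimator d c S x) $ j = score j x + (W *v x) $ j"
proof -
  interpret p: prob_space "post x" by (rule prob_space_post)
  have bl: "bounded_linear (\<lambda>\<theta>. (W *v \<theta>) $ j)"
    by (intro bounded_linear_compose[OF bounded_linear_vec_nth] matrix_vector_mul_bounded_linear)
  have int: "integrable (post x) (\<lambda>\<theta>. (W *v \<theta>) $ j)" by (rule integrable_bounded_linear[OF bl integrable_post])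
  have "(W *v eig_estimator d c S x) $ j = (\<integral>\<theta>. (W *v \<theta>) $ j \<partial>post x)"
    unfolding eig_estimator_def post_def[symmetric] by (rule integral_bounded_linear[OF bl integrable_post, symmetric])
  also have "\<dots> = (\<integral>\<theta>. resid j x \<theta> + (W *v x) $ j \<partial>post x)"
    by (simp add: resid_def matrix_vector_mult_diff_distrib)
  also have "\<dots> = (\<integral>\<theta>. resid j x \<theta> \<partial>post x) + (W *v x) $ j"
  proof -
    have "integrable (post x) (\<lambda>\<theta>. resid j x \<theta>)"
      using int by (simp add: resid_def matrix_vector_mult_diff_distrib)
    then show ?thesis by (simp add: p.prob_space)
  qed
  also have "(\<integral>\<theta>. resid j x \<theta> \<partial>post x) = (\<integral>\<theta>. lik x \<theta> / evid x * resid j x \<theta> \<partial>prior)"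
    unfolding post_eq using evid_pos[of x] lik_bounds(1)[of x] by (subst integral_density) (auto simp: less_imp_le)
  also have "\<dots> = score j x" unfolding score_def by simp
  finally show ?thesis .
qed

definition post_var :: "real^'k \<Rightarrow> ennreal" where
  "post_var x = (\<integral>\<^sup>+\<theta>. ennreal (msq (\<theta> - eig_estimator d c S x)) \<partial>post x)"

lemma post_var_eq: "post_var x = (\<Sum>j\<in>UNIV. coord_var j x)"
proof -
  note pos = post_dens_nonneg[of x]
  have "post_var x = (\<integral>\<^sup>+\<theta>. ennreal (lik x \<theta> / evid x) * ennreal (msq (\<theta> - eig_estimator d c S x)) \<partial>prior)"
    unfolding post_var_def by (rule nn_integral_post) measurable
  also have "\<dots> = (\<integral>\<^sup>+\<theta>. (\<Sum>j\<in>UNIV. ennreal (lik x \<theta> / evid x * (resid j x \<theta> - score j x)\<^sup>2)) \<partial>prior)"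
  proof (rule nn_integral_cong)
    fix \<theta>
    have "(W *v (\<theta> - eig_estimator d c S x)) $ j = resid j x \<theta> - score j x" for j
      by (simp add: matrix_vector_mult_diff_distrib W_estimator resid_def)
    then show "ennreal (lik x \<theta> / evid x) * ennreal (msq (\<theta> - eig_estimator d c S x))
       = (\<Sum>j\<in>UNIV. ennreal (lik x \<theta> / evid x * (resid j x \<theta> - score j x)\<^sup>2))"
      unfolding norm_sq_eq_sum by (simp only:) (rule ennreal_mult_sum[OF pos], simp)
  qed
  also have "\<dots> = (\<Sum>j\<in>UNIV. coord_var j x)"
    unfolding coord_var_def by (rule nn_integral_sum) measurable
  finally show ?thesis .
qed

lemma borel_measurable_post_var [measurable]: "post_var \<in> borel_measurable borel"
  unfolding post_var_eq[abs_def] by measurable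

lemma post_var_le_post_sq: "post_var x \<le> post_sq x"
proof -
  note pos = post_dens_nonneg[of x]
  have "post_var x \<le> (\<Sum>j\<in>UNIV. \<integral>\<^sup>+\<theta>. ennreal (lik x \<theta> / evid x * (resid j x \<theta> - - (W *v x) $ j)\<^sup>2) \<partial>prior)"
    unfolding post_var_eq by (intro sum_mono coord_var_le)
  also have "\<dots> = (\<integral>\<^sup>+\<theta>. (\<Sum>j\<in>UNIV. ennreal (lik x \<theta> / evid x * (resid j x \<theta> - - (W *v x) $ j)\<^sup>2)) \<partial>prior)"
    by (rule nn_integral_sum[symmetric]) measurable
  also have "\<dots> = post_sq x" unfolding post_sq_eq
  proof (rule nn_integral_cong)
    fix \<theta>
    have "resid j x \<theta> - - (W *v x) $ j = (W *v \<theta>) $ j" for j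
      by (simp add: matrix_vector_mult_diff_distrib resid_def)
    then show "(\<Sum>j\<in>UNIV. ennreal (lik x \<theta> / evid x * (resid j x \<theta> - - (W *v x) $ j)\<^sup>2))
       = ennreal (lik x \<theta> / evid x) * ennreal (msq \<theta>)"
      unfolding norm_sq_eq_sum by (simp only:) (rule ennreal_mult_sum[OF pos, symmetric], simp)
  qed
  finally show ?thesis .
qed

text \<open>The variance itself can be of order \<open>ln (1 / c)\<close> for observations near the detection threshold. On
  average it is only of the order of the square root.\<close>

lemma post_var_risk:
  "(\<integral>\<^sup>+x. post_var x \<partial>mvn \<mu> S) \<le> ennreal (real CARD('k) * (1 + sqrt resid_bound * shift_const))"
proof -
  have "(\<integral>\<^sup>+x. post_var x \<partial>mvn \<mu> S) = (\<Sum>j\<in>UNIV. \<integral>\<^sup>+x. coord_var j x \<partial>mvn \<mu> S)"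
    unfolding post_var_eq by (rule nn_integral_sum) measurable
  also have "\<dots> \<le> (\<Sum>j\<in>(UNIV :: 'k set). ennreal (1 + sqrt resid_bound * shift_const))"
    by (intro sum_mono coord_var_risk)
  also have "\<dots> = ennreal (real CARD('k) * (1 + sqrt resid_bound * shift_const))"
    by (simp add: ennreal_mult' ennreal_of_nat_eq_real_of_nat)
  finally show ?thesis .
qed

definition post_err :: "real^'k \<Rightarrow> real^'k \<Rightarrow> ennreal" where
  "post_err \<mu> x = (\<integral>\<^sup>+\<theta>. ennreal (msq (\<theta> - \<mu>)) \<partial>post x)"

lemma borel_measurable_post_err [measurable]: "post_err \<mu> \<in> borel_measurable borel"
proof -
  have "post_err \<mu> x = (\<integral>\<^sup>+\<theta>. ennreal (lik x \<theta> / evid x) * ennreal (msq (\<theta> - \<mu>)) \<partial>prior)" for x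
    unfolding post_err_def by (rule nn_integral_post) measurable
  then have "post_err \<mu> = (\<lambda>x. \<integral>\<^sup>+\<theta>. ennreal (lik x \<theta> / evid x) * ennreal (msq (\<theta> - \<mu>)) \<partial>prior)"
    by (rule ext)
  then show ?thesis by (simp only:) (rule prior.borel_measurable_nn_integral, measurable)
qed

lemma post_err_zero: "post_err 0 = post_sq"
  unfolding post_err_def[abs_def] post_sq_def[abs_def] by simp

text \<open>The triangle inequality through the observation.\<close>

lemma post_err_risk:
  "(\<integral>\<^sup>+x. post_err \<mu> x \<partial>mvn \<mu> S) \<le> ennreal (2 * resid_bound + 8 * sqrt (2 ^ CARD('k)))"
proof -
  interpret m: prob_space "mvn \<mu> S" by (rule prob_space_mvn)
  have le: "post_err \<mu> x \<le> ennreal (2 * resid_bound) + 2 * ennreal (msq (x - \<mu>))" for x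
  proof -
    interpret p: prob_space "post x" by (rule prob_space_post)
    have "post_err \<mu> x \<le> (\<integral>\<^sup>+\<theta>. 2 * ennreal (msq (x - \<theta>)) + 2 * ennreal (msq (x - \<mu>)) \<partial>post x)"
      unfolding post_err_def
    proof (rule nn_integral_mono)
      fix \<theta>
      have "msq (\<theta> - \<mu>) \<le> 2 * msq (x - \<theta>) + 2 * msq (x - \<mu>)"
        using norm_sq_sum_le[of "- (W *v (x - \<theta>))" "W *v (x - \<mu>)"] by (simp add: matrix_vector_mult_diff_distrib norm_minus_commute)
      then have "ennreal (msq (\<theta> - \<mu>)) \<le> ennreal (2 * msq (x - \<theta>) + 2 * msq (x - \<mu>))"
        by (rule ennreal_leI)
      then show "ennreal (msq (\<theta> - \<mu>)) \<le> 2 * ennreal (msq (x - \<theta>)) + 2 * ennreal (msq (x - \<mu>))"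
        by (simp add: ennreal_plus ennreal_mult')
    qed
    also have "\<dots> = 2 * (\<integral>\<^sup>+\<theta>. ennreal (msq (x - \<theta>)) \<partial>post x) + 2 * ennreal (msq (x - \<mu>))"
      by (subst nn_integral_add, measurable, subst nn_integral_cmult, measurable) (simp add: p.emeasure_space_1)
    also have "\<dots> \<le> 2 * ennreal resid_bound + 2 * ennreal (msq (x - \<mu>))"
      by (intro add_right_mono mult_left_mono post_residual) auto
    finally show ?thesis by (simp add: ennreal_mult')
  qed
  have "(\<integral>\<^sup>+x. post_err \<mu> x \<partial>mvn \<mu> S) \<le> (\<integral>\<^sup>+x. ennreal (2 * resid_bound) + 2 * ennreal (msq (x - \<mu>)) \<partial>mvn \<mu> S)"
    by (rule nn_integral_mono[OF le])
  also have "\<dots> = ennreal (2 * resid_bound) + 2 * (\<integral>\<^sup>+x. ennreal (msq (x - \<mu>)) \<partial>mvn \<mu> S)"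
    by (subst nn_integral_add, measurable, subst nn_integral_cmult, measurable) (simp add: m.emeasure_space_1)
  also have "(\<integral>\<^sup>+x. ennreal (msq (x - \<mu>)) \<partial>mvn \<mu> S) \<le> ennreal (4 * sqrt (2 ^ CARD('k)))"
    using nn_integral_lik_sq[of \<mu>] by (subst nn_integral_mvn) (auto simp: ennreal_mult''[symmetric])
  also have "ennreal (2 * resid_bound) + 2 * ennreal (4 * sqrt (2 ^ CARD('k))) = ennreal (2 * resid_bound + 8 * sqrt (2 ^ CARD('k)))"
  proof -
    have "2 * ennreal (4 * sqrt (2 ^ CARD('k))) = ennreal (8 * sqrt (2 ^ CARD('k)))"
      by (subst ennreal_numeral[symmetric], subst ennreal_mult'[symmetric]) auto
    then show ?thesis using resid_bound_ge by (simp only:) (subst ennreal_plus, auto)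
  qed
  finally show ?thesis by (simp add: mult_left_mono)
qed

end

section \<open>Independent coordinates and the limit\<close>

context whitened
begin

lemma nn_integral_data_law:
  assumes e: "\<And>i. i \<in> {1..n} \<Longrightarrow> e i \<in> borel_measurable borel"
  shows "(\<integral>\<^sup>+X. (\<Sum>i=1..n. e i (X i)) \<partial>data_law S n \<theta>\<^sub>0) = (\<Sum>i=1..n. \<integral>\<^sup>+x. e i x \<partial>mvn (\<theta>\<^sub>0 i) S)"
proof -
  have sets: "sets (mvn (\<theta>\<^sub>0 i) S) = sets borel" for i unfolding mvn_def by simp
  have comp: "(\<lambda>X. X i) \<in> measurable (data_law S n \<theta>\<^sub>0) (mvn (\<theta>\<^sub>0 i) S)" if "i \<in> {1..n}" for i
    unfolding data_law_def by (rule measurable_component_singleton[OF that])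
  have e': "e i \<in> borel_measurable (mvn (\<theta>\<^sub>0 i) S)" if "i \<in> {1..n}" for i
    using e[OF that] by (simp add: measurable_cong_sets[OF sets_mvn refl])
  have "(\<integral>\<^sup>+X. e i (X i) \<partial>data_law S n \<theta>\<^sub>0) = (\<integral>\<^sup>+x. e i x \<partial>mvn (\<theta>\<^sub>0 i) S)" if i: "i \<in> {1..n}" for i
  proof -
    have "(\<integral>\<^sup>+x. e i x \<partial>distr (data_law S n \<theta>\<^sub>0) (mvn (\<theta>\<^sub>0 i) S) (\<lambda>X. X i)) = (\<integral>\<^sup>+X. e i (X i) \<partial>data_law S n \<theta>\<^sub>0)"
      by (rule nn_integral_distr[OF comp[OF i]]) (use e'[OF i] in simp)
    moreover have "distr (data_law S n \<theta>\<^sub>0) (mvn (\<theta>\<^sub>0 i) S) (\<lambda>X. X i) = mvn (\<theta>\<^sub>0 i) S"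
      unfolding data_law_def by (rule distr_PiM_component[where M="\<lambda>i. mvn (\<theta>\<^sub>0 i) S", OF prob_space_mvn i])
    ultimately show ?thesis by simp
  qed
  moreover have "(\<integral>\<^sup>+X. (\<Sum>i=1..n. e i (X i)) \<partial>data_law S n \<theta>\<^sub>0) = (\<Sum>i=1..n. \<integral>\<^sup>+X. e i (X i) \<partial>data_law S n \<theta>\<^sub>0)"
    by (rule nn_integral_sum) (rule measurable_compose[OF comp e'])
  ultimately show ?thesis by simp
qed

end

text \<open>One constant, independent of \<open>c\<close>, for the three coordinatewise risk bounds.\<close>

definition risk_const :: "real \<Rightarrow> nat \<Rightarrow> real" where
  "risk_const d k = (let s = sqrt (2 ^ k); R = 4 * (ln s + d + 2) in
     ((4 * s / (1 - d) + 1) * (8 * d + 8 * s) / ((1 - (1/2) powr d) / s) + (16 + 2 * R) * 2 ^ k)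
     + (real k * (1 + sqrt R * (4 + 8 * s)) + (2 * R + 8 * s)))"

context eig_model
begin

lemma eig_posterior_eq:
  "eig_posterior d c S n X = density (\<Pi>\<^sub>M i\<in>{1..n}. prior) (\<lambda>\<theta>. \<Prod>i=1..n. ennreal (lik (X i) (\<theta> i) / evid (X i)))"
proof -
  interpret product_sigma_finite "\<lambda>_::nat. prior" by standard
  have "(\<integral>\<theta>. (\<Prod>i=1..n. mvn_density (\<theta> i) S (X i)) \<partial>(\<Pi>\<^sub>M i\<in>{1..n}. prior)) = (\<Prod>i=1..n. evid (X i) / gauss_const)"
    unfolding mvn_density_eq
    by (subst product_integral_prod) (auto simp: integrable_lik evid_def)
  moreover have "(\<Prod>i=1..n. mvn_density (\<theta> i) S (X i)) / (\<Prod>i=1..n. evid (X i) / gauss_const)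
     = (\<Prod>i=1..n. lik (X i) (\<theta> i) / evid (X i))" for \<theta>
    unfolding prod_dividef[symmetric] mvn_density_eq using gauss_const_pos by (intro prod.cong) auto
  moreover have "ennreal (\<Prod>i=1..n. lik (X i) (\<theta> i) / evid (X i)) = (\<Prod>i=1..n. ennreal (lik (X i) (\<theta> i) / evid (X i)))" for \<theta>
    using lik_bounds(1) evid_nonneg by (intro prod_ennreal[symmetric]) (auto simp: less_imp_le)
  ultimately show ?thesis unfolding eig_posterior_def bayes_posterior_def by simp
qed

text \<open>The prior and the likelihood are products, so the other coordinates integrate to \<open>1\<close>.\<close>

lemma nn_integral_eig_posterior:
  assumes f[measurable]: "f \<in> borel_measurable borel" and i: "i \<in> {1..n}"
  shows "(\<integral>\<^sup>+\<theta>. f (\<theta> i) \<partial>eig_posterior d c S n X) = (\<integral>\<^sup>+\<theta>. f \<theta> \<partial>post (X i))"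
proof -
  interpret product_sigma_finite "\<lambda>_::nat. prior" by standard
  let ?F = "\<lambda>j \<theta>. ennreal (lik (X j) \<theta> / evid (X j)) * (if j = i then f \<theta> else 1)"
  have m: "?F j \<in> borel_measurable prior" for j by measurable
  have comp[measurable]: "(\<lambda>\<theta>. \<theta> j) \<in> measurable (\<Pi>\<^sub>M i\<in>{1..n}. prior) borel" if "j \<in> {1..n}" for j
    using measurable_component_singleton[OF that, of "\<lambda>_. prior"] by (simp add: measurable_cong_sets[OF refl sets_prior])
  have m1: "(\<lambda>\<theta>. \<Prod>j=1..n. ennreal (lik (X j) (\<theta> j) / evid (X j))) \<in> borel_measurable (\<Pi>\<^sub>M i\<in>{1..n}. prior)"
    by (intro borel_measurable_prod_ennreal) measurable
  have m2: "(\<lambda>\<theta>. f (\<theta> i)) \<in> borel_measurable (\<Pi>\<^sub>M i\<in>{1..n}. prior)" using comp[OF i] by measurable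
  have "(\<integral>\<^sup>+\<theta>. f (\<theta> i) \<partial>eig_posterior d c S n X)
    = (\<integral>\<^sup>+\<theta>. (\<Prod>j=1..n. ennreal (lik (X j) (\<theta> j) / evid (X j))) * f (\<theta> i) \<partial>(\<Pi>\<^sub>M i\<in>{1..n}. prior))"
    unfolding eig_posterior_eq by (rule nn_integral_density[OF m1 m2])
  also have "\<dots> = (\<integral>\<^sup>+\<theta>. (\<Prod>j=1..n. ?F j (\<theta> j)) \<partial>(\<Pi>\<^sub>M i\<in>{1..n}. prior))"
    using i by (simp add: prod.distrib prod.delta)
  also have "\<dots> = (\<Prod>j=1..n. \<integral>\<^sup>+\<theta>. ?F j \<theta> \<partial>prior)"
    by (rule product_nn_integral_prod[OF _ m]) simp
  also have "\<dots> = (\<Prod>j=1..n. if j = i then (\<integral>\<^sup>+\<theta>. f \<theta> \<partial>post (X i)) else 1)"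
    by (intro prod.cong refl) (simp add: nn_integral_post nn_integral_lik_evid)
  also have "\<dots> = (\<integral>\<^sup>+\<theta>. f \<theta> \<partial>post (X i))" using i by (simp add: prod.delta)
  finally show ?thesis .
qed

text \<open>Markov's inequality reduces a statement on the joint posterior to expectations under the posteriors of
  single means.\<close>

lemma posterior_markov:
  assumes B: "B > 0"
    and g[measurable]: "\<And>i. g i \<in> borel_measurable borel" and nn: "\<And>i \<theta>. g i \<theta> \<ge> 0"
  shows "emeasure (eig_posterior d c S n X) {\<theta> \<in> space (eig_posterior d c S n X). (\<Sum>i=1..n. g i (\<theta> i)) > B}
    \<le> ennreal (1 / B) * (\<Sum>i=1..n. \<integral>\<^sup>+\<theta>. ennreal (g i \<theta>) \<partial>post (X i))"
proof -
  let ?P = "eig_posterior d c S n X"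
  have sP: "sets ?P = sets (\<Pi>\<^sub>M i\<in>{1..n}. prior)" unfolding eig_posterior_eq by simp
  have comp: "(\<lambda>\<theta>. \<theta> j) \<in> measurable ?P borel" if "j \<in> {1..n}" for j
    using measurable_component_singleton[OF that, of "\<lambda>_. prior"]
    by (simp add: measurable_cong_sets[OF sP sets_prior[symmetric]] )
  have m: "(\<lambda>\<theta>. ennreal (g i (\<theta> i))) \<in> borel_measurable ?P" if "i \<in> {1..n}" for i
    by (intro measurable_compose[OF _ measurable_ennreal] measurable_compose[OF comp[OF that] g])
  have mu: "(\<lambda>\<theta>. \<Sum>i=1..n. ennreal (g i (\<theta> i))) \<in> borel_measurable ?P"
    by (intro borel_measurable_sum m)
  have sub: "{\<theta> \<in> space ?P. (\<Sum>i=1..n. g i (\<theta> i)) > B} \<subseteq> {\<theta> \<in> space ?P. 1 \<le> ennreal (1 / B) * (\<Sum>i=1..n. ennreal (g i (\<theta> i)))}"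
  proof safe
    fix \<theta> assume "B < (\<Sum>i=1..n. g i (\<theta> i))"
    then have "1 \<le> 1 / B * (\<Sum>i=1..n. g i (\<theta> i))" using B by (simp add: field_simps)
    then have "ennreal 1 \<le> ennreal (1 / B * (\<Sum>i=1..n. g i (\<theta> i)))" by (rule ennreal_leI)
    also have "\<dots> = ennreal (1 / B) * ennreal (\<Sum>i=1..n. g i (\<theta> i))" using B by (intro ennreal_mult') simp
    also have "ennreal (\<Sum>i=1..n. g i (\<theta> i)) = (\<Sum>i=1..n. ennreal (g i (\<theta> i)))" using nn by (intro sum_ennreal[symmetric])
    finally show "1 \<le> ennreal (1 / B) * (\<Sum>i=1..n. ennreal (g i (\<theta> i)))" by simp
  qed
  have "{\<theta> \<in> space ?P. 1 \<le> ennreal (1 / B) * (\<Sum>i=1..n. ennreal (g i (\<theta> i)))} \<in> sets ?P"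
    using mu by measurable
  then have "emeasure ?P {\<theta> \<in> space ?P. (\<Sum>i=1..n. g i (\<theta> i)) > B} \<le> emeasure ?P {\<theta> \<in> space ?P. 1 \<le> ennreal (1 / B) * (\<Sum>i=1..n. ennreal (g i (\<theta> i)))}"
    by (rule emeasure_mono[OF sub])
  also have "\<dots> \<le> ennreal (1 / B) * (\<integral>\<^sup>+\<theta>. (\<Sum>i=1..n. ennreal (g i (\<theta> i))) * indicator (space ?P) \<theta> \<partial>?P)"
    by (intro nn_integral_Markov_inequality borel_measurable_times_ennreal mu borel_measurable_indicator sets.top)
  also have "(\<integral>\<^sup>+\<theta>. (\<Sum>i=1..n. ennreal (g i (\<theta> i))) * indicator (space ?P) \<theta> \<partial>?P) = (\<integral>\<^sup>+\<theta>. (\<Sum>i=1..n. ennreal (g i (\<theta> i))) \<partial>?P)"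
    by (intro nn_integral_cong) simp
  also have "\<dots> = (\<Sum>i=1..n. \<integral>\<^sup>+\<theta>. ennreal (g i (\<theta> i)) \<partial>?P)"
    by (rule nn_integral_sum) (rule m)
  also have "\<dots> = (\<Sum>i=1..n. \<integral>\<^sup>+\<theta>. ennreal (g i \<theta>) \<partial>post (X i))"
    by (intro sum.cong refl nn_integral_eig_posterior) measurable
  finally show ?thesis .
qed

lemma sparse_sum_le:
  assumes \<theta>\<^sub>0: "\<theta>\<^sub>0 \<in> nearly_black n q" and nn: "Z \<ge> 0" "V \<ge> 0"
    and null: "\<And>i. i \<in> {1..n} \<Longrightarrow> \<theta>\<^sub>0 i = 0 \<Longrightarrow> E i \<le> ennreal Z"
    and signal: "\<And>i. i \<in> {1..n} \<Longrightarrow> E i \<le> ennreal V"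
  shows "(\<Sum>i=1..n. E i) \<le> ennreal (real n * Z + real q * V)"
proof -
  have "(\<Sum>i=1..n. E i) \<le> (\<Sum>i=1..n. ennreal (Z + of_bool (\<theta>\<^sub>0 i \<noteq> 0) * V))"
  proof (rule sum_mono)
    fix i assume i: "i \<in> {1..n}"
    show "E i \<le> ennreal (Z + of_bool (\<theta>\<^sub>0 i \<noteq> 0) * V)"
      using null[OF i] signal[OF i] nn by (cases "\<theta>\<^sub>0 i = 0") (auto intro: order_trans ennreal_leI)
  qed
  also have "\<dots> = ennreal (\<Sum>i=1..n. Z + of_bool (\<theta>\<^sub>0 i \<noteq> 0) * V)" using nn by (intro sum_ennreal) auto
  also have "(\<Sum>i=1..n. Z + of_bool (\<theta>\<^sub>0 i \<noteq> 0) * V) = real n * Z + real (\<Sum>i=1..n. of_bool (\<theta>\<^sub>0 i \<noteq> 0)) * V"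
    by (simp add: sum.distrib sum_distrib_right)
  also have "ennreal \<dots> \<le> ennreal (real n * Z + real q * V)"
  proof (intro ennreal_leI add_left_mono mult_right_mono nn)
    have "(\<Sum>i=1..n. of_bool (\<theta>\<^sub>0 i \<noteq> 0)) \<le> q" using \<theta>\<^sub>0 unfolding nearly_black_def by simp
    then show "real (\<Sum>i=1..n. of_bool (\<theta>\<^sub>0 i \<noteq> 0)) \<le> real q" by (simp only: of_nat_le_iff)
  qed
  finally show ?thesis .
qed

lemma risk_bounds:
  defines "l \<equiv> 1 + ln (1 / c)" and "C \<equiv> risk_const d CARD('k)"
  shows "C > 0" and "(\<integral>\<^sup>+x. post_sq x \<partial>mvn 0 S) \<le> ennreal (C * c powr d * l)"
    and "(\<integral>\<^sup>+x. post_var x \<partial>mvn \<mu> S) \<le> ennreal (C * sqrt l)"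
    and "(\<integral>\<^sup>+x. post_err \<mu> x \<partial>mvn \<mu> S) \<le> ennreal (C * l)"
proof -
  define s where "s = sqrt (2 ^ CARD('k))"
  define R where "R = 4 * (ln s + d + 2)"
  have s: "s \<ge> 1" unfolding s_def by simp
  have lns: "ln s \<ge> 0" using s by simp
  have R: "R \<ge> 0" unfolding R_def using d lns by simp
  have l: "l \<ge> 1" unfolding l_def using c by simp
  define C1 where "C1 = trunc_const * (8 * d + 8 * s) / evid_const + (16 + 2 * R) * 2 ^ CARD('k)"
  define C2 where "C2 = real CARD('k) * (1 + sqrt R * shift_const)"
  define C3 where "C3 = 2 * R + 8 * s"
  have C: "C = C1 + (C2 + C3)"
    unfolding C_def risk_const_def Let_def C1_def C2_def C3_def trunc_const_def evid_const_def shift_const_def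
      R_def s_def by simp
  have tc: "trunc_const \<ge> 0" unfolding trunc_const_def using d by simp
  have sc: "shift_const \<ge> 0" unfolding shift_const_def by simp
  have C1: "C1 \<ge> 0" unfolding C1_def using tc d s R evid_const_pos by simp
  have C2: "C2 \<ge> 0" unfolding C2_def using sc R by simp
  have C3: "C3 > 0" unfolding C3_def using R s by simp
  show "C > 0" using C C1 C2 C3 by simp
  have rb: "resid_bound \<le> R * l"
  proof -
    have "ln flat_const = ln s + (d + 1) * (ln 2 + ln (1 / c))"
      unfolding flat_const_def s_def using c by (simp add: ln_mult ln_powr ln_div)
    moreover have "ln 2 \<le> (1::real)" using ln_2_less_1 by simp
    moreover have "(d + 1) * (ln 2 + ln (1 / c)) \<le> (d + 1) * l" using d \<open>ln 2 \<le> (1::real)\<close> by (intro mult_left_mono) (auto simp: l_def)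
    moreover have "(ln s + 1) * 1 \<le> (ln s + 1) * l" using lns l by (intro mult_left_mono) auto
    ultimately have "ln flat_const + 1 \<le> (ln s + 1) * l + (d + 1) * l"
      using add_mono[of "(ln s + 1) * 1" "(ln s + 1) * l" "(d + 1) * (ln 2 + ln (1 / c))" "(d + 1) * l"] by (simp only: mult_1_right)
    also have "\<dots> = (ln s + d + 2) * l" by (simp add: algebra_simps)
    finally have "4 * (ln flat_const + 1) \<le> 4 * ((ln s + d + 2) * l)" by (intro mult_left_mono) auto
    then show ?thesis unfolding resid_bound_def R_def by (simp only: mult.assoc)
  qed
  have rb0: "resid_bound \<ge> 0" using resid_bound_ge by simp
  show "(\<integral>\<^sup>+x. post_sq x \<partial>mvn 0 S) \<le> ennreal (C * c powr d * l)"
  proof (rule order_trans[OF null_risk], rule ennreal_leI)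
    have 1: "8 * d * ln (1 / c) + 8 * s \<le> (8 * d + 8 * s) * l"
    proof -
      have "8 * d * ln (1 / c) \<le> 8 * d * l" using d by (intro mult_left_mono) (auto simp: l_def)
      moreover have "8 * s * 1 \<le> 8 * s * l" using s l by (intro mult_left_mono) auto
      ultimately show ?thesis unfolding distrib_right by linarith
    qed
    have 2: "trunc_const * (8 * d * ln (1 / c) + 8 * s) / evid_const \<le> trunc_const * ((8 * d + 8 * s) * l) / evid_const"
      using evid_const_pos by (intro divide_right_mono mult_left_mono 1 tc) auto
    have 3: "(16 + 2 * resid_bound) * 2 ^ CARD('k) \<le> ((16 + 2 * R) * l) * 2 ^ CARD('k)"
    proof (rule mult_right_mono)
      have "16 + 2 * resid_bound \<le> 16 * l + 2 * (R * l)" using rb l by linarith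
      then show "16 + 2 * resid_bound \<le> (16 + 2 * R) * l" by (simp add: algebra_simps)
    qed simp
    have "trunc_const * (8 * d * ln (1 / c) + 8 * s) / evid_const + (16 + 2 * resid_bound) * 2 ^ CARD('k)
       \<le> trunc_const * ((8 * d + 8 * s) * l) / evid_const + ((16 + 2 * R) * l) * 2 ^ CARD('k)"
      using 2 3 by (rule add_mono)
    also have "\<dots> = C1 * l" unfolding C1_def by (simp add: distrib_right)
    also have "\<dots> \<le> C * l" using C C2 C3 l by (intro mult_right_mono) auto
    finally have le: "trunc_const * (8 * d * ln (1 / c) + 8 * s) / evid_const + (16 + 2 * resid_bound) * 2 ^ CARD('k) \<le> C * l" .
    have e: "C * c powr d * l = c powr d * (C * l)" by simp
    show "c powr d * (trunc_const * (8 * d * ln (1 / c) + 8 * sqrt (2 ^ CARD('k))) / evid_const + (16 + 2 * resid_bound) * 2 ^ CARD('k))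
       \<le> C * c powr d * l"
      unfolding e s_def[symmetric] by (rule mult_left_mono[OF le]) simp
  qed
  show "(\<integral>\<^sup>+x. post_var x \<partial>mvn \<mu> S) \<le> ennreal (C * sqrt l)"
  proof (rule order_trans[OF post_var_risk], rule ennreal_leI)
    have "sqrt resid_bound \<le> sqrt (R * l)" using rb by (rule real_sqrt_le_mono)
    then have "sqrt resid_bound * shift_const \<le> (sqrt R * sqrt l) * shift_const"
      using sc by (intro mult_right_mono) (auto simp: real_sqrt_mult)
    moreover have "1 \<le> sqrt l" using l by simp
    ultimately have "1 + sqrt resid_bound * shift_const \<le> sqrt l + (sqrt R * sqrt l) * shift_const" by linarith
    also have "\<dots> = (1 + sqrt R * shift_const) * sqrt l" by (simp add: algebra_simps)
    finally have "1 + sqrt resid_bound * shift_const \<le> (1 + sqrt R * shift_const) * sqrt l" .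
    then have "real CARD('k) * (1 + sqrt resid_bound * shift_const) \<le> real CARD('k) * ((1 + sqrt R * shift_const) * sqrt l)"
      by (intro mult_left_mono) auto
    also have "\<dots> = C2 * sqrt l" unfolding C2_def by simp
    also have "\<dots> \<le> C * sqrt l" using C C1 C3 l by (intro mult_right_mono) auto
    finally show "real CARD('k) * (1 + sqrt resid_bound * shift_const) \<le> C * sqrt l" .
  qed
  show "(\<integral>\<^sup>+x. post_err \<mu> x \<partial>mvn \<mu> S) \<le> ennreal (C * l)"
  proof (rule order_trans[OF post_err_risk], rule ennreal_leI)
    have "8 * s * 1 \<le> 8 * s * l" using s l by (intro mult_left_mono) auto
    then have "2 * resid_bound + 8 * s \<le> C3 * l" using rb unfolding C3_def distrib_right by linarith
    also have "\<dots> \<le> C * l" using C C1 C2 l by (intro mult_right_mono) auto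
    finally show "2 * resid_bound + 8 * sqrt (2 ^ CARD('k)) \<le> C * l" unfolding s_def .
  qed
qed

text \<open>The reduction common to both claims: at most \<open>q\<close> coordinates contribute \<open>V\<close>, the others contribute \<open>Z\<close>.\<close>

lemma sparse_risk:
  fixes P :: "(nat \<Rightarrow> real^'k) \<Rightarrow> ennreal" and E :: "nat \<Rightarrow> real^'k \<Rightarrow> ennreal"
  assumes \<theta>\<^sub>0: "\<theta>\<^sub>0 \<in> nearly_black n q" and B: "B > 0" and Z: "Z \<ge> 0" and V: "V \<ge> 0"
    and P: "\<And>X. P X \<le> ennreal (1 / B) * (\<Sum>i=1..n. E i (X i))"
    and E: "\<And>i. E i \<in> borel_measurable borel"
    and null: "\<And>i. \<theta>\<^sub>0 i = 0 \<Longrightarrow> (\<integral>\<^sup>+x. E i x \<partial>mvn (\<theta>\<^sub>0 i) S) \<le> ennreal Z"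
    and signal: "\<And>i. (\<integral>\<^sup>+x. E i x \<partial>mvn (\<theta>\<^sub>0 i) S) \<le> ennreal V"
  shows "(\<integral>\<^sup>+X. P X \<partial>data_law S n \<theta>\<^sub>0) \<le> ennreal ((real n * Z + real q * V) / B)"
proof -
  have sets: "sets (mvn (\<theta>\<^sub>0 i) S) = sets borel" for i unfolding mvn_def by simp
  have comp: "(\<lambda>X. X i) \<in> measurable (data_law S n \<theta>\<^sub>0) borel" if "i \<in> {1..n}" for i
    using measurable_component_singleton[OF that, of "\<lambda>i. mvn (\<theta>\<^sub>0 i) S"]
    unfolding data_law_def by (simp add: measurable_cong_sets[OF refl sets_mvn])
  have m: "(\<lambda>X. \<Sum>i=1..n. E i (X i)) \<in> borel_measurable (data_law S n \<theta>\<^sub>0)"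
    by (intro borel_measurable_sum measurable_compose[OF comp E])
  have "(\<integral>\<^sup>+X. P X \<partial>data_law S n \<theta>\<^sub>0) \<le> (\<integral>\<^sup>+X. ennreal (1 / B) * (\<Sum>i=1..n. E i (X i)) \<partial>data_law S n \<theta>\<^sub>0)"
    by (intro nn_integral_mono P)
  also have "\<dots> = ennreal (1 / B) * (\<integral>\<^sup>+X. (\<Sum>i=1..n. E i (X i)) \<partial>data_law S n \<theta>\<^sub>0)"
    by (rule nn_integral_cmult[OF m])
  also have "\<dots> = ennreal (1 / B) * (\<Sum>i=1..n. \<integral>\<^sup>+x. E i x \<partial>mvn (\<theta>\<^sub>0 i) S)"
    by (subst nn_integral_data_law) (use E in auto)
  also have "\<dots> \<le> ennreal (1 / B) * ennreal (real n * (Z) + real q * V)"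
    by (intro mult_left_mono sparse_sum_le[OF \<theta>\<^sub>0] Z V null signal) simp_all
  also have "\<dots> = ennreal ((real n * (Z) + real q * V) / B)"
    using B by (subst ennreal_mult'[symmetric]) auto
  finally show ?thesis .
qed

lemma posterior_risk:
  assumes \<theta>\<^sub>0: "\<theta>\<^sub>0 \<in> nearly_black n q" and B: "B > 0"
  defines "l \<equiv> 1 + ln (1 / c)" and "C \<equiv> risk_const d CARD('k)"
  shows "(\<integral>\<^sup>+X. emeasure (eig_posterior d c S n X)
           {\<theta> \<in> space (eig_posterior d c S n X).
              (\<Sum>i=1..n. (mahalanobis S (\<theta> i - eig_estimator d c S (X i)))\<^sup>2) > B} \<partial>data_law S n \<theta>\<^sub>0)
    \<le> ennreal ((real n * (C * c powr d * l) + real q * (C * sqrt l)) / B)" (is ?spread)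
    and "(\<integral>\<^sup>+X. emeasure (eig_posterior d c S n X)
           {\<theta> \<in> space (eig_posterior d c S n X).
              (\<Sum>i=1..n. (mahalanobis S (\<theta> i - \<theta>\<^sub>0 i))\<^sup>2) > B} \<partial>data_law S n \<theta>\<^sub>0)
    \<le> ennreal ((real n * (C * c powr d * l) + real q * (C * l)) / B)" (is ?error)
proof -
  note rb = risk_bounds[folded l_def C_def]
  have l: "l \<ge> 0" unfolding l_def using c by simp
  have nn: "C * c powr d * l \<ge> 0" "C * sqrt l \<ge> 0" "C * l \<ge> 0" using rb(1) l by auto
  have meas: "(\<lambda>\<theta>. (mahalanobis S (\<theta> - a))\<^sup>2) \<in> borel_measurable borel" for a
    unfolding mahalanobis_eq by measurable
  show ?spread
  proof (rule sparse_risk[OF \<theta>\<^sub>0 B nn(1,2), where E="\<lambda>_. post_var"])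
    show "emeasure (eig_posterior d c S n X) {\<theta> \<in> space (eig_posterior d c S n X).
        (\<Sum>i=1..n. (mahalanobis S (\<theta> i - eig_estimator d c S (X i)))\<^sup>2) > B} \<le> ennreal (1 / B) * (\<Sum>i=1..n. post_var (X i))" for X
      using posterior_markov[OF B, of "\<lambda>i \<theta>. (mahalanobis S (\<theta> - eig_estimator d c S (X i)))\<^sup>2", OF meas]
      by (simp add: post_var_def mahalanobis_eq)
    show "(\<integral>\<^sup>+x. post_var x \<partial>mvn (\<theta>\<^sub>0 i) S) \<le> ennreal (C * c powr d * l)" if "\<theta>\<^sub>0 i = 0" for i
      unfolding that by (rule order_trans[OF nn_integral_mono rb(2)]) (rule post_var_le_post_sq)
  qed (use nn rb in auto)
  show ?error
  proof (rule sparse_risk[OF \<theta>\<^sub>0 B nn(1,3), where E="\<lambda>i. post_err (\<theta>\<^sub>0 i)"])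
    show "emeasure (eig_posterior d c S n X) {\<theta> \<in> space (eig_posterior d c S n X).
        (\<Sum>i=1..n. (mahalanobis S (\<theta> i - \<theta>\<^sub>0 i))\<^sup>2) > B} \<le> ennreal (1 / B) * (\<Sum>i=1..n. post_err (\<theta>\<^sub>0 i) (X i))" for X
      using posterior_markov[OF B, of "\<lambda>i \<theta>. (mahalanobis S (\<theta> - \<theta>\<^sub>0 i))\<^sup>2", OF meas]
      by (simp add: post_err_def mahalanobis_eq)
    show "(\<integral>\<^sup>+x. post_err (\<theta>\<^sub>0 i) x \<partial>mvn (\<theta>\<^sub>0 i) S) \<le> ennreal (C * c powr d * l)" if "\<theta>\<^sub>0 i = 0" for i
      unfolding that post_err_zero by (rule rb(2))
  qed (use nn rb in auto)
qed

end

theorem theorem5: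
  fixes S :: "real^'k^'k" and d :: real and q :: "nat \<Rightarrow> nat" and c \<epsilon> :: "nat \<Rightarrow> real"
  assumes d: "0 < d" "d < 1"
    and S: "pos_def_mat S" "0 < lambda_min S" "lambda_min S \<le> lambda_max S"
    and q: "\<And>n. n \<ge> 1 \<Longrightarrow> q n > 0" "(\<lambda>n. real (q n)) \<in> o(\<lambda>n. real n)"
    and c: "\<And>n. n \<ge> 1 \<Longrightarrow> c n > 0" "c \<longlonglongrightarrow> 0"
    and eps: "\<forall>\<^sub>F n in sequentially. \<epsilon> n = 1 / ln (ln (real n / real (q n)))"
    and c_eq: "\<forall>\<^sub>F n in sequentially. c n = (real (q n) / real n) powr ((1 + \<epsilon> n) / d)"
  shows
    "((\<lambda>n. SUP \<theta>\<^sub>0\<in>nearly_black n (q n).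
         \<integral>\<^sup>+ X. emeasure (eig_posterior d (c n) S n X)
           {\<theta> \<in> space (eig_posterior d (c n) S n X).
              (\<Sum>i=1..n. (mahalanobis S (\<theta> i - eig_estimator d (c n) S (X i)))\<^sup>2)
                > real (q n) * ln (real n / real (q n))}
         \<partial>data_law S n \<theta>\<^sub>0) \<longlonglongrightarrow> 0) \<and>
     (\<forall>M :: nat \<Rightarrow> real. filterlim M at_top sequentially \<longrightarrow>
       limsup (\<lambda>n. SUP \<theta>\<^sub>0\<in>nearly_black n (q n).
         \<integral>\<^sup>+ X. emeasure (eig_posterior d (c n) S n X)
           {\<theta> \<in> space (eig_posterior d (c n) S n X).
              (\<Sum>i=1..n. (mahalanobis S (\<theta> i - \<theta>\<^sub>0 i))\<^sup>2)
                > M n * real (q n) * ln (real n / real (q n))}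
         \<partial>data_law S n \<theta>\<^sub>0) = 0)"
proof -
  obtain W :: "real^'k^'k" where W: "invertible W" "matrix_inv S = transpose W ** W" "(det W)\<^sup>2 * det S = 1"
    using pos_def_whitening[OF S(1)] .
  define C where "C = risk_const d CARD('k)"
  define L where "L n = ln (real n / real (q n))" for n
  have L_top: "filterlim L at_top sequentially"
  proof -
    have "((\<lambda>n. real (q n) / real n) \<longlongrightarrow> 0) sequentially" using q(2) by (rule smalloD_tendsto)
    moreover have "\<forall>\<^sub>F n in sequentially. real (q n) / real n > 0"
      using eventually_ge_at_top[of 1] by eventually_elim (use q(1) in auto)
    ultimately have "filterlim (\<lambda>n. inverse (real (q n) / real n)) at_top sequentially"
      by (rule filterlim_inverse_at_top)
    then have "filterlim (\<lambda>n. real n / real (q n)) at_top sequentially" by simp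
    then show ?thesis unfolding L_def by (rule filterlim_compose[OF ln_at_top])
  qed
  \<comment> \<open>\<open>G (L n)\<close> bounds the contribution of the zero means relative to \<open>q n\<close>.\<close>
  define G where "G x = exp (- x / ln x) * (1 + 2 * x / d)" for x :: real
  define good where "good n \<longleftrightarrow> eig_model S W d (c n) \<and> n \<ge> 1 \<and> L n \<ge> 1 \<and> C > 0 \<and>
     1 + ln (1 / c n) \<le> 1 + 2 * L n / d \<and> real n * (c n powr d * (1 + ln (1 / c n))) \<le> real (q n) * G (L n)" for n
  \<comment> \<open>\<open>L n > exp 1\<close> ensures \<open>ln (L n) > 1\<close>, hence \<open>\<epsilon> n \<le> 1\<close>.\<close>
  have good: "\<forall>\<^sub>F n in sequentially. good n"
    using eps c_eq eventually_ge_at_top[of 1] filterlim_at_top_dense[THEN iffD1, OF L_top, rule_format, of "exp 1"]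
  proof eventually_elim
    case (elim n)
    have Lpos: "L n > exp 1" using elim by simp
    have Lgt: "L n > 1" using Lpos by (metis exp_gt_one less_trans zero_less_one)
    have lnL: "ln (L n) > 1" using Lpos Lgt by (metis exp_gt_zero ln_exp ln_less_cancel_iff less_trans zero_less_one)
    have eps: "\<epsilon> n = 1 / ln (L n)" using elim unfolding L_def by simp
    have e: "0 < \<epsilon> n" "\<epsilon> n \<le> 1" using lnL unfolding eps by auto
    have qn: "real (q n) > 0" "real n > 0" using q(1)[OF elim(3)] elim(3) by auto
    have lc: "ln (c n) = - ((1 + \<epsilon> n) / d * L n)"
    proof -
      have "ln (c n) = (1 + \<epsilon> n) / d * ln (real (q n) / real n)" using elim qn by (simp add: ln_powr)
      also have "ln (real (q n) / real n) = - L n" unfolding L_def using qn by (simp add: ln_div)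
      finally show ?thesis by simp
    qed
    have cpos: "c n > 0" by (rule c(1)[OF elim(3)])
    have "ln (c n) \<le> 0" unfolding lc using e d Lgt by simp
    then have c1: "c n \<le> 1" using cpos by (simp add: ln_le_zero_iff)
    have m: "eig_model S W d (c n)"
      unfolding eig_model_def whitened_def eig_model_axioms_def using W d cpos c1 by simp
    have lb: "1 + ln (1 / c n) \<le> 1 + 2 * L n / d"
    proof -
      have "(1 + \<epsilon> n) / d * L n \<le> 2 / d * L n"
        using e d Lgt by (intro mult_right_mono divide_right_mono) auto
      then show ?thesis using cpos lc by (simp add: ln_div)
    qed
    have "real n * c n powr d = real (q n) * exp (- L n / ln (L n))"
    proof -
      have "c n powr d = exp (d * ln (c n))" using cpos by (simp add: powr_def)
      also have "d * ln (c n) = - L n + (- L n / ln (L n))" unfolding lc using d by (simp add: eps field_simps)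
      also have "exp \<dots> = exp (- L n) * exp (- L n / ln (L n))" by (rule exp_add)
      also have "exp (- L n) = real (q n) / real n" unfolding L_def using qn by (simp add: exp_minus)
      finally show ?thesis using qn by simp
    qed
    then have "real n * (c n powr d * (1 + ln (1 / c n))) = real (q n) * exp (- L n / ln (L n)) * (1 + ln (1 / c n))"
      by (simp add: mult.assoc[symmetric])
    also have "\<dots> \<le> real (q n) * exp (- L n / ln (L n)) * (1 + 2 * L n / d)" using lb by (intro mult_left_mono) auto
    finally have g: "real n * (c n powr d * (1 + ln (1 / c n))) \<le> real (q n) * G (L n)" unfolding G_def by (simp add: mult.assoc)
    have "C > 0" unfolding C_def by (rule eig_model.risk_bounds(1)[OF m])
    with m lb g Lgt elim show ?case unfolding good_def by auto
  qed
  have ratio: "(real n * (C * c n powr d * (1 + ln (1 / c n))) + real (q n) * (C * v)) / (m * real (q n) * L n)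
      \<le> C * (G (L n) + w) / L n * inverse m"
    if g: "good n" and m: "m > 0" and v: "v \<le> w" for n m v w
  proof -
    have g': "n \<ge> 1" "L n \<ge> 1" "C > 0" "real n * (c n powr d * (1 + ln (1 / c n))) \<le> real (q n) * G (L n)"
      using g unfolding good_def by auto
    have qn: "real (q n) > 0" using q(1)[OF g'(1)] by simp
    have "real n * (C * c n powr d * (1 + ln (1 / c n))) = C * (real n * (c n powr d * (1 + ln (1 / c n))))" by simp
    also have "\<dots> \<le> C * (real (q n) * G (L n))" by (rule mult_left_mono[OF g'(4)]) (use g' in simp)
    finally have 1: "real n * (C * c n powr d * (1 + ln (1 / c n))) \<le> real (q n) * (C * G (L n))" by (simp add: mult_ac)
    have "C * v \<le> C * w" by (rule mult_left_mono[OF v]) (use g' in simp)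
    then have "real (q n) * (C * v) \<le> real (q n) * (C * w)" by (rule mult_left_mono) simp
    with 1 have "real n * (C * c n powr d * (1 + ln (1 / c n))) + real (q n) * (C * v) \<le> real (q n) * (C * (G (L n) + w))"
      unfolding distrib_left by linarith
    then have "(real n * (C * c n powr d * (1 + ln (1 / c n))) + real (q n) * (C * v)) / (m * real (q n) * L n)
      \<le> real (q n) * (C * (G (L n) + w)) / (m * real (q n) * L n)"
      using m qn g' by (intro divide_right_mono) auto
    also have "\<dots> = C * (G (L n) + w) / L n * inverse m" using m qn g' by (simp add: field_simps)
    finally show ?thesis .
  qed
  have lim1: "(\<lambda>n. C * (G (L n) + sqrt (1 + 2 * L n / d)) / L n) \<longlonglongrightarrow> 0"
  proof -
    have "((\<lambda>x. C * (G x + sqrt (1 + 2 * x / d)) / x) \<longlongrightarrow> 0) at_top"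
      unfolding G_def using d by real_asymp
    then show ?thesis by (rule filterlim_compose[OF _ L_top])
  qed
  have lim2: "(\<lambda>n. C * (G (L n) + (1 + 2 * L n / d)) / L n * inverse (M n)) \<longlonglongrightarrow> 0" if M: "filterlim M at_top sequentially" for M :: "nat \<Rightarrow> real"
  proof -
    have "((\<lambda>x. C * (G x + (1 + 2 * x / d)) / x) \<longlongrightarrow> C * (2 * inverse d)) at_top"
      unfolding G_def using d by real_asymp
    then have "(\<lambda>n. C * (G (L n) + (1 + 2 * L n / d)) / L n) \<longlonglongrightarrow> C * (2 * inverse d)"
      by (rule filterlim_compose[OF _ L_top])
    moreover have "(\<lambda>n. inverse (M n)) \<longlonglongrightarrow> 0" by (rule filterlim_compose[OF tendsto_inverse_0_at_top[OF filterlim_ident] M])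
    ultimately have "(\<lambda>n. C * (G (L n) + (1 + 2 * L n / d)) / L n * inverse (M n)) \<longlonglongrightarrow> C * (2 * inverse d) * 0"
      by (rule tendsto_mult)
    then show ?thesis by simp
  qed
  have squeeze: "F \<longlonglongrightarrow> 0" if "\<forall>\<^sub>F n in sequentially. F n \<le> ennreal (f n)" "f \<longlonglongrightarrow> 0" for F :: "nat \<Rightarrow> ennreal" and f
  proof (rule tendsto_sandwich[where f="\<lambda>_. 0" and h="\<lambda>n. ennreal (f n)"])
    show "(\<lambda>n. ennreal (f n)) \<longlonglongrightarrow> 0" using tendsto_ennrealI[OF that(2)] by simp
  qed (use that in auto)
  show ?thesis
  proof (intro conjI allI impI, goal_cases)
    case 1
    show ?case
    proof (rule squeeze[OF _ lim1], use good in eventually_elim)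
      case (elim n)
      have m: "eig_model S W d (c n)" and B: "real (q n) * L n > 0" and "sqrt (1 + ln (1 / c n)) \<le> sqrt (1 + 2 * L n / d)"
        using elim q(1)[of n] unfolding good_def by simp_all
      from ratio[OF elim zero_less_one this(3)]
      have "(real n * (C * c n powr d * (1 + ln (1 / c n))) + real (q n) * (C * sqrt (1 + ln (1 / c n)))) / (real (q n) * L n)
        \<le> C * (G (L n) + sqrt (1 + 2 * L n / d)) / L n" by simp
      note le = order_trans[OF eig_model.posterior_risk(1)[OF m _ B, folded C_def] ennreal_leI[OF this], unfolded L_def]
      show ?case unfolding L_def by (rule SUP_least) (rule le)
    qed
  next
    case (2 M)
    then have M0: "\<forall>\<^sub>F n in sequentially. M n > 0" by (simp add: filterlim_at_top_dense)
    show ?case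
    proof (rule lim_imp_Limsup[OF _ squeeze[OF _ lim2[OF 2]]], simp, use good M0 in eventually_elim)
      case (elim n)
      have m: "eig_model S W d (c n)" and B: "M n * real (q n) * L n > 0" and "1 + ln (1 / c n) \<le> 1 + 2 * L n / d"
        using elim q(1)[of n] unfolding good_def by simp_all
      note le = order_trans[OF eig_model.posterior_risk(2)[OF m _ B, folded C_def] ennreal_leI[OF ratio[OF elim this(3)]], unfolded L_def]
      show ?case unfolding L_def by (rule SUP_least) (rule le)
    qed
  qed
qed

end
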